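(* Let $a,b,k$ be positive integers with $a\le b$. Then $$G^C_{w(a,b,k)}=GQ^{(\beta)}_{\tau(a,b)}.$$
   Context: For positive integers $a,b,k$ put $\ell=a+k$, $n=a+b+k$, and let $w(a,b,k)\in S_n\subset W_n$ be the permutation with one-line notation $1\,2\cdots k\ \ \ell{+}1\ \ \ell{+}2\cdots n\ \ k{+}1\ \ k{+}2\cdots\ell$. For $a\le b$, $\tau(a,b)=(a+b-1,\,a+b-3,\,\dots,\,b-a+1)$, a strict partition with $a$ parts. **Signed permutations.** $W_n$ is the group of bijections $w$ of $\{-n,\dots,-1,1,\dots,n\}$ with $w(-i)=-w(i)$, written in one-line notation $w(1)\cdots w(n)$; Coxeter generators $s_0=(-1\ 1)$, $s_i=(-i{-}1\ \,{-}i)(i\ \,i{+}1)$ for $1\le i\le n-1$; $S_n\subset W_n$ consists of those $w$ with $w(i)>0$ for $i>0$. **$G^C_w$.** Let $u_0,\dots,u_{n-1}$ be noncommuting variables (commuting with $\beta$ and $x_1,x_2,\dots$) with $u_i^2=\beta u_i$, $u_1u_0u_1u_0=u_0u_1u_0u_1$, $u_iu_{i+1}u_i=u_{i+1}u_iu_{i+1}$ ($i>0$), $u_iu_j=u_ju_i$ ($|i-j|>1$). For $w\in W_n$ with reduced word $(a_1,\dots,a_m)$ put $u_w=u_{a_1}\cdots u_{a_m}$. $G^C_w$ is the coefficient of $u_w$ in $$\prod_{i\ge1}(1+x_iu_{n-1})\cdots(1+x_iu_1)(1+x_iu_0)(1+x_iu_0)(1+x_iu_1)\cdots(1+x_iu_{n-1}),$$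 the product taken in order $i=1,2,\dots$ from left to right. **$GQ$.** A strict partition is $\lambda=(\lambda_1>\dots>\lambda_r>0)$, with shifted diagram $D_\lambda=\{(i,j):1\le i\le r,\ i\le j\le\lambda_i+i-1\}$. Order $\mathbb{Z}\setminus\{0\}$ by $\bar1\prec1\prec\bar2\prec2\prec\cdots$, where $\bar a=-a$. A shifted set-valued semistandard tableau of shape $\lambda$ is a filling $T$ of $D_\lambda$ by finite nonempty subsets of $\mathbb{Z}\setminus\{0\}$ with $\max T_{ij}\preceq\min T_{i+1,j}$, equality allowed only for negative values, and $\max T_{ij}\preceq\min T_{i,j+1}$, equality allowed only for positive values ($\max,\min$ with respect to $\prec$). With $|T|=\sum|T_{ij}|$ and $x^T=\prod_{(i,j)}\prod_{s\in T_{ij}}x_{|s|}$, set $GQ^{(\beta)}_\lambda=\sum_T\beta^{|T|-|\lambda|}x^T$. *)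

theory Defs
  imports
    "HOL-Library.Poly_Mapping"
    "HOL-Library.FuncSet"
    "HOL-Computational_Algebra.Polynomial"
    "HOL-Combinatorics.Permutations"
begin

text \<open>
  Formal power series over \<open>\<int>[\<beta>]\<close> in the commuting variables \<open>x\<^sub>1, x\<^sub>2, \<dots>\<close> are functions from
  exponent vectors (finitely supported functions) to \<open>int poly\<close>, the polynomial variable
  being \<open>\<beta>\<close>. The index \<open>0\<close> is unused: no series below involves \<open>x\<^sub>0\<close>.
\<close>

type_synonym exponent = "nat \<Rightarrow>\<^sub>0 nat"
type_synonym power_series = "exponent \<Rightarrow> int poly"

abbreviation beta :: "int poly" where
  "beta \<equiv> [:0, 1:]"


subsection \<open>Signed permutations\<close>

text \<open>Elements of \<open>W\<^sub>n\<close> are extended to all of \<open>int\<close> by the identity.\<close>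

definition signed_perms :: "nat \<Rightarrow> (int \<Rightarrow> int) set" where
  "signed_perms n = {w. w permutes ({- int n..int n} - {0}) \<and> (\<forall>i. w (- i) = - w i)}"

definition gen :: "nat \<Rightarrow> int \<Rightarrow> int" where
  "gen i = (if i = 0 then transpose (- 1) 1
            else transpose (- int i - 1) (- int i) \<circ> transpose (int i) (int i + 1))"

definition word_prod :: "nat list \<Rightarrow> int \<Rightarrow> int" where
  "word_prod as = foldr (\<circ>) (map gen as) id"

definition reduced_word :: "nat \<Rightarrow> (int \<Rightarrow> int) \<Rightarrow> nat list \<Rightarrow> bool" where
  "reduced_word n w as \<longleftrightarrow> set as \<subseteq> {..<n} \<and> word_prod as = w \<and>
     (\<forall>bs. set bs \<subseteq> {..<n} \<and> word_prod bs = w \<longrightarrow> length as \<le> length bs)"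

definition one_line :: "int list \<Rightarrow> int \<Rightarrow> int" where
  "one_line xs i = (if 1 \<le> \<bar>i\<bar> \<and> \<bar>i\<bar> \<le> int (length xs) then sgn i * xs ! (nat \<bar>i\<bar> - 1) else i)"

definition w_perm :: "nat \<Rightarrow> nat \<Rightarrow> nat \<Rightarrow> int \<Rightarrow> int" where
  "w_perm a b k = (let l = int (a + k); n = int (a + b + k) in
     one_line ([1..int k] @ [l + 1..n] @ [int k + 1..l]))"


subsection \<open>The algebra generated by \<open>u\<^sub>0, \<dots>, u\<^sub>n\<^sub>-\<^sub>1\<close>\<close>

text \<open>Words under concatenation, written additively as required for keys of \<open>poly_mapping\<close>.\<close>

datatype word = Word (letters: "nat list")

instantiation word :: monoid_add
begin

definition zero_word :: word where
  "0 = Word []"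

definition plus_word :: "word \<Rightarrow> word \<Rightarrow> word" where
  "v + w = Word (letters v @ letters w)"

instance
  by standard (auto simp: zero_word_def plus_word_def)

end

text \<open>The free associative \<open>\<int>[\<beta>]\<close>-algebra on \<open>u\<^sub>0, u\<^sub>1, \<dots>\<close>, and its subalgebra on \<open>u\<^sub>0, \<dots>, u\<^sub>n\<^sub>-\<^sub>1\<close>.\<close>

type_synonym free_algebra = "word \<Rightarrow>\<^sub>0 int poly"

definition free_subalgebra :: "nat \<Rightarrow> free_algebra set" where
  "free_subalgebra n = {p. \<forall>v \<in> Poly_Mapping.keys p. set (letters v) \<subseteq> {..<n}}"

definition scalar :: "int poly \<Rightarrow> free_algebra" where
  "scalar c = Poly_Mapping.single 0 c"

definition u :: "nat \<Rightarrow> free_algebra" where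
  "u i = Poly_Mapping.single (Word [i]) 1"

definition relators :: "nat \<Rightarrow> free_algebra set" where
  "relators n =
     {u i ^ 2 - scalar beta * u i | i. i < n} \<union>
     (if 1 < n then {u 1 * u 0 * u 1 * u 0 - u 0 * u 1 * u 0 * u 1} else {}) \<union>
     {u i * u (i + 1) * u i - u (i + 1) * u i * u (i + 1) | i. 0 < i \<and> i + 1 < n} \<union>
     {u i * u j - u j * u i | i j. i < n \<and> j < n \<and> \<bar>int i - int j\<bar> > 1}"

text \<open>
  The two-sided ideal of \<open>free_subalgebra n\<close> generated by \<open>relators n\<close>. The algebra of the \<open>u\<^sub>i\<close>
  is the quotient; we compute with representatives modulo this ideal, since a quotient type
  cannot depend on \<open>n\<close>.
\<close>

inductive_set relation_ideal :: "nat \<Rightarrow> free_algebra set" for n where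
  zero: "0 \<in> relation_ideal n"
| relator: "r \<in> relators n \<Longrightarrow> r \<in> relation_ideal n"
| add: "p \<in> relation_ideal n \<Longrightarrow> q \<in> relation_ideal n \<Longrightarrow> p + q \<in> relation_ideal n"
| mult_left: "p \<in> relation_ideal n \<Longrightarrow> f \<in> free_subalgebra n \<Longrightarrow> f * p \<in> relation_ideal n"
| mult_right: "p \<in> relation_ideal n \<Longrightarrow> f \<in> free_subalgebra n \<Longrightarrow> p * f \<in> relation_ideal n"

text \<open>Modulo \<open>relation_ideal n\<close> the choice of the reduced word is immaterial.\<close>

definition u_perm :: "nat \<Rightarrow> (int \<Rightarrow> int) \<Rightarrow> free_algebra" where
  "u_perm n w = prod_list (map u (SOME as. reduced_word n w as))"

text \<open>
  The classes of the \<open>u\<^sub>w\<close>, \<open>w \<in> W\<^sub>n\<close>, form a \<open>\<int>[\<beta>]\<close>-basis of the quotient, so exactly one family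
  \<open>c\<close> as below exists for each \<open>p\<close> in \<open>free_subalgebra n\<close>.
\<close>

definition u_coeff :: "nat \<Rightarrow> free_algebra \<Rightarrow> (int \<Rightarrow> int) \<Rightarrow> int poly" where
  "u_coeff n p = (THE c. (\<forall>w. w \<notin> signed_perms n \<longrightarrow> c w = 0) \<and>
     p - (\<Sum>w\<in>signed_perms n. scalar (c w) * u_perm n w) \<in> relation_ideal n)"


subsection \<open>The series \<open>G\<^sup>C\<^sub>w\<close>\<close>

text \<open>
  Polynomials in the \<open>x\<^sub>i\<close> with coefficients in the free algebra have type
  \<open>exponent \<Rightarrow>\<^sub>0 free_algebra\<close>; the \<open>x\<^sub>i\<close> commute with the coefficients.
\<close>

definition lin_factor :: "nat \<Rightarrow> nat \<Rightarrow> exponent \<Rightarrow>\<^sub>0 free_algebra" where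
  "lin_factor i j = 1 + Poly_Mapping.single (Poly_Mapping.single i 1) (u j)"

definition var_factor :: "nat \<Rightarrow> nat \<Rightarrow> exponent \<Rightarrow>\<^sub>0 free_algebra" where
  "var_factor n i = prod_list (map (lin_factor i) (rev [0..<n])) *
                    prod_list (map (lin_factor i) [0..<n])"

definition partial_product :: "nat \<Rightarrow> nat \<Rightarrow> exponent \<Rightarrow>\<^sub>0 free_algebra" where
  "partial_product n N = prod_list (map (var_factor n) [1..<Suc N])"

text \<open>The infinite product: each coefficient of the partial products is eventually constant.\<close>

definition infinite_product :: "nat \<Rightarrow> exponent \<Rightarrow> free_algebra" where
  "infinite_product n \<alpha> =
     (THE c. \<forall>\<^sub>F N in sequentially. Poly_Mapping.lookup (partial_product n N) \<alpha> = c)"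

definition GC :: "nat \<Rightarrow> (int \<Rightarrow> int) \<Rightarrow> power_series" where
  "GC n w = (\<lambda>\<alpha>. u_coeff n (infinite_product n \<alpha>) w)"


subsection \<open>The series \<open>GQ\<^sub>\<lambda>\<close>\<close>

definition strict_partition :: "nat list \<Rightarrow> bool" where
  "strict_partition lam \<longleftrightarrow> sorted_wrt (>) lam \<and> (\<forall>x \<in> set lam. 0 < x)"

definition shifted_diagram :: "nat list \<Rightarrow> (nat \<times> nat) set" where
  "shifted_diagram lam =
     {(i, j). 1 \<le> i \<and> i \<le> length lam \<and> i \<le> j \<and> j \<le> lam ! (i - 1) + i - 1}"

text \<open>The order \<open>-1 \<prec> 1 \<prec> -2 \<prec> 2 \<prec> \<dots>\<close> on nonzero integers.\<close>

definition prec_eq :: "int \<Rightarrow> int \<Rightarrow> bool" (infix "\<preceq>" 50) where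
  "s \<preceq> t \<longleftrightarrow> \<bar>s\<bar> < \<bar>t\<bar> \<or> (\<bar>s\<bar> = \<bar>t\<bar> \<and> s \<le> t)"

definition prec_max :: "int set \<Rightarrow> int" where
  "prec_max S = (THE m. m \<in> S \<and> (\<forall>s\<in>S. s \<preceq> m))"

definition prec_min :: "int set \<Rightarrow> int" where
  "prec_min S = (THE m. m \<in> S \<and> (\<forall>s\<in>S. m \<preceq> s))"

definition shifted_tableaux :: "nat list \<Rightarrow> (nat \<times> nat \<Rightarrow> int set) set" where
  "shifted_tableaux lam =
     {T \<in> shifted_diagram lam \<rightarrow>\<^sub>E {S. finite S \<and> S \<noteq> {} \<and> 0 \<notin> S}.
        (\<forall>i j. (i, j) \<in> shifted_diagram lam \<and> (i + 1, j) \<in> shifted_diagram lam \<longrightarrow>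
           prec_max (T (i, j)) \<preceq> prec_min (T (i + 1, j)) \<and>
           (prec_max (T (i, j)) = prec_min (T (i + 1, j)) \<longrightarrow> prec_max (T (i, j)) < 0)) \<and>
        (\<forall>i j. (i, j) \<in> shifted_diagram lam \<and> (i, j + 1) \<in> shifted_diagram lam \<longrightarrow>
           prec_max (T (i, j)) \<preceq> prec_min (T (i, j + 1)) \<and>
           (prec_max (T (i, j)) = prec_min (T (i, j + 1)) \<longrightarrow> prec_max (T (i, j)) > 0))}"

definition tableau_size :: "nat list \<Rightarrow> (nat \<times> nat \<Rightarrow> int set) \<Rightarrow> nat" where
  "tableau_size lam T = (\<Sum>c\<in>shifted_diagram lam. card (T c))"

definition tableau_weight :: "nat list \<Rightarrow> (nat \<times> nat \<Rightarrow> int set) \<Rightarrow> exponent" where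
  "tableau_weight lam T =
     (\<Sum>c\<in>shifted_diagram lam. \<Sum>s\<in>T c. Poly_Mapping.single (nat \<bar>s\<bar>) 1)"

text \<open>
  Only finitely many tableaux have a given weight, and \<open>sum_list lam \<le> tableau_size lam T\<close>
  because all entries are nonempty.
\<close>

definition GQ :: "nat list \<Rightarrow> power_series" where
  "GQ lam = (\<lambda>\<alpha>. \<Sum>T\<in>{T \<in> shifted_tableaux lam. tableau_weight lam T = \<alpha>}.
     beta ^ (tableau_size lam T - sum_list lam))"

definition tau :: "nat \<Rightarrow> nat \<Rightarrow> nat list" where
  "tau a b = map (\<lambda>i. a + b - 1 - 2 * i) [0..<a]"

lemma strict_partition_tau:
  assumes "a \<le> b"
  shows "strict_partition (tau a b)"
  using assms by (auto simp: strict_partition_def tau_def sorted_wrt_iff_nth_less)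

end

theory Submission
  imports Defs Complex_Main
begin

text \<open>
  Truncated to finitely many variables and evaluated at positive reals, both series are matrix
  entries of products of commuting row operators on functions of finite sets \<open>S\<close> of positive
  integers. For \<open>G\<^sup>C\<close>, the set \<open>S\<close> records, after the first \<open>k\<close> places, the positions of the
  \<open>a\<close> smallest of the remaining values of a Grassmannian permutation; \<open>u\<^sub>0, \<dots>, u\<^sub>k\<close> act by zero and
  \<open>u\<^sub>k\<^sub>+\<^sub>i\<close> moves an element of \<open>S\<close> from \<open>i + 1\<close> to \<open>i\<close>. For \<open>GQ\<close>, the set \<open>S\<close> consists of the parts of a
  strict partition, and entering a letter in a cell of content \<open>i\<close> is the same move, except that
  at content \<open>0\<close> a part \<open>1\<close> is created.

  Let the row of one variable have an independent parameter \<open>y\<close> for its upward half. At a set of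
  size \<open>a\<close> the value is then a polynomial in \<open>y\<close> of degree at most \<open>a\<close>, and when \<open>y\<close> is the inverse,
  for \<open>x \<oplus> y = x + y + \<beta> x y\<close>, of another variable, two rows merge into one. By interpolation both
  series are determined by their values in at most \<open>a\<close> variables. These vanish in fewer than \<open>a\<close>
  variables, and both equal \<open>\<Prod>\<^sub>i x\<^sub>i\<^bsup>b-a\<^esup> \<Prod>\<^sub>i\<^sub>,\<^sub>j (x\<^sub>i \<oplus> x\<^sub>j)\<close> in exactly \<open>a\<close> variables.
\<close>

subsection \<open>Row operators\<close>

text \<open>No bijection between the terms of the two series is constructed: each is pinned down by
  the same interpolation data. The engine is that the upward half of a row at
  \<open>\<ominus> w\<close> undoes the downward half of a row at \<open>w\<close>. Positive real
  \<open>\<beta>\<close> and parameters make \<open>1 + \<beta> * w\<close> nonzero, so these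
  inverses exist. The obstacle is commutation: a row must be moved next to another before they
  merge. Without creation at content \<open>0\<close>, rows with independent halves commute, so
  every upward parameter can be freed; with creation the reflection equation needs equal halves, so
  only the first row can be freed. Hence the values in exactly \<open>a\<close> variables need two
  separate computations. The coefficient of \<open>u_perm n w\<close> is a definite description,
  accessible only once these elements are known to be a basis of the quotient: braid moves between
  reduced words give spanning, and the right regular module gives independence and reads off the
  coefficient.\<close>

type_synonym vec = "nat set \<Rightarrow> real"

locale site_model =
  fixes \<beta> :: real
  assumes beta_pos: "0 < \<beta>"
begin

definition oplus :: "real \<Rightarrow> real \<Rightarrow> real" (infixl "\<oplus>" 65) where
  "x \<oplus> y = x + y + \<beta> * x * y"

definition inv_add :: "real \<Rightarrow> real" ("\<ominus> _" [81] 80) where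
  "\<ominus> x = - x / (1 + \<beta> * x)"

text \<open>This is \<open>1 + x * u\<close>, where \<open>u\<close> gives
  \<open>\<beta> * F S\<close> plus the value after the move if the move is possible, and zero
  otherwise. After a move the same move is impossible, whence
  \<open>u * u = \<beta> * u\<close>.\<close>

definition hop :: "nat \<Rightarrow> real \<Rightarrow> vec \<Rightarrow> vec" where
  "hop i x F S = (if i \<notin> S \<and> Suc i \<in> S
     then (1 + \<beta> * x) * F S + x * F (insert i (S - {Suc i})) else F S)"

definition create :: "real \<Rightarrow> vec \<Rightarrow> vec" where
  "create x F S = (if 1 \<in> S then (1 + \<beta> * x) * F S + x * F (S - {1}) else F S)"

lemma oplus_commute: "x \<oplus> y = y \<oplus> x"
  by (simp add: oplus_def algebra_simps)

lemma oplus_assoc: "x \<oplus> y \<oplus> z = x \<oplus> (y \<oplus> z)"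
  by (simp add: oplus_def algebra_simps)

lemma oplus_0 [simp]: "x \<oplus> 0 = x" "0 \<oplus> x = x"
  by (simp_all add: oplus_def)

lemma oplus_inv_add: "1 + \<beta> * x \<noteq> 0 \<Longrightarrow> x \<oplus> \<ominus> x = 0" "1 + \<beta> * x \<noteq> 0 \<Longrightarrow> \<ominus> x \<oplus> x = 0"
  by (simp_all add: oplus_def inv_add_def field_simps)

lemma oplus_pos: "0 < x \<Longrightarrow> 0 < y \<Longrightarrow> 0 < x \<oplus> y"
  using beta_pos by (simp add: oplus_def add_pos_pos)

lemma hop_0 [simp]: "hop i 0 F = F"
  by (rule ext) (simp add: hop_def)

lemma create_0 [simp]: "create 0 F = F"
  by (rule ext) (simp add: create_def)

text \<open>From \<open>u * u = \<beta> * u\<close>: the factors \<open>1 + x * u\<close> multiply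
  by the formal group law \<open>\<oplus>\<close> of their parameters.\<close>

lemma hop_hop: "hop i x (hop i y F) = hop i (x \<oplus> y) F"
  by (rule ext) (auto simp: hop_def oplus_def algebra_simps)

lemma create_create: "create x (create y F) = create (x \<oplus> y) F"
  by (rule ext) (auto simp: create_def oplus_def algebra_simps)

lemma hop_commute:
  assumes "Suc i < j" shows "hop i x (hop j y F) = hop j y (hop i x F)"
proof
  fix S
  have "insert i (insert j (S - {Suc j}) - {Suc i}) = insert j (insert i (S - {Suc i}) - {Suc j})"
    using assms by auto
  then show "hop i x (hop j y F) S = hop j y (hop i x F) S"
    using assms by (auto simp: hop_def algebra_simps)
qed

lemma create_hop_commute:
  assumes "1 < j" shows "create x (hop j y F) = hop j y (create x F)"
proof
  fix S
  have "insert j (S - {1} - {Suc j}) = insert j (S - {Suc j}) - {1}"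
    using assms by auto
  then show "create x (hop j y F) S = hop j y (create x F) S"
    using assms by (auto simp: hop_def create_def algebra_simps)
qed

text \<open>The Yang-Baxter equation: the braid relation holds with parameters when the middle one
  is the sum of the outer ones. Only the three sites involved matter, hence eight cases.\<close>

lemma hop_braid:
  "hop i x (hop (Suc i) (x \<oplus> y) (hop i y F)) = hop (Suc i) y (hop i (x \<oplus> y) (hop (Suc i) x F))"
proof
  fix S
  have e: "insert i (insert (Suc i) (S - {Suc (Suc i)}) - {Suc i}) = insert i (S - {Suc (Suc i)})"
    if "Suc i \<notin> S" using that by auto
  have e2: "insert (Suc i) (insert i (S - {Suc i}) - {Suc (Suc i)}) = insert i (insert (Suc i) (S - {Suc (Suc i)}))"
    if "Suc i \<in> S" using that by auto
  have e3: "insert (Suc i) (S - {Suc (Suc i)}) = S - {Suc (Suc i)}"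
    if "Suc i \<in> S" using that by auto
  show "hop i x (hop (Suc i) (x \<oplus> y) (hop i y F)) S = hop (Suc i) y (hop i (x \<oplus> y) (hop (Suc i) x F)) S"
    by (cases "i \<in> S"; cases "Suc i \<in> S"; cases "Suc (Suc i) \<in> S")
      (simp_all add: hop_def e e2 e3 oplus_def algebra_simps)
qed

lemma oplus_inv_add_cancel:
  assumes "1 + \<beta> * y \<noteq> 0"
  shows "x \<oplus> \<ominus> y \<oplus> y = x" "y \<oplus> (x \<oplus> \<ominus> y) = x"
proof -
  show "x \<oplus> \<ominus> y \<oplus> y = x"
    using assms by (simp add: oplus_inv_add oplus_assoc)
  then show "y \<oplus> (x \<oplus> \<ominus> y) = x"
    by (simp add: oplus_commute)
qed

text \<open>The reflection equation in its smallest instance, the counterpart with parameters of the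
  four-term braid relation between contents \<open>0\<close> and \<open>1\<close>.\<close>

lemma create_braid:
  assumes "1 + \<beta> * y \<noteq> 0"
  shows "hop 1 (x \<oplus> \<ominus> y) (create (x \<oplus> x) (hop 1 (x \<oplus> y) (create (y \<oplus> y) F)))
     = create (y \<oplus> y) (hop 1 (y \<oplus> x) (create (x \<oplus> x) (hop 1 (x \<oplus> \<ominus> y) F)))"
proof
  fix S
  \<comment> \<open>Writing \<open>x\<close> as \<open>d \<oplus> y\<close> removes the division
    hidden in \<open>\<ominus> y\<close>, so each case becomes a polynomial identity.\<close>
  define d where "d = x \<oplus> \<ominus> y"
  have x: "x = d + y + \<beta> * d * y"
    using oplus_inv_add_cancel(1)[OF assms, of x] unfolding d_def[symmetric] by (simp add: oplus_def)
  show "hop 1 (x \<oplus> \<ominus> y) (create (x \<oplus> x) (hop 1 (x \<oplus> y) (create (y \<oplus> y) F))) S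
     = create (y \<oplus> y) (hop 1 (y \<oplus> x) (create (x \<oplus> x) (hop 1 (x \<oplus> \<ominus> y) F))) S"
    unfolding d_def[symmetric]
    by (cases "1 \<in> S"; cases "2 \<in> S")
      (simp_all add: hop_def create_def numeral_2_eq_2 oplus_def x algebra_simps)
qed

section \<open>Rows: commutation and merging\<close>

fun down :: "nat \<Rightarrow> real \<Rightarrow> vec \<Rightarrow> vec" where
  "down 0 x F = F"
| "down (Suc m) x F = hop (Suc m) x (down m x F)"

fun up :: "nat \<Rightarrow> real \<Rightarrow> vec \<Rightarrow> vec" where
  "up 0 x F = F"
| "up (Suc m) x F = up m x (hop (Suc m) x F)"

text \<open>A row meets content \<open>0\<close> twice, once in each half, and the two factors merge
  into one with parameter \<open>x \<oplus> y\<close>. Without a wall (\<open>c = False\<close>)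
  these factors are the identity.\<close>

definition wall :: "bool \<Rightarrow> real \<Rightarrow> real \<Rightarrow> vec \<Rightarrow> vec" where
  "wall c x y F = (if c then create (x \<oplus> y) F else F)"

definition row :: "bool \<Rightarrow> nat \<Rightarrow> real \<Rightarrow> real \<Rightarrow> vec \<Rightarrow> vec" where
  "row c m x y F = down m x (wall c x y (up m y F))"

lemma row_0: "row c 0 x y F = wall c x y F"
  by (simp add: row_def)

lemma row_Suc: "row c (Suc m) x y F = hop (Suc m) x (row c m x y (hop (Suc m) y F))"
  by (simp add: row_def)

lemma wall_hop_commute: "1 < j \<Longrightarrow> wall c x y (hop j z F) = hop j z (wall c x y F)"
  by (simp add: wall_def create_hop_commute)

lemma row_hop_commute: "Suc m < j \<Longrightarrow> row c m x y (hop j z F) = hop j z (row c m x y F)"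
proof (induction m arbitrary: F)
  case 0
  then show ?case by (simp add: row_0 wall_hop_commute)
next
  case (Suc m)
  then show ?case by (simp add: row_Suc hop_commute)
qed

text \<open>The reflection equation. At the wall (\<open>c = True\<close>) it only holds with equal parameters.\<close>

lemma row_reflection:
  assumes c: "c \<Longrightarrow> x = x' \<and> y = y'"
    and y: "1 + \<beta> * y \<noteq> 0" "1 + \<beta> * y' \<noteq> 0"
  shows "hop (Suc m) (x \<oplus> \<ominus> y) (row c m x x' (hop (Suc m) (x' \<oplus> y) (row c m y y' F)))
    = row c m y y' (hop (Suc m) (y' \<oplus> x) (row c m x x' (hop (Suc m) (x' \<oplus> \<ominus> y') F)))"
proof (induction m arbitrary: F)
  case 0
  show ?case
  proof (cases c)
    case True
    then show ?thesis using c create_braid[OF y(1), of x F] by (simp add: row_0 wall_def oplus_commute)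
  next
    case False
    \<comment> \<open>Without a wall all hops sit at site \<open>1\<close> and merge; both sides
      have total parameter \<open>x \<oplus> x'\<close>.\<close>
    have "x \<oplus> \<ominus> y \<oplus> (x' \<oplus> y) = x \<oplus> x' \<oplus> (y \<oplus> \<ominus> y)"
      by (simp add: oplus_def algebra_simps)
    moreover have "y' \<oplus> x \<oplus> (x' \<oplus> \<ominus> y') = x \<oplus> x' \<oplus> (y' \<oplus> \<ominus> y')"
      by (simp add: oplus_def algebra_simps)
    ultimately show ?thesis using False y by (simp add: row_0 wall_def hop_hop oplus_inv_add)
  qed
next
  case (Suc m)
  define k where "k = Suc m"
  have cm: "row c m p q (hop (Suc k) z G) = hop (Suc k) z (row c m p q G)" for p q z G
    by (rule row_hop_commute) (simp add: k_def)
  \<comment> \<open>\<open>b1\<close> and \<open>b2\<close> carry the hops at site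
    \<open>k + 1\<close> past those at \<open>k\<close>; what remains around the inner rows is an
    instance of the induction hypothesis at site \<open>k\<close>.\<close>
  have b1: "hop k p (hop (Suc k) (p \<oplus> q) (hop k q G)) = hop (Suc k) q (hop k (p \<oplus> q) (hop (Suc k) p G))" for p q G
    by (rule hop_braid)
  have b2: "hop (Suc k) p (hop k (p \<oplus> q) (hop (Suc k) q G)) = hop k q (hop (Suc k) (p \<oplus> q) (hop k p G))" for p q G
    using hop_braid[of k q p G] by (simp add: oplus_commute)
  have xy: "x \<oplus> \<ominus> y \<oplus> y = x" "x' \<oplus> \<ominus> y' \<oplus> y' = x'"
    using y by (simp_all add: oplus_inv_add_cancel)
  have "hop (Suc k) (x \<oplus> \<ominus> y) (row c k x x' (hop (Suc k) (x' \<oplus> y) (row c k y y' F)))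
      = hop (Suc k) (x \<oplus> \<ominus> y) (hop k x (row c m x x' (hop k x' (hop (Suc k) (x' \<oplus> y) (hop k y (row c m y y' (hop k y' F)))))))"
    by (simp add: k_def row_Suc)
  also have "\<dots> = hop (Suc k) (x \<oplus> \<ominus> y) (hop k x (hop (Suc k) y (row c m x x' (hop k (x' \<oplus> y) (row c m y y' (hop (Suc k) x' (hop k y' F)))))))"
    by (simp add: b1 cm)
  also have "\<dots> = hop k y (hop (Suc k) x (hop k (x \<oplus> \<ominus> y) (row c m x x' (hop k (x' \<oplus> y) (row c m y y' (hop (Suc k) x' (hop k y' F)))))))"
    using b2[of "x \<oplus> \<ominus> y" y] by (simp add: xy)
  also have "\<dots> = hop k y (hop (Suc k) x (row c m y y' (hop k (y' \<oplus> x) (row c m x x' (hop k (x' \<oplus> \<ominus> y') (hop (Suc k) x' (hop k y' F)))))))"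
    by (simp add: Suc.IH[folded k_def])
  also have "\<dots> = hop k y (hop (Suc k) x (row c m y y' (hop k (y' \<oplus> x) (row c m x x' (hop (Suc k) y' (hop k x' (hop (Suc k) (x' \<oplus> \<ominus> y') F)))))))"
    using b1[of "x' \<oplus> \<ominus> y'" y'] by (simp add: xy)
  also have "\<dots> = hop k y (row c m y y' (hop (Suc k) x (hop k (x \<oplus> y') (hop (Suc k) y' (row c m x x' (hop k x' (hop (Suc k) (x' \<oplus> \<ominus> y') F)))))))"
    by (simp add: cm oplus_commute)
  also have "\<dots> = hop k y (row c m y y' (hop k y' (hop (Suc k) (y' \<oplus> x) (hop k x (row c m x x' (hop k x' (hop (Suc k) (x' \<oplus> \<ominus> y') F)))))))"
    by (simp add: b2 oplus_commute)
  also have "\<dots> = row c k y y' (hop (Suc k) (y' \<oplus> x) (row c k x x' (hop (Suc k) (x' \<oplus> \<ominus> y') F)))"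
    by (simp add: k_def row_Suc)
  finally show ?case unfolding k_def .
qed

text \<open>The outermost hop \<open>x\<close> is split into \<open>y\<close> and the surplus
  \<open>x \<oplus> \<ominus> y\<close>. The reflection equation carries the surplus through both
  inner rows; it emerges as \<open>x' \<oplus> \<ominus> y'\<close> and combines with
  \<open>y'\<close> to the missing \<open>x'\<close>.\<close>

lemma row_commute:
  assumes c: "c \<Longrightarrow> x = x' \<and> y = y'"
    and y: "1 + \<beta> * y \<noteq> 0" "1 + \<beta> * y' \<noteq> 0"
  shows "row c m x x' (row c m y y' F) = row c m y y' (row c m x x' F)"
proof (cases m)
  case 0
  then show ?thesis by (simp add: row_0 wall_def create_create oplus_commute)
next
  case (Suc k)
  have "row c m x x' (row c m y y' F)
      = hop m y (hop m (x \<oplus> \<ominus> y) (row c k x x' (hop m (x' \<oplus> y) (row c k y y' (hop m y' F)))))"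
    using y by (simp add: Suc row_Suc hop_hop oplus_inv_add_cancel)
  also have "\<dots> = hop m y (row c k y y' (hop m (y' \<oplus> x) (row c k x x' (hop m (x' \<oplus> \<ominus> y') (hop m y' F)))))"
    using row_reflection[where m = k and F = "hop m y' F", OF c y] by (simp add: Suc)
  also have "\<dots> = row c m y y' (row c m x x' F)"
    using y by (simp add: Suc row_Suc hop_hop oplus_inv_add_cancel)
  finally show ?thesis .
qed

lemma up_down: "1 + \<beta> * x \<noteq> 0 \<Longrightarrow> up m (\<ominus> x) (down m x F) = F"
  by (induction m arbitrary: F) (simp_all add: hop_hop oplus_inv_add)

lemma down_up: "1 + \<beta> * x \<noteq> 0 \<Longrightarrow> down m x (up m (\<ominus> x) F) = F"
  by (induction m arbitrary: F) (simp_all add: hop_hop oplus_inv_add)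

lemma row_inv_add: "1 + \<beta> * x \<noteq> 0 \<Longrightarrow> row c m x (\<ominus> x) F = F"
  by (simp add: row_def wall_def oplus_inv_add down_up)

text \<open>The upward half at \<open>\<ominus> z\<close> cancels the downward half at
  \<open>z\<close>, and the wall parameters add up to \<open>x \<oplus> w\<close>. This is the
  merging that drives all interpolation arguments.\<close>

lemma row_row_merge:
  assumes "1 + \<beta> * z \<noteq> 0"
  shows "row c m x (\<ominus> z) (row c m z w F) = row c m x w F"
proof -
  have "x \<oplus> \<ominus> z \<oplus> (z \<oplus> w) = x \<oplus> w"
    using assms by (metis oplus_assoc oplus_inv_add_cancel(1))
  then show ?thesis
    using assms by (simp add: row_def wall_def up_down create_create)
qed

subsection \<open>Dependence on the upward parameter\<close>

definition deg_le :: "nat \<Rightarrow> (real \<Rightarrow> real) \<Rightarrow> bool" where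
  "deg_le d f \<longleftrightarrow> (\<exists>q. degree q \<le> d \<and> (\<forall>y. f y = poly q y))"

lemma deg_le_const: "deg_le d (\<lambda>y. k)"
  unfolding deg_le_def by (rule exI[of _ "[:k:]"]) simp

lemma deg_le_add: "deg_le d f \<Longrightarrow> deg_le d g \<Longrightarrow> deg_le d (\<lambda>y. f y + g y)"
  unfolding deg_le_def by (metis degree_add_le poly_add)

lemma deg_le_mult:
  assumes "deg_le d f" "deg_le e g" shows "deg_le (d + e) (\<lambda>y. f y * g y)"
proof -
  obtain p q where "degree p \<le> d" "\<forall>y. f y = poly p y" "degree q \<le> e" "\<forall>y. g y = poly q y"
    using assms unfolding deg_le_def by blast
  then show ?thesis
    unfolding deg_le_def using degree_mult_le[of p q] by (intro exI[of _ "p * q"]) auto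
qed

lemma deg_le_mono: "deg_le d f \<Longrightarrow> d \<le> e \<Longrightarrow> deg_le e f"
  unfolding deg_le_def using le_trans by blast

lemma deg_le_linear: "deg_le 1 (\<lambda>y. k + l * y)"
  unfolding deg_le_def by (rule exI[of _ "[:k, l:]"]) auto

lemma deg_le_scale: "deg_le d f \<Longrightarrow> deg_le d (\<lambda>y. k * f y)"
  using deg_le_mult[OF deg_le_const[where d = 0 and k = k]] by simp

lemma deg_le_linear_mult: "deg_le d f \<Longrightarrow> deg_le (Suc d) (\<lambda>y. (k + l * y) * f y)"
  using deg_le_mult[OF deg_le_linear] by (metis plus_1_eq_Suc)

lemma deg_le_unique:
  assumes "deg_le d f" "deg_le d g" "finite A" "d < card A" "\<And>y. y \<in> A \<Longrightarrow> f y = g y"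
  shows "f y = g y"
proof -
  obtain p q where pq: "degree p \<le> d" "\<forall>y. f y = poly p y" "degree q \<le> d" "\<forall>y. g y = poly q y"
    using assms unfolding deg_le_def by blast
  have "p = q"
    by (rule poly_eqI_degree[of A]) (use assms pq in auto)
  then show ?thesis using pq by simp
qed

lemma card_hop [simp]:
  assumes "finite S" "i \<notin> S" "Suc i \<in> S"
  shows "card (insert i (S - {Suc i})) = card S"
  using assms by (metis card_Suc_Diff1 card_insert_disjoint finite_Diff insert_Diff insert_iff)

text \<open>Seen from \<open>S\<close> the hops act in the order \<open>1, 2, ...\<close>, so each
  element above \<open>1\<close> is offered at most one move, and each offer raises the degree in
  \<open>y\<close> by at most one. The bound assumed for \<open>F\<close> counts the elements that
  have not yet been offered a move, which makes the induction work.\<close>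

lemma up_degree:
  assumes "\<And>S. finite S \<Longrightarrow> deg_le (card {j \<in> S. Suc m < j}) (\<lambda>y. F y S)" "finite S"
  shows "deg_le (card {j \<in> S. 1 < j}) (\<lambda>y. up m y (F y) S)"
  using assms
proof (induction m arbitrary: F S)
  case 0
  then show ?case by simp
next
  case (Suc m)
  have "deg_le (card {j \<in> S. Suc m < j}) (\<lambda>y. hop (Suc m) y (F y) S)" if "finite S" for S
  proof (cases "Suc m \<notin> S \<and> Suc (Suc m) \<in> S")
    case True
    let ?S = "insert (Suc m) (S - {Suc (Suc m)})"
    have "{j \<in> S. Suc m < j} = insert (Suc (Suc m)) {j \<in> S. Suc (Suc m) < j}"
      using True by (auto simp: less_Suc_eq)
    then have c: "card {j \<in> S. Suc m < j} = Suc (card {j \<in> S. Suc (Suc m) < j})"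
      using that by simp
    have "{j \<in> ?S. Suc (Suc m) < j} = {j \<in> S. Suc (Suc m) < j}" by auto
    then have "deg_le (card {j \<in> S. Suc (Suc m) < j}) (\<lambda>y. F y ?S)"
      using Suc.prems(1)[of ?S] that by simp
    then show ?thesis
      using True Suc.prems(1)[OF that] deg_le_linear_mult[of _ "\<lambda>y. F y S" 1 \<beta>] deg_le_linear_mult[of _ "\<lambda>y. F y ?S" 0 1]
      by (auto simp: c hop_def intro!: deg_le_add)
  next
    case False
    have "card {j \<in> S. Suc (Suc m) < j} \<le> card {j \<in> S. Suc m < j}"
      using that by (intro card_mono) auto
    then show ?thesis
      using False Suc.prems(1)[OF that] by (auto simp: hop_def intro: deg_le_mono)
  qed
  then show ?case using Suc.IH[of "\<lambda>y. hop (Suc m) y (F y)" S] Suc.prems(2) by simp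
qed

lemma up_degree_const:
  assumes "finite S" shows "deg_le (card {j \<in> S. 1 < j}) (\<lambda>y. up m y F S)"
  using up_degree[of m "\<lambda>y. F" S] assms deg_le_const by simp

text \<open>The downward half does not involve \<open>y\<close> and preserves cardinality, so a
  bound uniform over all sets of one size passes through it.\<close>

lemma down_degree:
  assumes "\<And>S. finite S \<Longrightarrow> card S = d \<Longrightarrow> deg_le e (\<lambda>y. F y S)" "finite S" "card S = d"
  shows "deg_le e (\<lambda>y. down m x (F y) S)"
  using assms(2,3)
proof (induction m arbitrary: S)
  case 0
  then show ?case using assms(1) by simp
next
  case (Suc m)
  show ?case
  proof (cases "Suc m \<notin> S \<and> Suc (Suc m) \<in> S")
    case True
    let ?S = "insert (Suc m) (S - {Suc (Suc m)})"
    have "deg_le e (\<lambda>y. down m x (F y) S)" "deg_le e (\<lambda>y. down m x (F y) ?S)"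
      using Suc True by (auto intro!: Suc.IH simp del: card_insert_disjoint)
    then have "deg_le e (\<lambda>y. (1 + \<beta> * x) * down m x (F y) S + x * down m x (F y) ?S)"
      by (intro deg_le_add deg_le_scale)
    then show ?thesis using True by (simp add: hop_def)
  next
    case False
    then have "hop (Suc m) x (down m x (F y)) S = down m x (F y) S" for y
      by (auto simp: hop_def)
    then show ?thesis using Suc.IH[OF Suc.prems] by simp
  qed
qed

text \<open>Elements above \<open>1\<close> cost one degree each in the upward half; the wall costs
  one more only if \<open>1\<close> is present.\<close>

lemma row_degree:
  assumes "finite S" shows "deg_le (card S) (\<lambda>y. row c m x y F S)"
proof -
  have "deg_le (card S) (\<lambda>y. wall c x y (up m y F) S)" if "finite S" for S
  proof -
    have le: "card {j \<in> S. 1 < j} \<le> card S" using that by (intro card_mono) auto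
    show ?thesis
    proof (cases "c \<and> 1 \<in> S")
      case True
      have "{j \<in> S. 1 < j} \<subseteq> S - {1}" "{j \<in> S - {1}. 1 < j} \<subseteq> S - {1}" by auto
      then have l: "card {j \<in> S. 1 < j} \<le> card (S - {1})" "card {j \<in> S - {1}. 1 < j} \<le> card (S - {1})"
        using that by (auto intro!: card_mono)
      have s: "card S = Suc (card (S - {1}))" using that True by (simp only: card_Suc_Diff1)
      have "deg_le (card S) (\<lambda>y. (1 + \<beta> * x + (\<beta> + \<beta> * \<beta> * x) * y) * up m y F S + (x + (1 + \<beta> * x) * y) * up m y F (S - {1}))"
        unfolding s using that l
        by (intro deg_le_add deg_le_linear_mult) (auto intro: deg_le_mono[OF up_degree_const])
      then show ?thesis using True by (simp add: wall_def create_def oplus_def algebra_simps)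
    next
      case False
      then show ?thesis
        using deg_le_mono[OF up_degree_const le] that by (cases c) (auto simp: wall_def create_def)
    qed
  qed
  then show ?thesis
    unfolding row_def
    by (intro down_degree[where d = "card S" and F = "\<lambda>y. wall c x y (up m y F)"]) (use assms in metis)+
qed

section \<open>Interpolation at the inverses of the parameters\<close>

lemma inv_add_neg: "0 < x \<Longrightarrow> \<ominus> x < 0"
  using beta_pos by (simp add: inv_add_def divide_neg_pos add_pos_pos)

lemma one_plus_nonzero: "0 < x \<Longrightarrow> 1 + \<beta> * x \<noteq> 0"
  using beta_pos add_pos_pos[OF zero_less_one mult_pos_pos[of \<beta> x]] by simp

lemma inv_add_inj: "0 < x \<Longrightarrow> 0 < y \<Longrightarrow> \<ominus> x = \<ominus> y \<Longrightarrow> x = y"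
  using one_plus_nonzero[of x] one_plus_nonzero[of y] by (simp add: inv_add_def field_simps)

lemma card_inv_add_image:
  assumes "finite W" "\<And>w. w \<in> W \<Longrightarrow> 0 < w" shows "card (inv_add ` W) = card W"
  using assms inv_add_inj by (intro card_image inj_onI) blast

text \<open>\<open>y \<oplus> w\<close> is linear in \<open>y\<close> with root
  \<open>\<ominus> w\<close>, and the product is normalised to \<open>1\<close> at
  \<open>y = 0\<close>. The nodes \<open>0\<close> and \<open>\<ominus> w\<close> are distinct since
  the latter are negative, and there is one more of them than the degree.\<close>

lemma root_form:
  assumes "deg_le (card W) f" "finite W" "\<And>w. w \<in> W \<Longrightarrow> 0 < w" "\<And>w. w \<in> W \<Longrightarrow> f (\<ominus> w) = 0"
  shows "f y = f 0 * (\<Prod>w\<in>W. (y \<oplus> w) / w)"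
proof -
  have d: "deg_le (card W) (\<lambda>y. \<Prod>w\<in>W. (y \<oplus> w) / w)"
    using assms(2,3)
  proof (induction W rule: finite_induct)
    case empty
    then show ?case by (simp add: deg_le_const)
  next
    case (insert w W)
    have "(y \<oplus> w) / w = 1 + ((1 + \<beta> * w) / w) * y" for y
      using insert.prems[of w] by (simp add: oplus_def field_simps)
    then show ?case
      using insert deg_le_linear_mult[of "card W" "\<lambda>y. \<Prod>w\<in>W. (y \<oplus> w) / w" 1 "(1 + \<beta> * w) / w"] by simp
  qed
  show ?thesis
  proof (rule deg_le_unique[OF assms(1) deg_le_scale[OF d], of "insert 0 (inv_add ` W)"])
    have "0 \<notin> inv_add ` W" using assms(3) inv_add_neg by fastforce
    then show "card W < card (insert 0 (inv_add ` W))"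
      using assms card_inv_add_image[of W] by simp
    fix y assume "y \<in> insert 0 (inv_add ` W)"
    moreover have "(\<Prod>w\<in>W. (0 \<oplus> w) / w) = 1"
      by (rule prod.neutral) (use assms(3) in force)
    moreover have "(\<Prod>w\<in>W. (\<ominus> v \<oplus> w) / w) = 0" if "v \<in> W" for v
      using that assms one_plus_nonzero[of v] by (intro prod_zero) (auto intro!: bexI[of _ v] simp: oplus_inv_add)
    ultimately show "f y = f 0 * (\<Prod>w\<in>W. (y \<oplus> w) / w)"
      using assms(4) by auto
  qed (use assms in auto)
qed

definition rows :: "bool \<Rightarrow> nat \<Rightarrow> real list \<Rightarrow> vec \<Rightarrow> vec" where
  "rows c m zs F = foldr (\<lambda>z. row c m z z) zs F"

lemma rows_simps [simp]: "rows c m [] F = F" "rows c m (z # zs) F = row c m z z (rows c m zs F)"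
  by (simp_all add: rows_def)

lemma rows_move:
  assumes "z \<in> set zs" "\<And>w. w \<in> set zs \<Longrightarrow> 0 < w"
  shows "rows c m zs F = row c m z z (rows c m (remove1 z zs) F)"
  using assms
proof (induction zs)
  case (Cons v zs)
  have "row c m v v (row c m z z G) = row c m z z (row c m v v G)" if "0 < z" for G
    using that one_plus_nonzero by (intro row_commute) auto
  then show ?case using Cons by (cases "v = z") auto
qed simp

text \<open>
  The value at \<open>S\<close> of a product of rows, the first one with an independent upward parameter \<open>y\<close>,
  is a polynomial in \<open>y\<close> of degree at most \<open>card S\<close>. At \<open>y = \<ominus> w\<close>, for each of the other
  parameters \<open>w\<close>, two rows merge into one, so the values for more than \<open>card S\<close> rows are
  determined by interpolation from those for fewer rows.
\<close>

lemma rows_determined: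
  assumes S: "finite S" "finite S'" "card S = a" "card S' = a"
    and zero: "\<And>zs. length zs < a \<Longrightarrow> rows c m zs F S = 0" "\<And>zs. length zs < a \<Longrightarrow> rows c' m zs F' S' = 0"
    and zero2: "\<And>x y zs. Suc (length zs) < a \<Longrightarrow> row c m x y (rows c m zs F) S = 0"
      "\<And>x y zs. Suc (length zs) < a \<Longrightarrow> row c' m x y (rows c' m zs F') S' = 0"
    and base: "\<And>zs. length zs = a \<Longrightarrow> distinct zs \<Longrightarrow> \<forall>z\<in>set zs. 0 < z \<Longrightarrow> rows c m zs F S = rows c' m zs F' S'"
    and a: "0 < a"
  shows "distinct (x # zs) \<Longrightarrow> \<forall>z\<in>set (x # zs). 0 < z \<Longrightarrow>
    row c m x y (rows c m zs F) S = row c' m x y (rows c' m zs F') S'"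
\<comment> \<open>\<open>y\<close> must stay arbitrary: merging produces a row whose upward
  parameter \<open>w\<close> differs from its downward parameter \<open>x\<close>.\<close>
proof (induction "length zs" arbitrary: x y zs rule: less_induct)
  case less
  let ?g = "\<lambda>y. row c m x y (rows c m zs F) S" and ?g' = "\<lambda>y. row c' m x y (rows c' m zs F') S'"
  let ?W = "set (x # zs)"
  have deg: "deg_le a ?g" "deg_le a ?g'"
    using row_degree[OF S(1)] row_degree[OF S(2)] S(3,4) by auto
  have cardW: "card ?W = Suc (length zs)" using less.prems(1) by (simp only: distinct_card length_Cons)
  have node: "row d m x (\<ominus> x) (rows d m zs G) T = rows d m zs G T" for d G T
    using less.prems(2) one_plus_nonzero[of x] by (simp add: row_inv_add)
  have node2: "row d m x (\<ominus> w) (rows d m zs G) T = row d m x w (rows d m (remove1 w zs) G) T"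
    if "w \<in> set zs" for w d G T
    using that less.prems(2) rows_move[of w zs d m G] one_plus_nonzero[of w] by (simp add: row_row_merge)
  consider "Suc (length zs) < a" | "Suc (length zs) = a" | "a < Suc (length zs)" by linarith
  then show ?case
  proof cases
    case 1
    then show ?thesis using zero2 by simp
  next
    case 2
    \<comment> \<open>With exactly \<open>a\<close> parameters every merged product has fewer than
      \<open>a\<close> rows and vanishes, so both sides have the shape of \<open>root_form\<close>;
      the remaining constant is fixed at \<open>y = x\<close>, where the base values agree and the
      product is positive.\<close>
    have v: "?g (\<ominus> w) = 0 \<and> ?g' (\<ominus> w) = 0" if "w \<in> ?W" for w
    proof (cases "w = x")
      case True
      then show ?thesis using node zero 2 by simp
    next
      case False
      then have w: "w \<in> set zs" using that by simp
      then have "Suc (length (remove1 w zs)) < a"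
        using 2 by (simp add: length_remove1) (metis Suc_pred length_pos_if_in_set lessI)
      then show ?thesis using node2[OF w] zero2 by simp
    qed
    have dW: "deg_le (card ?W) ?g" "deg_le (card ?W) ?g'" unfolding cardW 2 by (fact deg)+
    have pW: "0 < w" if "w \<in> ?W" for w using less.prems(2) that by blast
    have f: "?g y = ?g 0 * (\<Prod>w\<in>?W. (y \<oplus> w) / w)" for y
      by (rule root_form[OF dW(1)]) (use pW v in auto)
    have f': "?g' y = ?g' 0 * (\<Prod>w\<in>?W. (y \<oplus> w) / w)" for y
      by (rule root_form[OF dW(2)]) (use pW v in auto)
    have "0 < (\<Prod>w\<in>?W. (x \<oplus> w) / w)"
      by (rule prod_pos) (use less.prems(2) oplus_pos in auto)
    moreover have "?g x = ?g' x"
      using base[of "x # zs"] less.prems 2 by simp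
    ultimately have "?g 0 = ?g' 0"
      unfolding f[of x] f'[of x] by (metis less_irrefl mult_cancel_right)
    then show ?thesis unfolding f[of y] f'[of y] by simp
  next
    case 3
    show ?thesis
    proof (rule deg_le_unique[OF deg])
      \<comment> \<open>More than \<open>a\<close> parameters provide enough nodes for degree
        \<open>a\<close>.\<close>
      show "a < card (inv_add ` ?W)"
        using card_inv_add_image[of ?W] less.prems(2) cardW 3 by simp
      fix y assume "y \<in> inv_add ` ?W"
      then obtain w where w: "w \<in> ?W" "y = \<ominus> w" by blast
      show "?g y = ?g' y"
      proof (cases "w = x")
        case True
        \<comment> \<open>At \<open>y = \<ominus> x\<close> the first row disappears; the head of
          \<open>zs\<close> then plays its role, with equal halves.\<close>
        obtain z zs' where zs: "zs = z # zs'" using 3 a by (cases zs) auto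
        then have "rows c m zs F S = rows c' m zs F' S'"
          using less.hyps[of zs' z z] less.prems by simp
        then show ?thesis using True w node by simp
      next
        case False
        then have wz: "w \<in> set zs" using w by simp
        have "distinct (x # remove1 w zs)" "\<forall>z\<in>set (x # remove1 w zs). 0 < z"
          using less.prems set_remove1_subset[of w zs] by auto
        then have "row c m x w (rows c m (remove1 w zs) F) S = row c' m x w (rows c' m (remove1 w zs) F') S'"
          using less.hyps[of "remove1 w zs" x w] wz by (metis One_nat_def diff_less length_pos_if_in_set length_remove1 zero_less_one)
        then show ?thesis using w node2[OF wz] by simp
      qed
    qed simp
  qed
qed

subsection \<open>Supports\<close>

definition cnt :: "nat set \<Rightarrow> nat \<Rightarrow> nat" where
  "cnt S m = card (S \<inter> {1..m})"

lemma cnt_Suc: "cnt S (Suc m) = cnt S m + (if Suc m \<in> S then 1 else 0)"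
proof -
  have "S \<inter> {1..Suc m} = (if Suc m \<in> S then insert (Suc m) (S \<inter> {1..m}) else S \<inter> {1..m})"
    by (auto simp: le_Suc_eq)
  then show ?thesis by (simp add: cnt_def)
qed

lemma cnt_mono: "i \<le> j \<Longrightarrow> cnt S i \<le> cnt S j"
  unfolding cnt_def by (intro card_mono) auto

lemma cnt_move:
  assumes "i \<notin> S" "Suc i \<in> S" "0 < i"
  shows "cnt (insert i (S - {Suc i})) j = (if j = i then Suc (cnt S i) else cnt S j)"
proof (induction j)
  case 0
  then show ?case using assms by (simp add: cnt_def)
next
  case (Suc j)
  then show ?case using assms by (auto simp: cnt_Suc)
qed

lemma hop_nonzero:
  assumes "hop i x F S \<noteq> 0"
  obtains S' where "F S' \<noteq> 0" "S' = S \<or> i \<notin> S \<and> Suc i \<in> S \<and> S' = insert i (S - {Suc i})"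
proof (cases "F S = 0")
  case True
  then show ?thesis using assms that by (auto simp: hop_def split: if_splits)
qed (use that in blast)

text \<open>In an upward half each element moves at most one site. The second conjunct, that counts
  beyond the sites in use are unchanged, is what the induction needs to handle the next hop.\<close>

lemma up_support:
  assumes "up m y F S \<noteq> 0"
  shows "\<exists>S'. F S' \<noteq> 0 \<and> (\<forall>j. cnt S' j \<le> cnt S (Suc j)) \<and> (\<forall>j>m. cnt S j = cnt S' j)"
  using assms
proof (induction m arbitrary: F)
  case 0
  then show ?case using cnt_mono by (intro exI[of _ S]) auto
next
  case (Suc m)
  then obtain S1 where S1: "hop (Suc m) y F S1 \<noteq> 0" "\<forall>j. cnt S1 j \<le> cnt S (Suc j)" "\<forall>j>m. cnt S j = cnt S1 j"
    by fastforce
  then obtain S' where S': "F S' \<noteq> 0" "S' = S1 \<or> Suc m \<notin> S1 \<and> Suc (Suc m) \<in> S1 \<and> S' = insert (Suc m) (S1 - {Suc (Suc m)})"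
    using hop_nonzero by metis
  then show ?case
  proof (elim disjE)
    assume a: "Suc m \<notin> S1 \<and> Suc (Suc m) \<in> S1 \<and> S' = insert (Suc m) (S1 - {Suc (Suc m)})"
    then have c: "cnt S' j = (if j = Suc m then Suc (cnt S1 (Suc m)) else cnt S1 j)" for j
      using cnt_move[of "Suc m" S1 j] by simp
    have "cnt S (Suc (Suc m)) = Suc (cnt S1 (Suc m))"
      using S1(3) a by (simp add: cnt_Suc[of S1 "Suc m"])
    then have "cnt S' j \<le> cnt S (Suc j)" for j
      using S1(2) c by simp
    moreover have "cnt S j = cnt S' j" if "Suc m < j" for j
      using S1(3) c that by simp
    ultimately show ?thesis using S'(1) by blast
  qed (use S1 in auto)
qed

text \<open>Seen from \<open>S\<close> the hops act from the top site down. At most one element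
  passes from \<open>j + 2\<close> to \<open>j + 1\<close>, and only if \<open>j + 1\<close> is not
  in \<open>S\<close>.\<close>

lemma down_support:
  assumes "down m x F S \<noteq> 0"
  shows "\<exists>S'. F S' \<noteq> 0 \<and> (\<forall>j. cnt S' (Suc j) \<le> Suc (cnt S j)) \<and> (\<forall>j>m. cnt S j = cnt S' j)"
  using assms
proof (induction m arbitrary: S)
  case 0
  then show ?case by (intro exI[of _ S]) (auto simp: cnt_Suc)
next
  case (Suc m)
  then obtain S1 where S1: "down m x F S1 \<noteq> 0"
    "S1 = S \<or> Suc m \<notin> S \<and> Suc (Suc m) \<in> S \<and> S1 = insert (Suc m) (S - {Suc (Suc m)})"
    using hop_nonzero by (metis down.simps(2))
  then obtain S' where S': "F S' \<noteq> 0" "\<forall>j. cnt S' (Suc j) \<le> Suc (cnt S1 j)" "\<forall>j>m. cnt S1 j = cnt S' j"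
    using Suc.IH by blast
  from S1(2) show ?case
  proof (elim disjE)
    assume a: "Suc m \<notin> S \<and> Suc (Suc m) \<in> S \<and> S1 = insert (Suc m) (S - {Suc (Suc m)})"
    then have c: "cnt S1 j = (if j = Suc m then Suc (cnt S (Suc m)) else cnt S j)" for j
      using cnt_move[of "Suc m" S j] by simp
    have "cnt S' (Suc (Suc m)) = Suc (cnt S (Suc m))"
      using S'(3) a c[of "Suc (Suc m)"] by (simp add: cnt_Suc[of S "Suc m"])
    then have "cnt S' (Suc j) \<le> Suc (cnt S j)" for j
      using S'(2) c[of j] by (metis order_refl)
    moreover have "cnt S j = cnt S' j" if "Suc m < j" for j
      using S'(3) c[of j] that by simp
    ultimately show ?thesis using S'(1) by blast
  qed (use S' in auto)
qed

section \<open>Rows without a wall: the value at \<open>block a b\<close>\<close>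

definition pair_rows :: "nat \<Rightarrow> (real \<times> real) list \<Rightarrow> vec \<Rightarrow> vec" where
  "pair_rows m ps F = foldr (\<lambda>p. row False m (fst p) (snd p)) ps F"

lemma pair_rows_simps [simp]:
  "pair_rows m [] F = F"
  "pair_rows m (p # ps) F = row False m (fst p) (snd p) (pair_rows m ps F)"
  by (simp_all add: pair_rows_def)

definition unit_vec :: "nat set \<Rightarrow> vec" where
  "unit_vec T S = (if S = T then 1 else 0)"

lemma cnt_initial: "cnt {1..a} m = min a m"
  by (simp add: cnt_def min_def)

text \<open>Through one row, the bound for \<open>Suc j\<close> with one row fewer gives the bound
  for \<open>j\<close>: \<open>down_support\<close> loses one element and \<open>up_support\<close>
  one site.\<close>

lemma pair_rows_support:
  assumes "pair_rows m ps (unit_vec {1..a}) S \<noteq> 0" "j + length ps \<le> a"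
  shows "j \<le> cnt S (j + length ps)"
  using assms
proof (induction ps arbitrary: S j)
  case Nil
  then show ?case by (auto simp: unit_vec_def cnt_initial[simplified] split: if_splits)
next
  case (Cons p ps)
  then have "down m (fst p) (up m (snd p) (pair_rows m ps (unit_vec {1..a}))) S \<noteq> 0"
    by (simp add: row_def wall_def)
  then obtain S1 S' where "pair_rows m ps (unit_vec {1..a}) S' \<noteq> 0"
    "\<forall>j. cnt S1 (Suc j) \<le> Suc (cnt S j)" "\<forall>j. cnt S' j \<le> cnt S1 (Suc j)"
    using down_support up_support by meson
  moreover from this(1) have "Suc j \<le> cnt S' (Suc j + length ps)"
    using Cons.prems(2) by (intro Cons.IH) auto
  ultimately have "Suc j \<le> Suc (cnt S (Suc j + length ps))"
    by (meson order_trans)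
  then show ?case by simp
qed

definition block :: "nat \<Rightarrow> nat \<Rightarrow> nat set" where
  "block a b = {Suc b..b + a}"

text \<open>The support bound at \<open>j = 1\<close> asks for an element of the block that is at
  most \<open>1 + length ps\<close>, hence at most \<open>a\<close>; as \<open>a \<le> b\<close>,
  the block has none.\<close>

lemma pair_rows_block_zero:
  assumes "length ps < a" "a \<le> b"
  shows "pair_rows m ps (unit_vec {1..a}) (block a b) = 0"
proof (rule ccontr)
  assume "\<not> ?thesis"
  then have "1 \<le> cnt (block a b) (1 + length ps)"
    using assms pair_rows_support[of m ps a "block a b" 1] by simp
  moreover have "block a b \<inter> {1..1 + length ps} = {}"
    using assms by (auto simp: block_def)
  ultimately show False by (simp add: cnt_def)
qed

lemma pair_rows_move:
  assumes "p \<in> set ps" "\<And>p. p \<in> set ps \<Longrightarrow> 0 < fst p \<and> 0 \<le> snd p"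
  shows "pair_rows m ps F = row False m (fst p) (snd p) (pair_rows m (remove1 p ps) F)"
  using assms
proof (induction ps)
  case (Cons q ps)
  have "row False m (fst q) (snd q) (row False m (fst p) (snd p) G) = row False m (fst p) (snd p) (row False m (fst q) (snd q) G)"
    if "0 < fst p" "0 \<le> snd p" for G
    using that one_plus_nonzero beta_pos by (intro row_commute) (auto simp: order_le_less)
  then show ?case using Cons by (cases "q = p") auto
qed simp

text \<open>As a polynomial in \<open>y\<close> the value vanishes at \<open>\<ominus> w\<close> for
  each of the \<open>a\<close> downward parameters: the front row disappears or merges with another,
  and \<open>a - 1\<close> rows are too few for the block.\<close>

lemma pair_rows_front:
  assumes "0 < x" "\<And>p. p \<in> set ps \<Longrightarrow> 0 < fst p" "a \<le> b" "Suc (length ps) = a"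
    "distinct (x # map fst ps)" "\<And>p. p \<in> set ps \<Longrightarrow> 0 \<le> snd p"
  shows "pair_rows m ((x, y) # ps) (unit_vec {1..a}) (block a b) =
    (\<Prod>w\<in>insert x (fst ` set ps). (y \<oplus> w) / w) * pair_rows m ((x, 0) # ps) (unit_vec {1..a}) (block a b)"
proof -
  let ?W = "insert x (fst ` set ps)" and ?e = "unit_vec {1..a}"
  have cW: "card ?W = a"
    using assms(4,5) by (metis distinct_card length_Cons length_map list.simps(15) list.set_map)
  have f: "card (block a b) = a" by (simp add: block_def)
  have "row False m x y (pair_rows m ps ?e) (block a b)
    = row False m x 0 (pair_rows m ps ?e) (block a b) * (\<Prod>w\<in>?W. (y \<oplus> w) / w)"
  proof (rule root_form)
    show "deg_le (card ?W) (\<lambda>y. row False m x y (pair_rows m ps ?e) (block a b))"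
      unfolding cW using row_degree[of "block a b"] f by (metis block_def finite_atLeastAtMost)
    show "0 < w" if "w \<in> ?W" for w using that assms by auto
    show "row False m x (\<ominus> w) (pair_rows m ps ?e) (block a b) = 0" if w: "w \<in> ?W" for w
    proof (cases "w = x")
      case True
      then show ?thesis
        using assms one_plus_nonzero pair_rows_block_zero by (simp add: row_inv_add)
    next
      case False
      then obtain p where p: "p \<in> set ps" "w = fst p" using w by auto
      have "row False m x (\<ominus> w) (pair_rows m ps ?e) = pair_rows m ((x, snd p) # remove1 p ps) ?e"
        using p assms(2,6) pair_rows_move[of p ps m ?e] one_plus_nonzero[of w] by (simp add: row_row_merge)
      moreover have "length ((x, snd p) # remove1 p ps) < a"
        using p assms(4) length_pos_if_in_set[of p ps] by (auto simp: length_remove1)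
      ultimately show ?thesis using pair_rows_block_zero assms(3) by metis
    qed
  qed simp
  then show ?thesis by (simp add: mult.commute)
qed

text \<open>Site \<open>l\<close> cannot be filled: elements below it only move further down, and
  those above \<open>Suc k\<close> do not move.\<close>

lemma down_zero:
  assumes "\<And>S. l \<notin> S \<Longrightarrow> F S = 0" "l \<notin> T" "\<And>j. l \<le> j \<Longrightarrow> j \<le> Suc k \<Longrightarrow> j \<notin> T"
  shows "down k x F T = 0"
  using assms(2,3)
proof (induction k arbitrary: T)
  case 0
  then show ?case using assms(1) by simp
next
  case (Suc k)
  have 1: "down k x F T = 0" using Suc by simp
  have 2: "down k x F (insert (Suc k) (T - {Suc (Suc k)})) = 0" if "Suc (Suc k) \<in> T"
  proof (rule Suc.IH)
    have "Suc (Suc k) < l"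
      using that Suc.prems by (metis le_refl linorder_not_le not_less_eq_eq)
    then show "l \<notin> insert (Suc k) (T - {Suc (Suc k)})"
      "\<And>j. l \<le> j \<Longrightarrow> j \<le> Suc k \<Longrightarrow> j \<notin> insert (Suc k) (T - {Suc (Suc k)})"
      using Suc.prems by auto
  qed
  show ?case using 1 2 by (simp add: hop_def)
qed

lemma down_full: "{1..k} \<subseteq> T \<Longrightarrow> down k x F T = F T"
proof (induction k)
  case (Suc k)
  have "{1..k} \<subseteq> T" "Suc k \<in> T" using Suc.prems by auto
  then show ?case using Suc by (auto simp: hop_def)
qed simp

lemma down_skip: "{Suc k..m} \<subseteq> T \<Longrightarrow> k \<le> m \<Longrightarrow> down m x F T = down k x F T"
proof (induction m)
  case (Suc m)
  then show ?case
    by (cases "k = Suc m") (auto simp: hop_def atLeastAtMostSuc_conv)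
qed simp

text \<open>Site \<open>Suc l\<close> has to be filled, and only the element at
  \<open>Suc (l + d)\<close> can reach it; it must take all \<open>d\<close> steps, each with factor
  \<open>x\<close>.\<close>

lemma down_slide:
  assumes "\<And>S. Suc l \<notin> S \<Longrightarrow> F S = 0" "Suc (l + d) \<in> T" "\<And>j. l < j \<Longrightarrow> j \<le> l + d \<Longrightarrow> j \<notin> T"
  shows "down (l + d) x F T = x ^ d * down l x F (insert (Suc l) (T - {Suc (l + d)}))"
  using assms(2,3)
proof (induction d arbitrary: T)
  case 0
  then show ?case by (simp add: insert_absorb)
next
  case (Suc d)
  let ?T = "insert (Suc (l + d)) (T - {Suc (Suc (l + d))})"
  have "down (l + d) x F T = 0"
    by (rule down_zero[where l = "Suc l"]) (use assms(1) Suc.prems in auto)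
  moreover have "down (l + d) x F ?T = x ^ d * down l x F (insert (Suc l) (?T - {Suc (l + d)}))"
    using Suc.prems by (intro Suc.IH) auto
  moreover have "?T - {Suc (l + d)} = T - {Suc (Suc (l + d))}" using Suc.prems by auto
  ultimately show ?case using Suc.prems by (simp add: hop_def)
qed

lemma up_0 [simp]: "up m 0 F = F"
  by (induction m arbitrary: F) simp_all

lemma row_down: "row False m x 0 F = down m x F"
  by (simp add: row_def wall_def)

lemma downs_support:
  assumes "pair_rows m (map (\<lambda>x. (x, 0)) xs) (unit_vec {1..a}) S \<noteq> 0"
  shows "min a (j + length xs) \<le> cnt S j + length xs"
  using assms
proof (induction xs arbitrary: S j)
  case Nil
  then show ?case by (auto simp: unit_vec_def cnt_initial[simplified] split: if_splits)
next
  case (Cons x xs)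
  then have "down m x (pair_rows m (map (\<lambda>x. (x, 0)) xs) (unit_vec {1..a})) S \<noteq> 0"
    by (simp add: row_down)
  from down_support[OF this]
  obtain S' where "pair_rows m (map (\<lambda>x. (x, 0)) xs) (unit_vec {1..a}) S' \<noteq> 0" "cnt S' (Suc j) \<le> Suc (cnt S j)"
    by blast
  then show ?case using Cons.IH[of S' "Suc j"] by simp
qed

text \<open>With zero upward parameters a single history survives: each row carries the lowest
  remaining element of the upper interval down by \<open>b\<close> sites, to the site just above the
  initial interval.\<close>

lemma downs_block:
  assumes "length xs \<le> a" "0 < b"
  shows "pair_rows (a + b - 1) (map (\<lambda>x. (x, 0)) xs) (unit_vec {1..a})
      ({1..a - length xs} \<union> {Suc (b + a - length xs)..b + a}) = (\<Prod>x\<leftarrow>xs. x ^ b)"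
  using assms(1)
proof (induction xs)
  case Nil
  then show ?case by (simp add: unit_vec_def)
next
  case (Cons x xs)
  define l where "l = a - Suc (length xs)"
  have l: "a - length xs = Suc l" "b + a - length xs = Suc (l + b)" "b + a - length (x # xs) = l + b" "a - length (x # xs) = l"
    using Cons.prems by (auto simp: l_def)
  let ?F = "pair_rows (a + b - 1) (map (\<lambda>x. (x, 0)) xs) (unit_vec {1..a})"
  let ?T = "{1..l} \<union> {Suc (l + b)..b + a}"
  \<comment> \<open>\<open>downs_support\<close> at \<open>Suc l\<close> forces the first
    \<open>Suc l\<close> sites to be full.\<close>
  have F0: "?F S = 0" if "Suc l \<notin> S" for S
  proof (rule ccontr)
    assume "?F S \<noteq> 0"
    then have "min a (Suc l + length xs) \<le> cnt S (Suc l) + length xs" by (rule downs_support)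
    then have "Suc l \<le> cnt S (Suc l)" using Cons.prems l(1) by simp
    moreover have "cnt S (Suc l) \<le> l"
      using that by (simp add: cnt_Suc) (metis cnt_def card_atLeastAtMost card_mono diff_Suc_1 finite_atLeastAtMost inf_le2)
    ultimately show False by simp
  qed
  have "down (a + b - 1) x ?F ?T = down (l + b) x ?F ?T"
    using Cons.prems by (intro down_skip) (auto simp: l_def)
  also have "\<dots> = x ^ b * down l x ?F (insert (Suc l) (?T - {Suc (l + b)}))"
    using F0 Cons.prems assms(2) by (intro down_slide) (auto simp: l_def)
  also have "insert (Suc l) (?T - {Suc (l + b)}) = {1..Suc l} \<union> {Suc (Suc (l + b))..b + a}"
    using assms(2) by auto
  also have "down l x ?F \<dots> = ?F \<dots>"
    by (rule down_full) auto
  also have "\<dots> = (\<Prod>x\<leftarrow>xs. x ^ b)"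
    using Cons.IH Cons.prems l by simp
  finally show ?case using l by (simp add: row_down)
qed

text \<open>\<open>qs\<close> collects the rows already treated. Commutation brings the next row to
  the front, where \<open>pair_rows_front\<close> frees it of its upward parameter, and then puts it
  back.\<close>

lemma pair_rows_zero_out:
  assumes "a \<le> b" "length (qs @ ps) = a" "distinct (map fst (qs @ ps))"
    "\<And>p. p \<in> set (qs @ ps) \<Longrightarrow> 0 < fst p \<and> 0 \<le> snd p"
  shows "pair_rows m (qs @ ps) (unit_vec {1..a}) (block a b) =
    (\<Prod>p\<leftarrow>ps. \<Prod>w\<in>fst ` set (qs @ ps). (snd p \<oplus> w) / w) *
    pair_rows m (qs @ map (\<lambda>p. (fst p, 0)) ps) (unit_vec {1..a}) (block a b)"
  using assms(2-)
proof (induction ps arbitrary: qs)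
  case Nil
  then show ?case by simp
next
  case (Cons p ps)
  let ?e = "unit_vec {1..a}" and ?B = "block a b" and ?p = "(fst p, 0)"
  have d: "p \<notin> set qs" "?p \<notin> set qs" using Cons.prems(2) by (force simp: rev_image_eqI)+
  have mv: "pair_rows m (qs @ r # ps) ?e = pair_rows m (r # qs @ ps) ?e"
    if "r \<notin> set qs" "0 < fst r" "0 \<le> snd r" for r
    using that Cons.prems(3) pair_rows_move[of r "qs @ r # ps" m ?e] by (auto simp: remove1_append)
  have set: "fst ` set (qs @ p # ps) = insert (fst p) (fst ` set (qs @ ps))" by auto
  have "pair_rows m (qs @ p # ps) ?e ?B = pair_rows m ((fst p, snd p) # qs @ ps) ?e ?B"
    using mv[of p] d Cons.prems(3) by simp
  also have "\<dots> = (\<Prod>w\<in>insert (fst p) (fst ` set (qs @ ps)). (snd p \<oplus> w) / w) * pair_rows m (?p # qs @ ps) ?e ?B"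
    using Cons.prems assms(1) by (intro pair_rows_front) auto
  also have "pair_rows m (?p # qs @ ps) ?e ?B = pair_rows m ((qs @ [?p]) @ ps) ?e ?B"
    using mv[of ?p] d Cons.prems(3) by simp
  also have "\<dots> = (\<Prod>r\<leftarrow>ps. \<Prod>w\<in>fst ` set ((qs @ [?p]) @ ps). (snd r \<oplus> w) / w) *
    pair_rows m ((qs @ [?p]) @ map (\<lambda>p. (fst p, 0)) ps) ?e ?B"
  proof (rule Cons.IH)
    fix r assume "r \<in> set ((qs @ [?p]) @ ps)"
    then show "0 < fst r \<and> 0 \<le> snd r"
      using Cons.prems(3)[of r] Cons.prems(3)[of p] by auto
  qed (use Cons.prems(1,2) in auto)
  also have "fst ` set ((qs @ [?p]) @ ps) = fst ` set (qs @ p # ps)" by auto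
  finally show ?case unfolding set by simp
qed

lemma rows_False: "rows False m zs F = pair_rows m (map (\<lambda>z. (z, z)) zs) F"
  by (induction zs) simp_all

text \<open>The downward halves give \<open>z ^ b\<close> for each variable; the denominators of the
  normalised factors take away \<open>z ^ a\<close>.\<close>

lemma rows_block_base:
  assumes "0 < a" "a \<le> b" "length zs = a" "distinct zs" "\<And>z. z \<in> set zs \<Longrightarrow> 0 < z"
  shows "rows False (a + b - 1) zs (unit_vec {1..a}) (block a b) =
    (\<Prod>z\<in>set zs. z ^ (b - a)) * (\<Prod>z\<in>set zs. \<Prod>w\<in>set zs. z \<oplus> w)"
proof -
  let ?ps = "map (\<lambda>z. (z, z)) zs"
  have "rows False (a + b - 1) zs (unit_vec {1..a}) (block a b) =
    (\<Prod>p\<leftarrow>?ps. \<Prod>w\<in>fst ` set ([] @ ?ps). (snd p \<oplus> w) / w) *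
    pair_rows (a + b - 1) ([] @ map (\<lambda>p. (fst p, 0)) ?ps) (unit_vec {1..a}) (block a b)"
    unfolding rows_False using pair_rows_zero_out[of a b "[]" ?ps "a + b - 1"] assms
    by (force simp: comp_def less_imp_le)
  also have "pair_rows (a + b - 1) ([] @ map (\<lambda>p. (fst p, 0)) ?ps) (unit_vec {1..a}) (block a b) = (\<Prod>z\<leftarrow>zs. z ^ b)"
    using downs_block[of zs a b] assms by (simp add: comp_def block_def)
  also have "(\<Prod>p\<leftarrow>?ps. \<Prod>w\<in>fst ` set ([] @ ?ps). (snd p \<oplus> w) / w) = (\<Prod>z\<leftarrow>zs. \<Prod>w\<in>set zs. (z \<oplus> w) / w)"
    by (simp add: comp_def image_image)
  also have "\<dots> = (\<Prod>z\<in>set zs. \<Prod>w\<in>set zs. (z \<oplus> w) / w)"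
    using assms(4) by (simp add: prod.distinct_set_conv_list)
  also have "\<dots> = (\<Prod>z\<in>set zs. \<Prod>w\<in>set zs. z \<oplus> w) / (\<Prod>z\<in>set zs. z ^ a)"
    using assms(3,4) distinct_card[of zs] by (simp add: prod_dividef prod_power_distrib)
  also have "(\<Prod>z\<leftarrow>zs. z ^ b) = (\<Prod>z\<in>set zs. z ^ b)"
    using assms(4) by (simp add: prod.distinct_set_conv_list)
  also have "\<dots> = (\<Prod>z\<in>set zs. z ^ a) * (\<Prod>z\<in>set zs. z ^ (b - a))"
    using assms(2) by (simp add: prod.distrib[symmetric] power_add[symmetric])
  finally show ?thesis
    using assms(5) by (force simp: field_simps)
qed

section \<open>Rows with a wall: the value at the staircase \<open>steps\<close>\<close>

lemma hop_card_zero: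
  assumes "\<And>S. finite S \<Longrightarrow> k < card S \<Longrightarrow> F S = 0" "finite S" "k < card S"
  shows "hop i x F S = 0"
  using assms by (auto simp: hop_def simp del: card_insert_disjoint)

lemma up_card_zero:
  assumes "\<And>S. finite S \<Longrightarrow> k < card S \<Longrightarrow> F S = 0" "finite S" "k < card S"
  shows "up m y F S = 0"
  using assms(1)
proof (induction m arbitrary: F)
  case 0
  then show ?case using assms by simp
next
  case (Suc m)
  have "hop (Suc m) y F T = 0" if "finite T" "k < card T" for T
    using hop_card_zero[of k F T] Suc.prems that by blast
  then show ?case using Suc.IH by simp
qed

lemma down_card_zero:
  assumes "\<And>S. finite S \<Longrightarrow> k < card S \<Longrightarrow> F S = 0" "finite S" "k < card S"
  shows "down m y F S = 0"
  using assms(2,3)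
proof (induction m arbitrary: S)
  case 0
  then show ?case using assms by simp
next
  case (Suc m)
  then show ?case using hop_card_zero[of k "down m y F" S] by simp
qed

lemma row_card_zero:
  assumes "\<And>S. finite S \<Longrightarrow> k < card S \<Longrightarrow> F S = 0" "finite S" "Suc k < card S"
  shows "row True m x y F S = 0"
  unfolding row_def
proof (rule down_card_zero[where k = "Suc k"])
  fix S :: "nat set" assume S: "finite S" "Suc k < card S"
  then have "up m y F S = 0" "1 \<in> S \<Longrightarrow> up m y F (S - {1}) = 0"
    using assms(1) up_card_zero[of k F] by (auto simp: card_Diff_singleton)
  then show "wall True x y (up m y F) S = 0"
    by (simp add: wall_def create_def)
qed (use assms in auto)

text \<open>A row creates at most one part, because its two factors at content \<open>0\<close> have
  merged into a single \<open>create\<close>.\<close>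

lemma rows_card_zero: "finite S \<Longrightarrow> length zs < card S \<Longrightarrow> rows True m zs (unit_vec {}) S = 0"
proof (induction zs arbitrary: S)
  case Nil
  then show ?case by (auto simp: unit_vec_def)
next
  case (Cons z zs)
  then show ?case using row_card_zero[of "length zs"] by simp
qed

text \<open>For the zero at \<open>y = \<ominus> z\<close>, the row of \<open>z\<close> is moved to
  the front, where its downward half is cancelled; its wall does nothing at \<open>M\<close> since
  \<open>1\<close> is absent, and the remaining rows are too few for a set of this size.\<close>

lemma up_rows:
  assumes "finite M" "card M = length zs" "1 \<notin> M" "distinct zs" "\<And>z. z \<in> set zs \<Longrightarrow> 0 < z"
  shows "up m y (rows True m zs (unit_vec {})) M =
    rows True m zs (unit_vec {}) M * (\<Prod>z\<in>set zs. (y \<oplus> z) / z)"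
proof -
  let ?F = "rows True m zs (unit_vec {})"
  have "up m y ?F M = up m 0 ?F M * (\<Prod>z\<in>set zs. (y \<oplus> z) / z)"
  proof (rule root_form)
    have "card {j \<in> M. 1 < j} \<le> card (set zs)"
      using assms distinct_card[of zs] card_mono[of M "{j \<in> M. 1 < j}"] by auto
    then show "deg_le (card (set zs)) (\<lambda>y. up m y ?F M)"
      using up_degree_const[OF assms(1)] deg_le_mono by blast
    fix z assume z: "z \<in> set zs"
    let ?G = "rows True m (remove1 z zs) (unit_vec {})"
    have "up m (\<ominus> z) ?F = create (z \<oplus> z) (up m z ?G)"
      using z assms(5) rows_move[of z zs True m] one_plus_nonzero[of z]
      by (simp add: row_def wall_def up_down)
    then have "up m (\<ominus> z) ?F M = up m z ?G M"
      using assms(3) by (simp add: create_def)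
    also have "\<dots> = 0"
      using assms(1,2) z length_pos_if_in_set[OF z]
      by (intro up_card_zero[where k = "length (remove1 z zs)"] rows_card_zero) (auto simp: length_remove1)
    finally show "up m (\<ominus> z) ?F M = 0" .
  qed (use assms in auto)
  then show ?thesis by simp
qed

text \<open>The creating term of \<open>create\<close> without its coefficient. At a set with one
  more element than there are rows behind it, this is the only term that survives.\<close>

definition insert_one :: "vec \<Rightarrow> vec" where
  "insert_one F S = (if 1 \<in> S then F (S - {1}) else 0)"

lemma down_cong_card:
  assumes "\<And>S. finite S \<Longrightarrow> card S = k \<Longrightarrow> F S = r * G S" "finite S" "card S = k"
  shows "down m x F S = r * down m x G S"
  using assms(2,3)
proof (induction m arbitrary: S)
  case 0
  then show ?case using assms by simp
next
  case (Suc m)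
  then show ?case
    by (auto simp: hop_def algebra_simps simp del: card_insert_disjoint)
qed

text \<open>At a set with as many elements as rows, the first row must create a part. Its wall gives
  \<open>x \<oplus> x\<close>, and its upward half is evaluated by \<open>up_rows\<close> once that
  part is removed.\<close>

lemma rows_Cons_top:
  assumes "finite T" "card T = Suc (length zs)" "distinct zs" "\<And>z. z \<in> set zs \<Longrightarrow> 0 < z"
  shows "rows True m (x # zs) (unit_vec {}) T = (x \<oplus> x) * (\<Prod>z\<in>set zs. (x \<oplus> z) / z) *
    down m x (insert_one (rows True m zs (unit_vec {}))) T"
  unfolding rows_simps row_def
proof (rule down_cong_card[where k = "Suc (length zs)"])
  fix S :: "nat set" assume S: "finite S" "card S = Suc (length zs)"
  let ?F = "rows True m zs (unit_vec {})"
  have "up m x ?F S = 0"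
    using S by (intro up_card_zero[where k = "length zs"] rows_card_zero) auto
  moreover have "up m x ?F (S - {1}) = ?F (S - {1}) * (\<Prod>z\<in>set zs. (x \<oplus> z) / z)" if "1 \<in> S"
    using S that assms by (intro up_rows) auto
  ultimately show "wall True x x (up m x ?F) S = (x \<oplus> x) * (\<Prod>z\<in>set zs. (x \<oplus> z) / z) * insert_one ?F S"
    by (simp add: wall_def create_def insert_one_def)
qed (use assms in auto)

definition steps :: "nat \<Rightarrow> nat \<Rightarrow> nat set" where
  "steps p i = (\<lambda>j. p + 2 * j) ` {..<i}"

lemma steps_Suc: "steps p (Suc i) = insert (p + 2 * i) (steps p i)"
  by (auto simp: steps_def lessThan_Suc)

lemma steps_bound: "j \<in> steps p i \<Longrightarrow> p \<le> j \<and> j + 2 \<le> p + 2 * i"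
  by (auto simp: steps_def)

lemma card_steps [simp]: "card (steps p i) = i" "finite (steps p i)"
  by (simp_all add: steps_def card_image inj_on_def)

text \<open>The hops into the sites \<open>p + 1, p + 3, ...\<close>: in a staircase with gaps of
  two these are the only moves of the elements \<open>p + 2, p + 4, ...\<close>.\<close>

fun every_other :: "nat \<Rightarrow> real \<Rightarrow> nat \<Rightarrow> vec \<Rightarrow> vec" where
  "every_other p x 0 F = F"
| "every_other p x (Suc i) F = hop (p + 2 * i + 1) x (every_other p x i F)"

lemma every_other_commute:
  "p + 2 * i < j \<Longrightarrow> every_other p x i (hop j x F) = hop j x (every_other p x i F)"
  by (induction i) (simp_all add: hop_commute)

text \<open>Since the gaps are two, an element above \<open>p\<close> that moves one site down is
  stopped by its lower neighbour, whereas \<open>p\<close> slides to \<open>1\<close> with factor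
  \<open>x ^ (p - 1)\<close> and is removed. \<open>Z\<close> holds the elements whose moves are
  already decided.\<close>

lemma down_steps:
  assumes "0 < p" "\<And>z. z \<in> Z \<Longrightarrow> p + 2 * i < z"
  shows "down (p + 2 * i) x (insert_one F) (steps p (Suc i) \<union> Z) =
    x ^ (p - 1) * every_other p x i F (steps (p + 2) i \<union> Z)"
  using assms(2)
proof (induction i arbitrary: Z)
  case 0
  have Z: "j \<notin> Z" if "j \<le> p" for j using 0[of j] that by auto
  have d: "down (0 + (p - 1)) x (insert_one F) (insert p Z) =
      x ^ (p - 1) * down 0 x (insert_one F) (insert (Suc 0) (insert p Z - {Suc (0 + (p - 1))}))"
    using assms(1) Z by (intro down_slide) (auto simp: insert_one_def)
  have z: "insert p Z - {p} = Z" "Suc 0 \<notin> Z" using Z[of p] Z[of 1] assms(1) by auto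
  obtain q where q: "p = Suc q" using assms(1) by (cases p) auto
  have "down p x (insert_one F) (insert p Z) = down (p - 1) x (insert_one F) (insert p Z)"
    by (simp add: q hop_def)
  moreover have "insert_one F (insert (Suc 0) Z) = F Z"
    using z by (simp add: insert_one_def)
  ultimately show ?case using d z assms(1) by (simp add: steps_def lessThan_Suc)
next
  case (Suc i)
  let ?t = "p + 2 * i + 2"
  let ?S = "steps p (Suc i)" and ?M = "steps (p + 2) i"
  have e: "p + 2 * Suc i = Suc (Suc (p + 2 * i))" by simp
  have S: "steps p (Suc (Suc i)) \<union> Z = ?S \<union> insert ?t Z" by (auto simp: steps_Suc)
  have M: "steps (p + 2) (Suc i) \<union> Z = ?M \<union> insert ?t Z" by (auto simp: steps_Suc)
  have nS: "y \<notin> ?S" "y \<notin> ?M" if "p + 2 * i < y" for y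
    using that steps_bound[of y p "Suc i"] steps_bound[of y "p + 2" i] by auto
  have nZ: "y \<notin> Z" if "y \<le> ?t" for y
    using that Suc.prems[of y] by auto
  have n: "Suc (p + 2 * i) \<notin> ?S \<union> insert ?t Z" "Suc (p + 2 * i) \<notin> ?M \<union> insert ?t Z"
    using nS[of "Suc (p + 2 * i)"] nZ[of "Suc (p + 2 * i)"] by auto
  have r: "insert (Suc (p + 2 * i)) (?S \<union> insert ?t Z - {?t}) = ?S \<union> insert (Suc (p + 2 * i)) Z"
    "insert (Suc (p + 2 * i)) (?M \<union> insert ?t Z - {?t}) = ?M \<union> insert (Suc (p + 2 * i)) Z"
    using nS[of ?t] nZ[of ?t] by auto
  have IH: "down (p + 2 * i) x (insert_one F) (?S \<union> insert y Z) = x ^ (p - 1) * every_other p x i F (?M \<union> insert y Z)"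
    if "y = ?t \<or> y = Suc (p + 2 * i)" for y
    by (rule Suc.IH) (use Suc.prems that in \<open>fastforce dest: Suc_lessD\<close>)
  have "down (p + 2 * Suc i) x (insert_one F) (?S \<union> insert ?t Z) =
      hop (Suc (p + 2 * i)) x (down (p + 2 * i) x (insert_one F)) (?S \<union> insert ?t Z)"
    unfolding e down.simps by (subst hop_def) simp
  also have "\<dots> = (1 + \<beta> * x) * down (p + 2 * i) x (insert_one F) (?S \<union> insert ?t Z)
      + x * down (p + 2 * i) x (insert_one F) (?S \<union> insert (Suc (p + 2 * i)) Z)"
    using n r by (simp add: hop_def)
  also have "\<dots> = x ^ (p - 1) * ((1 + \<beta> * x) * every_other p x i F (?M \<union> insert ?t Z)
      + x * every_other p x i F (?M \<union> insert (Suc (p + 2 * i)) Z))"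
    using IH by (simp add: algebra_simps)
  also have "\<dots> = x ^ (p - 1) * hop (Suc (p + 2 * i)) x (every_other p x i F) (?M \<union> insert ?t Z)"
    using n r by (simp add: hop_def)
  finally show ?case unfolding S M by simp
qed

lemma up_skip: "(\<And>j. 1 < j \<Longrightarrow> j \<le> Suc k \<Longrightarrow> j \<notin> Z) \<Longrightarrow> up k x F Z = F Z"
  by (induction k arbitrary: F) (simp_all add: hop_def)

text \<open>In an upward half, too, only the hops of \<open>every_other\<close> find an element to
  move. Together with \<open>down_steps\<close> this trades the downward half on the staircase for
  an upward half on the staircase without its smallest element, where \<open>up_rows\<close>
  applies.\<close>

lemma up_steps:
  assumes "\<And>z. z \<in> Z \<Longrightarrow> p + 2 * i + 2 \<le> z"
  shows "up (p + 2 * i) x F (steps (p + 2) i \<union> Z) = every_other p x i F (steps (p + 2) i \<union> Z)"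
  using assms
proof (induction i arbitrary: Z F)
  case 0
  then show ?case by (fastforce simp: steps_def intro!: up_skip)
next
  case (Suc i)
  let ?t = "p + 2 * i + 2" and ?M = "steps (p + 2) i"
  let ?S = "?M \<union> insert ?t Z"
  have e: "p + 2 * Suc i = Suc (Suc (p + 2 * i))" by simp
  have M: "steps (p + 2) (Suc i) \<union> Z = ?S" by (auto simp: steps_Suc)
  have n: "Suc (p + 2 * i) \<notin> ?S" "Suc ?t \<notin> insert (Suc (p + 2 * i)) (?S - {?t})" "?t \<in> ?S" "?t \<notin> ?M"
    using Suc.prems[of "Suc ?t"] Suc.prems[of "Suc (p + 2 * i)"] steps_bound[of "Suc ?t" "p + 2" i]
      steps_bound[of "Suc (p + 2 * i)" "p + 2" i] steps_bound[of ?t "p + 2" i] by auto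
  have "up (p + 2 * Suc i) x F ?S = up (p + 2 * i) x (hop (Suc (p + 2 * i)) x (hop ?t x F)) ?S"
    unfolding e by simp
  also have "\<dots> = every_other p x i (hop (Suc (p + 2 * i)) x (hop ?t x F)) ?S"
    by (rule Suc.IH) (use Suc.prems in fastforce)
  also have "\<dots> = hop (Suc (p + 2 * i)) x (hop ?t x (every_other p x i F)) ?S"
    by (simp add: every_other_commute)
  also have "\<dots> = hop (Suc (p + 2 * i)) x (every_other p x i F) ?S"
    using n by (simp add: hop_def)
  finally show ?case unfolding M by simp
qed

text \<open>The first row removes the smallest part, and the rest is again a staircase, with start
  \<open>p + 2\<close> and the same number of sites. \<open>up_rows\<close> is used for both halves
  of that row, which gives the factors \<open>x \<oplus> z\<close> twice.\<close>

lemma rows_steps_base: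
  assumes "0 < p" "length zs = Suc i" "distinct zs" "\<And>z. z \<in> set zs \<Longrightarrow> 0 < z"
  shows "rows True (p + 2 * i) zs (unit_vec {}) (steps p (Suc i)) =
    (\<Prod>z\<in>set zs. z ^ (p - 1)) * (\<Prod>z\<in>set zs. \<Prod>w\<in>set zs. z \<oplus> w)"
  using assms
proof (induction zs arbitrary: p i)
  case (Cons x zs)
  let ?m = "p + 2 * i" and ?c = "\<Prod>z\<in>set zs. (x \<oplus> z) / z"
  let ?F = "rows True ?m zs (unit_vec {})"
  have len: "length zs = i" using Cons.prems by simp
  have "rows True ?m (x # zs) (unit_vec {}) (steps p (Suc i)) =
      (x \<oplus> x) * ?c * down ?m x (insert_one ?F) (steps p (Suc i))"
    using Cons.prems by (intro rows_Cons_top) auto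
  also have "down ?m x (insert_one ?F) (steps p (Suc i)) = x ^ (p - 1) * up ?m x ?F (steps (p + 2) i)"
    using down_steps[of p "{}" i x ?F] up_steps[of "{}" p i x ?F] Cons.prems(1) by simp
  also have "up ?m x ?F (steps (p + 2) i) = ?F (steps (p + 2) i) * ?c"
    using Cons.prems len by (intro up_rows) (auto dest: steps_bound)
  also have "?F (steps (p + 2) i) = (\<Prod>z\<in>set zs. z ^ (p + 1)) * (\<Prod>z\<in>set zs. \<Prod>w\<in>set zs. z \<oplus> w)"
  proof (cases i)
    case 0
    then show ?thesis using len by (simp add: steps_def unit_vec_def)
  next
    case (Suc j)
    then show ?thesis using Cons.IH[of "p + 2" j] Cons.prems by simp
  qed
  \<comment> \<open>The extra square cancels the denominators of the two factors
    \<open>?c\<close>.\<close>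
  also have "(\<Prod>z\<in>set zs. z ^ (p + 1)) = (\<Prod>z\<in>set zs. z ^ (p - 1)) * (\<Prod>z\<in>set zs. z) ^ 2"
  proof -
    have "z ^ (p + 1) = z ^ (p - 1) * z ^ 2" for z :: real
      using Cons.prems(1) by (metis Suc_pred' add.commute add_2_eq_Suc' plus_1_eq_Suc power_add)
    then show ?thesis by (simp only: prod.distrib prod_power_distrib)
  qed
  also have "?c = (\<Prod>z\<in>set zs. x \<oplus> z) / (\<Prod>z\<in>set zs. z)"
    by (simp add: prod_dividef)
  finally have *: "rows True ?m (x # zs) (unit_vec {}) (steps p (Suc i)) =
      (x \<oplus> x) * ((\<Prod>z\<in>set zs. x \<oplus> z) / (\<Prod>z\<in>set zs. z)) * (x ^ (p - 1) *
      ((\<Prod>z\<in>set zs. z ^ (p - 1)) * (\<Prod>z\<in>set zs. z) ^ 2 * (\<Prod>z\<in>set zs. \<Prod>w\<in>set zs. z \<oplus> w) *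
       ((\<Prod>z\<in>set zs. x \<oplus> z) / (\<Prod>z\<in>set zs. z))))" .
  have nz: "(\<Prod>z\<in>set zs. z) \<noteq> 0" using Cons.prems by force
  have split: "(\<Prod>z\<in>set (x # zs). \<Prod>w\<in>set (x # zs). z \<oplus> w) =
     (x \<oplus> x) * (\<Prod>z\<in>set zs. x \<oplus> z) ^ 2 * (\<Prod>z\<in>set zs. \<Prod>w\<in>set zs. z \<oplus> w)"
    using Cons.prems by (simp add: prod.distrib power2_eq_square oplus_commute mult_ac)
  show ?case
    unfolding * split using nz Cons.prems by (simp add: field_simps power2_eq_square)
qed simp

text \<open>With \<open>p = b - a + 1\<close> one has \<open>p - 1 = b - a\<close> and
  \<open>p + 2 * (a - 1) = a + b - 1\<close>, so the two base values and the two numbers of sites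
  coincide.\<close>

theorem rows_block_eq_rows_steps:
  assumes "0 < a" "a \<le> b" "distinct zs" "\<And>z. z \<in> set zs \<Longrightarrow> 0 < z"
  shows "rows False (a + b - 1) zs (unit_vec {1..a}) (block a b) =
    rows True (a + b - 1) zs (unit_vec {}) (steps (b - a + 1) a)"
proof -
  let ?m = "a + b - 1"
  have z1: "rows False ?m zs (unit_vec {1..a}) (block a b) = 0" if "length zs < a" for zs
    using pair_rows_block_zero[of "map (\<lambda>z. (z, z)) zs" a b] that assms(2) by (simp add: rows_False)
  have z2: "rows True ?m zs (unit_vec {}) (steps (b - a + 1) a) = 0" if "length zs < a" for zs
    using that by (intro rows_card_zero) auto
  show ?thesis
  proof (cases zs)
    case Nil
    then show ?thesis using z1[of "[]"] z2[of "[]"] assms(1) by simp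
  next
    case (Cons x xs)
    have "row False ?m x x (rows False ?m xs (unit_vec {1..a})) (block a b) =
      row True ?m x x (rows True ?m xs (unit_vec {})) (steps (b - a + 1) a)"
    proof (rule rows_determined[where a = a])
      fix zs :: "real list" assume zs: "length zs = a" "distinct zs" "\<forall>z\<in>set zs. 0 < z"
      obtain i where i: "a = Suc i" using assms(1) by (cases a) auto
      have "?m = b - a + 1 + 2 * i" using assms(2) i by simp
      then show "rows False ?m zs (unit_vec {1..a}) (block a b) = rows True ?m zs (unit_vec {}) (steps (b - a + 1) a)"
        using rows_block_base[of a b zs] rows_steps_base[of "b - a + 1" zs i] zs assms(1,2) i by simp
    next
      fix x y :: real and zs :: "real list" assume l: "Suc (length zs) < a"
      show "row False ?m x y (rows False ?m zs (unit_vec {1..a})) (block a b) = 0"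
        using pair_rows_block_zero[of "(x, y) # map (\<lambda>z. (z, z)) zs" a b] l assms(2) by (simp add: rows_False)
      show "row True ?m x y (rows True ?m zs (unit_vec {})) (steps (b - a + 1) a) = 0"
        using l by (intro row_card_zero[where k = "length zs"] rows_card_zero) auto
    qed (use z1 z2 assms Cons in \<open>auto simp: block_def\<close>)
    then show ?thesis using Cons by simp
  qed
qed

end

subsection \<open>Set-valued tableaux\<close>

text \<open>A strict partition is encoded by its set \<open>S\<close> of parts; the cells of content \<open>c\<close> then
  lie in the rows \<open>1, \<dots>, parts_above S c\<close>.\<close>

definition parts_above :: "nat set \<Rightarrow> nat \<Rightarrow> nat" where
  "parts_above S c = card {t \<in> S. c < t}"

definition cells :: "nat set \<Rightarrow> (nat \<times> nat) set" where
  "cells S = {(i, j). 1 \<le> i \<and> i \<le> j \<and> i \<le> parts_above S (j - i)}"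

definition cell_content :: "nat \<times> nat \<Rightarrow> nat" where
  "cell_content c = snd c - fst c"

text \<open>Removing the last cell of content \<open>c\<close> lowers the part \<open>Suc c\<close>
  to \<open>c\<close>. The parts stay distinct if \<open>c\<close> is not a part already; for
  \<open>c = 0\<close> the part simply disappears.\<close>

definition corner :: "nat \<Rightarrow> nat set \<Rightarrow> bool" where
  "corner c S \<longleftrightarrow> Suc c \<in> S \<and> (c = 0 \<or> c \<notin> S)"

definition remove_corner :: "nat \<Rightarrow> nat set \<Rightarrow> nat set" where
  "remove_corner c S = (if c = 0 then S - {1} else insert c (S - {Suc c}))"

definition corner_cell :: "nat \<Rightarrow> nat set \<Rightarrow> nat \<times> nat" where
  "corner_cell c S = (parts_above S c, parts_above S c + c)"

lemma parts_above_Suc: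
  assumes "finite S"
  shows "parts_above S c = parts_above S (Suc c) + (if Suc c \<in> S then 1 else 0)"
proof -
  have "{t \<in> S. c < t} = (if Suc c \<in> S then insert (Suc c) {t \<in> S. Suc c < t} else {t \<in> S. Suc c < t})"
    by (auto simp: less_Suc_eq intro: Suc_lessI)
  then show ?thesis using assms by (simp add: parts_above_def)
qed

lemma parts_above_remove_corner:
  assumes "finite S" "corner c S"
  shows "parts_above (remove_corner c S) d = (if d = c then parts_above S c - 1 else parts_above S d)"
proof -
  consider "d < c" | "d = c" | "c < d" by linarith
  then show ?thesis
  proof cases
    case 1
    then have "{t \<in> remove_corner c S. d < t} = insert c ({t \<in> S. d < t} - {Suc c})" "c \<notin> {t \<in> S. d < t}"
      "Suc c \<in> {t \<in> S. d < t}"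
      using assms by (auto simp: remove_corner_def corner_def)
    moreover have "card (insert x (A - {y})) = card A" if "finite A" "x \<notin> A" "y \<in> A" for A and x y :: nat
      using that by (metis card.remove card_insert_disjoint Diff_iff finite_Diff)
    ultimately have "card {t \<in> remove_corner c S. d < t} = card {t \<in> S. d < t}"
      using assms(1) by simp
    then show ?thesis using 1 by (simp add: parts_above_def)
  next
    case 2
    then have "{t \<in> remove_corner c S. d < t} = {t \<in> S. d < t} - {Suc c}" "Suc c \<in> {t \<in> S. d < t}"
      using assms by (auto simp: remove_corner_def corner_def)
    then show ?thesis using 2 assms(1) by (simp add: parts_above_def)
  next
    case 3
    then have "{t \<in> remove_corner c S. d < t} = {t \<in> S. d < t}"
      using assms by (auto simp: remove_corner_def corner_def)
    then show ?thesis using 3 by (simp add: parts_above_def)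
  qed
qed

lemma corner_parts_above: "finite S \<Longrightarrow> corner c S \<Longrightarrow> 0 < parts_above S c"
  by (auto simp: parts_above_def corner_def card_gt_0_iff)

lemma corner_cell_in: "finite S \<Longrightarrow> corner c S \<Longrightarrow> corner_cell c S \<in> cells S"
  using corner_parts_above[of S c] by (auto simp: cells_def corner_cell_def)

lemma content_corner_cell [simp]: "cell_content (corner_cell c S) = c"
  by (simp add: cell_content_def corner_cell_def)

lemma cells_remove_corner:
  assumes "finite S" "corner c S"
  shows "cells (remove_corner c S) = cells S - {corner_cell c S}"
proof -
  have "(i, j) \<in> cells (remove_corner c S) \<longleftrightarrow> (i, j) \<in> cells S - {corner_cell c S}" for i j
  proof (cases "j - i = c")
    case True
    have "i \<le> n - 1 \<longleftrightarrow> i \<le> n \<and> i \<noteq> n" if "0 < n" for n :: nat using that by auto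
    then show ?thesis
      using True corner_parts_above[OF assms] parts_above_remove_corner[OF assms, of c]
      by (auto simp: cells_def corner_cell_def)
  next
    case False
    then show ?thesis
      using parts_above_remove_corner[OF assms, of "j - i"] by (auto simp: cells_def corner_cell_def)
  qed
  then show ?thesis by auto
qed

lemma finite_cells: "finite S \<Longrightarrow> finite (cells S)"
proof -
  assume S: "finite S"
  obtain m where m: "\<forall>t\<in>S. t \<le> m" using S finite_nat_set_iff_bounded_le by blast
  have "cells S \<subseteq> {..card S} \<times> {..card S + m}"
  proof
    fix p assume "p \<in> cells S"
    then obtain i j where p: "p = (i, j)" "1 \<le> i" "i \<le> j" "i \<le> parts_above S (j - i)"
      by (auto simp: cells_def)
    have "parts_above S (j - i) \<le> card S"
      unfolding parts_above_def using S by (intro card_mono) auto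
    moreover have "{t \<in> S. j - i < t} \<noteq> {}"
      using p by (auto simp: parts_above_def simp del: Collect_empty_eq)
    then have "j - i < m" using m by (auto intro: less_le_trans)
    ultimately show "p \<in> {..card S} \<times> {..card S + m}" using p by auto
  qed
  then show ?thesis using finite_subset by blast
qed

text \<open>With content \<open>c\<close>, the missing right neighbour shows that
  \<open>Suc c\<close> is a part, the missing lower neighbour that a positive \<open>c\<close> is
  not.\<close>

lemma cell_is_corner:
  assumes "finite S" "p \<in> cells S" "(fst p, Suc (snd p)) \<notin> cells S" "(Suc (fst p), snd p) \<notin> cells S"
  shows "corner (cell_content p) S" "p = corner_cell (cell_content p) S"
proof -
  obtain r j where p: "p = (r, j)" by (cases p)
  define c where "c = j - r"
  have r: "1 \<le> r" "j = r + c" "r \<le> parts_above S c" using assms(2) p c_def by (auto simp: cells_def)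
  have 1: "parts_above S (Suc c) < r" using assms(3) r p by (auto simp: cells_def Suc_diff_le)
  then have "Suc c \<in> S" "r = parts_above S c"
    using parts_above_Suc[OF assms(1), of c] r by (auto split: if_splits)
  moreover have "c \<notin> S" if "c \<noteq> 0"
  proof -
    obtain d where d: "c = Suc d" using \<open>c \<noteq> 0\<close> by (cases c) auto
    have "parts_above S d \<le> r" using assms(4) r p d by (auto simp: cells_def)
    then show ?thesis using parts_above_Suc[OF assms(1), of d] \<open>r = parts_above S c\<close> d by (auto split: if_splits)
  qed
  moreover have "cell_content p = c" using p r by (simp add: cell_content_def)
  ultimately show "corner (cell_content p) S" "p = corner_cell (cell_content p) S"
    using p r by (auto simp: corner_def corner_cell_def)
qed

lemma corner_cell_edge:
  assumes "finite S" "corner c S"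
  shows "(fst (corner_cell c S), Suc (snd (corner_cell c S))) \<notin> cells S"
    "(Suc (fst (corner_cell c S)), snd (corner_cell c S)) \<notin> cells S"
proof -
  show "(fst (corner_cell c S), Suc (snd (corner_cell c S))) \<notin> cells S"
    using assms parts_above_Suc[of S c] by (auto simp: cells_def corner_cell_def corner_def Suc_diff_le)
  show "(Suc (fst (corner_cell c S)), snd (corner_cell c S)) \<notin> cells S"
  proof (cases c)
    case (Suc d)
    then show ?thesis using assms parts_above_Suc[of S d] by (auto simp: cells_def corner_cell_def corner_def)
  qed (simp add: cells_def corner_cell_def)
qed

text \<open>An integer key for the order: \<open>sgn\<close> varies by at most \<open>2\<close>, so
  the factor \<open>3\<close> lets absolute values dominate. Transitivity and linearity are
  inherited from the integers.\<close>

lemma prec_eq_key: "s \<preceq> t \<longleftrightarrow> 3 * \<bar>s\<bar> + sgn s \<le> 3 * \<bar>t\<bar> + sgn t"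
  by (auto simp: prec_eq_def sgn_if abs_if split: if_splits)

lemma prec_eq_refl: "s \<preceq> s"
  by (simp add: prec_eq_key)

lemma prec_eq_trans: "s \<preceq> t \<Longrightarrow> t \<preceq> r \<Longrightarrow> s \<preceq> r"
  by (simp add: prec_eq_key)

lemma prec_eq_antisym: "s \<preceq> t \<Longrightarrow> t \<preceq> s \<Longrightarrow> s = t"
  by (auto simp: prec_eq_def)

lemma prec_max:
  assumes "finite A" "A \<noteq> {}"
  shows "prec_max A \<in> A" "\<And>s. s \<in> A \<Longrightarrow> s \<preceq> prec_max A"
proof -
  have "\<exists>m\<in>A. \<forall>s\<in>A. s \<preceq> m"
    using assms
  proof (induction rule: finite_ne_induct)
    case (singleton s)
    then show ?case by (simp add: prec_eq_refl)
  next
    case (insert s A)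
    then obtain m where m: "m \<in> A" "\<forall>s\<in>A. s \<preceq> m" by blast
    then show ?case
      using linear[of "3 * \<bar>s\<bar> + sgn s" "3 * \<bar>m\<bar> + sgn m"] prec_eq_refl[of s] prec_eq_trans
      unfolding prec_eq_key[symmetric] by blast
  qed
  then have "\<exists>!m. m \<in> A \<and> (\<forall>s\<in>A. s \<preceq> m)" using prec_eq_antisym by blast
  from theI'[OF this] show "prec_max A \<in> A" "\<And>s. s \<in> A \<Longrightarrow> s \<preceq> prec_max A"
    unfolding prec_max_def by blast+
qed

lemma prec_min:
  assumes "finite A" "A \<noteq> {}"
  shows "prec_min A \<in> A" "\<And>s. s \<in> A \<Longrightarrow> prec_min A \<preceq> s"
proof -
  have "\<exists>m\<in>A. \<forall>s\<in>A. m \<preceq> s"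
    using assms
  proof (induction rule: finite_ne_induct)
    case (singleton s)
    then show ?case by (simp add: prec_eq_refl)
  next
    case (insert s A)
    then obtain m where m: "m \<in> A" "\<forall>s\<in>A. m \<preceq> s" by blast
    then show ?case
      using linear[of "3 * \<bar>s\<bar> + sgn s" "3 * \<bar>m\<bar> + sgn m"] prec_eq_refl[of s] prec_eq_trans
      unfolding prec_eq_key[symmetric] by blast
  qed
  then have "\<exists>!m. m \<in> A \<and> (\<forall>s\<in>A. m \<preceq> s)" using prec_eq_antisym by blast
  from theI'[OF this] show "prec_min A \<in> A" "\<And>s. s \<in> A \<Longrightarrow> prec_min A \<preceq> s"
    unfolding prec_min_def by blast+
qed

text \<open>Comparing all pairs of entries is stable under inserting and deleting single entries,
  without recomputing maxima and minima.\<close>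

definition below :: "(int \<Rightarrow> bool) \<Rightarrow> int set \<Rightarrow> int set \<Rightarrow> bool" where
  "below P A B \<longleftrightarrow> (\<forall>s\<in>A. \<forall>t\<in>B. s \<preceq> t \<and> (s = t \<longrightarrow> P s))"

lemma below_max_min:
  assumes "finite A" "A \<noteq> {}" "finite B" "B \<noteq> {}"
  shows "prec_max A \<preceq> prec_min B \<and> (prec_max A = prec_min B \<longrightarrow> P (prec_max A)) \<longleftrightarrow> below P A B"
proof
  assume *: "prec_max A \<preceq> prec_min B \<and> (prec_max A = prec_min B \<longrightarrow> P (prec_max A))"
  show "below P A B"
    unfolding below_def
  proof (intro ballI)
    fix s t assume st: "s \<in> A" "t \<in> B"
    then have "s \<preceq> prec_max A" "prec_min B \<preceq> t" using prec_max prec_min assms by auto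
    then show "s \<preceq> t \<and> (s = t \<longrightarrow> P s)"
      using * prec_eq_trans prec_eq_antisym by metis
  qed
next
  assume "below P A B"
  then show "prec_max A \<preceq> prec_min B \<and> (prec_max A = prec_min B \<longrightarrow> P (prec_max A))"
    using prec_max(1)[OF assms(1,2)] prec_min(1)[OF assms(3,4)] unfolding below_def by blast
qed

text \<open>Bounding the entries cell by cell, according to content, allows letters to be entered one
  content at a time.\<close>

definition tableaux :: "(int \<times> nat) set \<Rightarrow> nat set \<Rightarrow> (nat \<times> nat \<Rightarrow> int set) set" where
  "tableaux E S = {T \<in> cells S \<rightarrow>\<^sub>E {A. finite A \<and> A \<noteq> {}}.
     (\<forall>p\<in>cells S. \<forall>s\<in>T p. (s, cell_content p) \<in> E) \<and>
     (\<forall>i j. (i, j) \<in> cells S \<and> (i + 1, j) \<in> cells S \<longrightarrow> below (\<lambda>s. s < 0) (T (i, j)) (T (i + 1, j))) \<and>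
     (\<forall>i j. (i, j) \<in> cells S \<and> (i, j + 1) \<in> cells S \<longrightarrow> below (\<lambda>s. 0 < s) (T (i, j)) (T (i, j + 1)))}"

lemma finite_tableaux:
  assumes "finite E" "finite S" shows "finite (tableaux E S)"
proof (rule finite_subset)
  show "tableaux E S \<subseteq> cells S \<rightarrow>\<^sub>E Pow (fst ` E)"
  proof
    fix T assume T: "T \<in> tableaux E S"
    then have "T p \<subseteq> fst ` E" if "p \<in> cells S" for p
      using that unfolding tableaux_def by (force intro: rev_image_eqI)
    then show "T \<in> cells S \<rightarrow>\<^sub>E Pow (fst ` E)"
      using T by (auto simp: tableaux_def PiE_iff)
  qed
  show "finite (cells S \<rightarrow>\<^sub>E Pow (fst ` E))"
    using assms finite_cells by (intro finite_PiE) auto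
qed

text \<open>\<open>(s, c)\<close> may be entered after \<open>(t, d)\<close>: marked letters sweep the contents downwards and
  unmarked ones upwards, so that a newly entered letter always sits in a corner.\<close>

definition later :: "int \<times> nat \<Rightarrow> int \<times> nat \<Rightarrow> bool" where
  "later q p \<longleftrightarrow> fst q \<preceq> fst p \<and>
     (fst q = fst p \<longrightarrow> (if fst p < 0 then snd p < snd q else snd q < snd p))"

text \<open>No neighbour to the right or below can hold a later letter. An equal letter to the right
  must be positive, and one below negative, but the sweep order admits \<open>s\<close> at content
  \<open>c + 1\<close> only if it is negative and at \<open>c - 1\<close> only if it is
  positive.\<close>

lemma new_entry_in_corner:
  assumes "finite S" "\<forall>q\<in>E. later q (s, c)" "T \<in> tableaux (insert (s, c) E) S"
    "p \<in> cells S" "s \<in> T p" "cell_content p = c" "s \<noteq> 0"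
  shows "corner c S" "p = corner_cell c S"
proof -
  have E: "(t, cell_content q) \<in> insert (s, c) E" if "q \<in> cells S" "t \<in> T q" for q t
    using assms(3) that by (auto simp: tableaux_def)
  obtain i j where p: "p = (i, j)" by (cases p)
  have ij: "1 \<le> i" "i \<le> j" "c = j - i" using assms(4,6) p by (auto simp: cells_def cell_content_def)
  have ne: "T q \<noteq> {}" if "q \<in> cells S" for q using assms(3) that by (auto simp: tableaux_def PiE_iff)
  have r: "(fst p, Suc (snd p)) \<notin> cells S"
  proof
    assume a: "(fst p, Suc (snd p)) \<in> cells S"
    then obtain t where t: "t \<in> T (i, Suc j)" using ne p by fastforce
    have "cell_content (i, Suc j) = Suc c" using ij by (simp add: cell_content_def Suc_diff_le)
    then have "(t, Suc c) \<in> E" using E[of "(i, Suc j)" t] a t p by auto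
    then have l: "t \<preceq> s" "t = s \<longrightarrow> s < 0" using assms(2,7) by (fastforce simp: later_def split: if_splits)+
    have "below (\<lambda>s. 0 < s) (T (i, j)) (T (i, Suc j))"
      using assms(3,4) a p by (simp add: tableaux_def)
    then have "s \<preceq> t" "s = t \<longrightarrow> 0 < s" using assms(5) t p by (auto simp: below_def)
    then show False using l prec_eq_antisym by force
  qed
  have b: "(Suc (fst p), snd p) \<notin> cells S"
  proof
    assume a: "(Suc (fst p), snd p) \<in> cells S"
    then obtain t where t: "t \<in> T (Suc i, j)" using ne p by fastforce
    have "Suc i \<le> j" using a p by (auto simp: cells_def)
    then have "c = Suc (cell_content (Suc i, j))" using ij by (simp add: cell_content_def Suc_diff_Suc)
    then have "(t, c - 1) \<in> E" "0 < c" using E[of "(Suc i, j)" t] a t p by auto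
    then have l: "t \<preceq> s" "t = s \<longrightarrow> 0 < s" using assms(2,7) by (fastforce simp: later_def split: if_splits)+
    have "below (\<lambda>s. s < 0) (T (i, j)) (T (Suc i, j))"
      using assms(3,4) a p by (simp add: tableaux_def)
    then have "s \<preceq> t" "s = t \<longrightarrow> s < 0" using assms(5) t p by (auto simp: below_def)
    then show False using l prec_eq_antisym by force
  qed
  show "corner c S" "p = corner_cell c S"
    using cell_is_corner[OF assms(1,4) r b] assms(6) by auto
qed

lemma tableaux_old:
  "{T \<in> tableaux (insert (s, c) E) S. \<forall>p\<in>cells S. cell_content p = c \<longrightarrow> s \<notin> T p} = tableaux E S"
  if "(s, c) \<notin> E"
proof (intro set_eqI)
  fix T
  have "(\<forall>p\<in>cells S. \<forall>t\<in>T p. (t, cell_content p) \<in> insert (s, c) E) \<and> (\<forall>p\<in>cells S. cell_content p = c \<longrightarrow> s \<notin> T p)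
    \<longleftrightarrow> (\<forall>p\<in>cells S. \<forall>t\<in>T p. (t, cell_content p) \<in> E)" (is "?L \<longleftrightarrow> ?R")
  proof
    assume ?L
    then show ?R by (metis insertE Pair_inject)
  next
    assume R: ?R
    then show ?L using that by (metis insertI2)
  qed
  then show "T \<in> {T \<in> tableaux (insert (s, c) E) S. \<forall>p\<in>cells S. cell_content p = c \<longrightarrow> s \<notin> T p} \<longleftrightarrow> T \<in> tableaux E S"
    unfolding tableaux_def mem_Collect_eq by argo
qed

lemma tableauxI:
  assumes "T \<in> cells S \<rightarrow>\<^sub>E {A. finite A \<and> A \<noteq> {}}"
    "\<And>p s. p \<in> cells S \<Longrightarrow> s \<in> T p \<Longrightarrow> (s, cell_content p) \<in> E"
    "\<And>i j. (i, j) \<in> cells S \<Longrightarrow> (i + 1, j) \<in> cells S \<Longrightarrow> below (\<lambda>s. s < 0) (T (i, j)) (T (i + 1, j))"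
    "\<And>i j. (i, j) \<in> cells S \<Longrightarrow> (i, j + 1) \<in> cells S \<Longrightarrow> below (\<lambda>s. 0 < s) (T (i, j)) (T (i, j + 1))"
  shows "T \<in> tableaux E S"
  using assms unfolding tableaux_def by simp

lemma tableauxD:
  assumes "T \<in> tableaux E S"
  shows "T \<in> cells S \<rightarrow>\<^sub>E {A. finite A \<and> A \<noteq> {}}"
    "p \<in> cells S \<Longrightarrow> s \<in> T p \<Longrightarrow> (s, cell_content p) \<in> E"
    "(i, j) \<in> cells S \<Longrightarrow> (i + 1, j) \<in> cells S \<Longrightarrow> below (\<lambda>s. s < 0) (T (i, j)) (T (i + 1, j))"
    "(i, j) \<in> cells S \<Longrightarrow> (i, j + 1) \<in> cells S \<Longrightarrow> below (\<lambda>s. 0 < s) (T (i, j)) (T (i, j + 1))"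
  using assms unfolding tableaux_def by simp_all

text \<open>At a corner only the left and the upper neighbour compare with \<open>s\<close>, and
  \<open>later\<close> places their entries before \<open>s\<close> with exactly the permitted
  equalities.\<close>

lemma tableaux_append:
  assumes S: "finite S" "corner c S" and later: "\<forall>q\<in>E. later q (s, c)" and T: "T \<in> tableaux E S" and s: "s \<noteq> 0"
  shows "T(corner_cell c S := insert s (T (corner_cell c S))) \<in> tableaux (insert (s, c) E) S"
proof -
  let ?c = "corner_cell c S"
  let ?T = "T(?c := insert s (T ?c))"
  have c: "?c \<in> cells S" by (rule corner_cell_in[OF S])
  have E: "(t, cell_content q) \<in> E" if "q \<in> cells S" "t \<in> T q" for q t
    using T that by (auto simp: tableaux_def)
  have l: "t \<preceq> s \<and> (t = s \<longrightarrow> (if s < 0 then c < d else d < c))" if "(t, d) \<in> E" for t d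
    using later that by (fastforce simp: later_def)
  have v: "below (\<lambda>s. s < 0) (?T (i, j)) (?T (i + 1, j))" if ij: "(i, j) \<in> cells S" "(i + 1, j) \<in> cells S" for i j
  proof -
    have o: "below (\<lambda>s. s < 0) (T (i, j)) (T (i + 1, j))" using T ij by (simp add: tableaux_def)
    have "(i, j) \<noteq> ?c" using corner_cell_edge(2)[OF S] ij by (metis Suc_eq_plus1 fst_conv snd_conv)
    moreover have "t \<preceq> s \<and> (t = s \<longrightarrow> t < 0)" if "(i + 1, j) = ?c" "t \<in> T (i, j)" for t
    proof -
      have "cell_content (i, j) = Suc c"
        using ij(2) content_corner_cell[of c S] unfolding that(1)[symmetric] by (auto simp: cell_content_def cells_def)
      then have "(t, Suc c) \<in> E" using E[OF ij(1) that(2)] by simp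
      then show ?thesis using l[of t "Suc c"] by (auto split: if_splits)
    qed
    ultimately show ?thesis using o by (auto simp: below_def)
  qed
  have h: "below (\<lambda>s. 0 < s) (?T (i, j)) (?T (i, j + 1))" if ij: "(i, j) \<in> cells S" "(i, j + 1) \<in> cells S" for i j
  proof -
    have o: "below (\<lambda>s. 0 < s) (T (i, j)) (T (i, j + 1))" using T ij by (simp add: tableaux_def)
    have "(i, j) \<noteq> ?c" using corner_cell_edge(1)[OF S] ij by (metis Suc_eq_plus1 fst_conv snd_conv)
    moreover have "t \<preceq> s \<and> (t = s \<longrightarrow> 0 < t)" if "(i, j + 1) = ?c" "t \<in> T (i, j)" for t
    proof -
      have "c = Suc (cell_content (i, j))"
        using ij(1) content_corner_cell[of c S] unfolding that(1)[symmetric] by (auto simp: cell_content_def cells_def Suc_diff_le)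
      then have "(t, c - 1) \<in> E" "0 < c" using E[OF ij(1) that(2)] by auto
      then show ?thesis using l[of t "c - 1"] s by (auto split: if_splits)
    qed
    ultimately show ?thesis using o by (auto simp: below_def)
  qed
  show ?thesis
  proof (rule tableauxI[OF _ _ v h])
    show "?T \<in> cells S \<rightarrow>\<^sub>E {A. finite A \<and> A \<noteq> {}}"
      using tableauxD(1)[OF T] c by (auto simp: PiE_iff extensional_def)
    show "(t, cell_content p) \<in> insert (s, c) E" if "p \<in> cells S" "t \<in> ?T p" for p t
      using that E[of p t] by (auto split: if_splits)
  qed
qed

lemma tableaux_delete:
  assumes S: "finite S" "corner c S" and E: "(s, c) \<notin> E" "\<forall>q\<in>E. later q (s, c)" and s: "s \<noteq> 0"
    and T: "T \<in> tableaux (insert (s, c) E) S" "T (corner_cell c S) \<noteq> {s}"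
  shows "T(corner_cell c S := T (corner_cell c S) - {s}) \<in> tableaux E S"
proof -
  let ?c = "corner_cell c S"
  let ?T = "T(?c := T ?c - {s})"
  have c: "?c \<in> cells S" by (rule corner_cell_in[OF S])
  have sub: "?T p \<subseteq> T p" for p by auto
  have m: "below P (T p) (T q) \<Longrightarrow> below P (?T p) (?T q)" for P p q
    using sub[of p] sub[of q] unfolding below_def by blast
  have ne: "T p \<noteq> {}" "finite (T p)" if "p \<in> cells S" for p using T(1) that by (auto simp: tableaux_def PiE_iff)
  show ?thesis
  proof (rule tableauxI)
    fix p t assume p: "p \<in> cells S" "t \<in> ?T p"
    then have "(t, cell_content p) \<in> insert (s, c) E" using T(1) sub[of p] by (auto simp: tableaux_def)
    moreover have "(t, cell_content p) \<noteq> (s, c)"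
      using new_entry_in_corner(2)[OF S(1) E(2) T(1) p(1) _ _ s] p(2) sub[of p] by (auto split: if_splits)
    ultimately show "(t, cell_content p) \<in> E" by auto
  next
    show "?T \<in> cells S \<rightarrow>\<^sub>E {A. finite A \<and> A \<noteq> {}}"
      using tableauxD(1)[OF T(1)] T(2) c ne[OF c] by (auto simp: PiE_iff extensional_def)
  qed (rule m, erule (1) tableauxD[OF T(1)])+
qed

lemma tableaux_new_cell:
  assumes S: "finite S" "corner c S" and later: "\<forall>q\<in>E. later q (s, c)"
    and T: "T \<in> tableaux E (remove_corner c S)" and s: "s \<noteq> 0"
  shows "T(corner_cell c S := {s}) \<in> tableaux (insert (s, c) E) S"
proof -
  let ?c = "corner_cell c S"
  let ?T = "T(?c := {s})"
  note cr = cells_remove_corner[OF S]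
  have c: "?c \<in> cells S" by (rule corner_cell_in[OF S])
  have E: "(t, cell_content q) \<in> E" if "q \<in> cells S" "q \<noteq> ?c" "t \<in> T q" for q t
    using T that by (auto simp: tableaux_def cr)
  have l: "t \<preceq> s \<and> (t = s \<longrightarrow> (if s < 0 then c < d else d < c))" if "(t, d) \<in> E" for t d
    using later that by (fastforce simp: later_def)
  have v: "below (\<lambda>s. s < 0) (?T (i, j)) (?T (i + 1, j))" if ij: "(i, j) \<in> cells S" "(i + 1, j) \<in> cells S" for i j
  proof -
    have n: "(i, j) \<noteq> ?c" using corner_cell_edge(2)[OF S] ij by (metis Suc_eq_plus1 fst_conv snd_conv)
    show ?thesis
    proof (cases "(i + 1, j) = ?c")
      case True
      have "t \<preceq> s \<and> (t = s \<longrightarrow> t < 0)" if "t \<in> T (i, j)" for t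
      proof -
        have "cell_content (i, j) = Suc c"
          using ij(2) content_corner_cell[of c S] unfolding True[symmetric] by (auto simp: cell_content_def cells_def)
        then have "(t, Suc c) \<in> E" using E[OF ij(1) n that] by simp
        then show ?thesis using l[of t "Suc c"] by (auto split: if_splits)
      qed
      then show ?thesis using n True by (auto simp: below_def)
    next
      case False
      then show ?thesis using T n ij by (simp add: tableaux_def cr)
    qed
  qed
  have h: "below (\<lambda>s. 0 < s) (?T (i, j)) (?T (i, j + 1))" if ij: "(i, j) \<in> cells S" "(i, j + 1) \<in> cells S" for i j
  proof -
    have n: "(i, j) \<noteq> ?c" using corner_cell_edge(1)[OF S] ij by (metis Suc_eq_plus1 fst_conv snd_conv)
    show ?thesis
    proof (cases "(i, j + 1) = ?c")
      case True
      have "t \<preceq> s \<and> (t = s \<longrightarrow> 0 < t)" if "t \<in> T (i, j)" for t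
      proof -
        have "c = Suc (cell_content (i, j))"
          using ij(1) content_corner_cell[of c S] unfolding True[symmetric] by (auto simp: cell_content_def cells_def Suc_diff_le)
        then have "(t, c - 1) \<in> E" "0 < c" using E[OF ij(1) n that] by auto
        then show ?thesis using l[of t "c - 1"] s by (auto split: if_splits)
      qed
      then show ?thesis using n True by (auto simp: below_def)
    next
      case False
      then show ?thesis using T n ij by (simp add: tableaux_def cr)
    qed
  qed
  show ?thesis
  proof (rule tableauxI[OF _ _ v h])
    show "?T \<in> cells S \<rightarrow>\<^sub>E {A. finite A \<and> A \<noteq> {}}"
      using tableauxD(1)[OF T] c by (auto simp: PiE_iff extensional_def cr)
    show "(t, cell_content p) \<in> insert (s, c) E" if "p \<in> cells S" "t \<in> ?T p" for p t
      using that E[of p t] by (auto split: if_splits)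
  qed
qed

text \<open>The value \<open>undefined\<close> is what the extensional function space
  \<open>\<rightarrow>\<^sub>E\<close> demands at the cell that has left the diagram.\<close>

lemma tableaux_drop_cell:
  assumes S: "finite S" "corner c S" and E: "(s, c) \<notin> E" "\<forall>q\<in>E. later q (s, c)" and s: "s \<noteq> 0"
    and T: "T \<in> tableaux (insert (s, c) E) S" "T (corner_cell c S) = {s}"
  shows "T(corner_cell c S := undefined) \<in> tableaux E (remove_corner c S)"
proof -
  let ?c = "corner_cell c S"
  note cr = cells_remove_corner[OF S]
  have "(t, cell_content p) \<in> E" if p: "p \<in> cells S" "p \<noteq> ?c" "t \<in> T p" for p t
  proof -
    have "(t, cell_content p) \<in> insert (s, c) E" using T(1) p by (auto simp: tableaux_def)
    moreover have "(t, cell_content p) \<noteq> (s, c)"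
      using new_entry_in_corner(2)[OF S(1) E(2) T(1) p(1) _ _ s] p by auto
    ultimately show ?thesis by auto
  qed
  then show ?thesis
    using T(1) by (auto simp: tableaux_def cr PiE_iff extensional_def)
qed

section \<open>Tableau generating functions as products of rows\<close>

context site_model
begin

definition weight :: "(nat \<Rightarrow> real) \<Rightarrow> nat set \<Rightarrow> (nat \<times> nat \<Rightarrow> int set) \<Rightarrow> real" where
  "weight x S T = (\<Prod>p\<in>cells S. \<beta> ^ (card (T p) - 1) * (\<Prod>s\<in>T p. x (nat \<bar>s\<bar>)))"

definition tableau_sum :: "(nat \<Rightarrow> real) \<Rightarrow> (int \<times> nat) set \<Rightarrow> vec" where
  "tableau_sum x E S = (\<Sum>T\<in>tableaux E S. weight x S T)"

definition letter :: "nat \<Rightarrow> real \<Rightarrow> vec \<Rightarrow> vec" where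
  "letter c z F = (if c = 0 then create z F else hop c z F)"

lemma letter_0: "letter 0 z F = create z F"
  by (simp add: letter_def)

lemma letter_corner:
  "letter c z F S = (if corner c S then (1 + \<beta> * z) * F S + z * F (remove_corner c S) else F S)"
  by (auto simp: letter_def create_def hop_def corner_def remove_corner_def)

text \<open>At the corner of content \<open>c\<close> the letter \<open>s\<close> is absent, shares
  the cell, or fills it alone. Relative to the tableau without \<open>s\<close> this multiplies the
  weight by \<open>1\<close>, by \<open>\<beta>\<close> times the variable, or by the variable on
  the diagram without that cell: the three terms of \<open>letter\<close>.\<close>

lemma tableau_sum_insert:
  assumes S: "finite S" and E: "finite E" "(s, c) \<notin> E" "\<forall>q\<in>E. later q (s, c)" and s: "s \<noteq> 0"
  shows "tableau_sum x (insert (s, c) E) S = letter c (x (nat \<bar>s\<bar>)) (tableau_sum x E) S"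
proof -
  let ?X = "tableaux (insert (s, c) E) S" and ?c = "corner_cell c S" and ?z = "x (nat \<bar>s\<bar>)"
  have fin: "finite ?X" using finite_tableaux E S by simp
  show ?thesis
  proof (cases "corner c S")
    case False
    then have "tableaux E S = ?X"
      using new_entry_in_corner(1)[OF S E(3) _ _ _ _ s] tableaux_old[OF E(2), of S] by blast
    then show ?thesis using False by (simp add: tableau_sum_def letter_corner)
  next
    case True
    note c = corner_cell_in[OF S True]
    let ?A = "{T \<in> ?X. s \<notin> T ?c}" and ?B = "{T \<in> ?X. T ?c = {s}}" and ?C = "{T \<in> ?X. s \<in> T ?c \<and> T ?c \<noteq> {s}}"
    have A: "?A = tableaux E S"
      unfolding tableaux_old[OF E(2), of S, symmetric]
      using new_entry_in_corner(2)[OF S E(3) _ _ _ _ s] c by auto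
    have fc: "finite (cells S)" using S by (rule finite_cells)
    have w: "weight x S T = \<beta> ^ (card (T ?c) - 1) * (\<Prod>s\<in>T ?c. x (nat \<bar>s\<bar>)) *
        (\<Prod>p\<in>cells S - {?c}. \<beta> ^ (card (T p) - 1) * (\<Prod>s\<in>T p. x (nat \<bar>s\<bar>)))" for T
      unfolding weight_def by (rule prod.remove[OF fc c])
    have notE: "s \<notin> T ?c" if "T \<in> tableaux E S" for T
      using tableauxD(2)[OF that c, of s] E(2) by auto
    have und: "T ?c = undefined" if "T \<in> tableaux E (remove_corner c S)" for T
      using PiE_arb[OF tableauxD(1)[OF that]] cells_remove_corner[OF S True] by blast
    have B: "(\<Sum>T\<in>?B. weight x S T) = (\<Sum>T\<in>tableaux E (remove_corner c S). ?z * weight x (remove_corner c S) T)"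
    proof (rule sum.reindex_bij_witness[of _ "\<lambda>T. T(?c := {s})" "\<lambda>T. T(?c := undefined)"])
      fix T assume T: "T \<in> ?B"
      then show "(T(?c := undefined))(?c := {s}) = T" by (auto simp: fun_upd_idem_iff)
      show "T(?c := undefined) \<in> tableaux E (remove_corner c S)"
        using T tableaux_drop_cell[OF S True E(2,3) s] by blast
      show "?z * weight x (remove_corner c S) (T(?c := undefined)) = weight x S T"
        unfolding w using T by (simp add: weight_def cells_remove_corner[OF S True])
    next
      fix T assume T: "T \<in> tableaux E (remove_corner c S)"
      then show "(T(?c := {s}))(?c := undefined) = T" using und by (auto simp: fun_upd_idem_iff)
      show "T(?c := {s}) \<in> ?B"
        using tableaux_new_cell[OF S True E(3) T s] by simp
    qed
    have C: "(\<Sum>T\<in>?C. weight x S T) = (\<Sum>T\<in>tableaux E S. \<beta> * ?z * weight x S T)"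
    proof (rule sum.reindex_bij_witness[of _ "\<lambda>T. T(?c := insert s (T ?c))" "\<lambda>T. T(?c := T ?c - {s})"])
      fix T assume T: "T \<in> ?C"
      then show "(T(?c := T ?c - {s}))(?c := insert s ((T(?c := T ?c - {s})) ?c)) = T"
        by (auto simp: fun_upd_idem_iff insert_absorb)
      show "T(?c := T ?c - {s}) \<in> tableaux E S"
        using T tableaux_delete[OF S True E(2,3) s] by blast
      have f: "finite (T ?c)" using T c by (auto simp: tableaux_def PiE_iff)
      have "T ?c - {s} \<noteq> {}" using T by auto
      then have "0 < card (T ?c - {s})" using f by (simp add: card_gt_0_iff)
      moreover have "card (T ?c) = Suc (card (T ?c - {s}))" using T f card.remove[of "T ?c" s] by blast
      ultimately have "\<beta> ^ (card (T ?c) - 1) = \<beta> * \<beta> ^ (card (T ?c - {s}) - 1)"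
        by (metis Suc_pred diff_Suc_1 power_Suc)
      moreover have "(\<Prod>t\<in>T ?c. x (nat \<bar>t\<bar>)) = ?z * (\<Prod>t\<in>T ?c - {s}. x (nat \<bar>t\<bar>))"
        using T f by (intro prod.remove) auto
      ultimately show "\<beta> * ?z * weight x S (T(?c := T ?c - {s})) = weight x S T"
        unfolding w by simp
    next
      fix T assume T: "T \<in> tableaux E S"
      then show "(T(?c := insert s (T ?c)))(?c := (T(?c := insert s (T ?c))) ?c - {s}) = T"
        using notE[OF T] by (auto simp: fun_upd_idem_iff)
      have "T ?c \<noteq> {}" using T c by (auto simp: tableaux_def PiE_iff)
      then show "T(?c := insert s (T ?c)) \<in> ?C"
        using tableaux_append[OF S True E(3) T s] notE[OF T] by auto
    qed
    have "?X = ?A \<union> (?B \<union> ?C)" by auto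
    then have "tableau_sum x (insert (s, c) E) S = (\<Sum>T\<in>?A \<union> (?B \<union> ?C). weight x S T)"
      unfolding tableau_sum_def by simp
    also have "\<dots> = (\<Sum>T\<in>?A. weight x S T) + (\<Sum>T\<in>?B \<union> ?C. weight x S T)"
      using fin by (intro sum.union_disjoint) auto
    also have "(\<Sum>T\<in>?B \<union> ?C. weight x S T) = (\<Sum>T\<in>?B. weight x S T) + (\<Sum>T\<in>?C. weight x S T)"
      using fin by (intro sum.union_disjoint) auto
    finally show ?thesis
      using True unfolding A B C by (simp add: tableau_sum_def letter_corner sum_distrib_left[symmetric] algebra_simps)
  qed
qed

lemma tableau_sum_fold:
  assumes "sorted_wrt later L" "distinct L" "\<forall>q\<in>set L. fst q \<noteq> 0" "finite S" "0 \<notin> S"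
  shows "tableau_sum x (set L) S = fold (\<lambda>(s, c). letter c (x (nat \<bar>s\<bar>))) L (unit_vec {}) S"
  using assms
proof (induction L arbitrary: S rule: rev_induct)
  case Nil
  show ?case
  proof (cases "S = {}")
    case True
    then have "cells S = {}" by (auto simp: cells_def parts_above_def)
    then have "tableaux {} S = {\<lambda>x. undefined}" by (auto simp: tableaux_def)
    then show ?thesis using True \<open>cells S = {}\<close> by (simp add: tableau_sum_def weight_def unit_vec_def)
  next
    case False
    \<comment> \<open>A nonempty set without \<open>0\<close> has the cell \<open>(1, 1)\<close>,
      for which no letter is available.\<close>
    then obtain t where "t \<in> S" by blast
    then have "0 < t" using Nil by (metis gr0I)
    then have "0 < parts_above S 0"
      using \<open>t \<in> S\<close> Nil(4) by (auto simp: parts_above_def card_gt_0_iff)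
    then have "(1, 1) \<in> cells S" by (simp add: cells_def)
    then have "tableaux {} S = {}" by (fastforce simp: tableaux_def PiE_iff)
    then show ?thesis using False by (simp add: tableau_sum_def unit_vec_def)
  qed
next
  case (snoc q L)
  obtain s c where q: "q = (s, c)" by (cases q)
  have "tableau_sum x (set (L @ [q])) S = letter c (x (nat \<bar>s\<bar>)) (tableau_sum x (set L)) S"
    using snoc.prems tableau_sum_insert[of S "set L" s c x] q by (auto simp: sorted_wrt_append)
  also have "\<dots> = letter c (x (nat \<bar>s\<bar>)) (fold (\<lambda>(s, c). letter c (x (nat \<bar>s\<bar>))) L (unit_vec {})) S"
  proof -
    have "tableau_sum x (set L) S' = fold (\<lambda>(s, c). letter c (x (nat \<bar>s\<bar>))) L (unit_vec {}) S'"
      if "finite S'" "0 \<notin> S'" for S'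
      using snoc that by (auto simp: sorted_wrt_append)
    moreover have "finite (remove_corner c S)" "0 \<notin> remove_corner c S"
      using snoc.prems by (auto simp: remove_corner_def)
    ultimately show ?thesis using snoc.prems by (simp add: letter_corner)
  qed
  finally show ?case by (simp add: q)
qed

definition sweep :: "nat \<Rightarrow> nat \<Rightarrow> (int \<times> nat) list" where
  "sweep n v = map (\<lambda>i. (- int v, i)) (rev [0..<n]) @ map (\<lambda>i. (int v, i)) [0..<n]"

text \<open>The marked sweep is the upward half and the unmarked sweep the downward half; the two
  consecutive visits to content \<open>0\<close> are the wall.\<close>

lemma fold_sweep:
  assumes "0 < v"
  shows "fold (\<lambda>(s, c). letter c (x (nat \<bar>s\<bar>))) (sweep (Suc m) v) F = row True m (x v) (x v) F"
proof -
  let ?f = "\<lambda>i. letter i (x v)"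
  have up: "fold ?f (rev [Suc 0..<Suc m]) F = up m (x v) F" for F
    by (induction m arbitrary: F) (simp_all add: letter_def del: upt_Suc add: upt_Suc_append)
  have down: "fold ?f [Suc 0..<Suc m] F = down m (x v) F" for F
    by (induction m arbitrary: F) (simp_all add: letter_def del: upt_Suc add: upt_Suc_append)
  have "fold (\<lambda>(s, c). letter c (x (nat \<bar>s\<bar>))) (sweep (Suc m) v) F = fold ?f [0..<Suc m] (fold ?f (rev [0..<Suc m]) F)"
    by (simp add: sweep_def fold_map comp_def del: upt_Suc)
  also have "[0..<Suc m] = 0 # [Suc 0..<Suc m]" by (simp add: upt_conv_Cons del: upt_Suc)
  finally show ?thesis
    using letter_0 by (simp add: up down row_def wall_def create_create[symmetric] del: upt_Suc)
qed

definition sweeps :: "nat \<Rightarrow> nat \<Rightarrow> (int \<times> nat) list" where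
  "sweeps n N = concat (map (sweep n) [1..<Suc N])"

lemma set_sweep: "set (sweep n v) = {- int v, int v} \<times> {..<n}"
  by (auto simp: sweep_def)

lemma set_sweeps: "set (sweeps n N) = {(s, c). s \<noteq> 0 \<and> \<bar>s\<bar> \<le> int N \<and> c < n}"
proof -
  have "(s, c) \<in> set (sweeps n N) \<longleftrightarrow> s \<noteq> 0 \<and> \<bar>s\<bar> \<le> int N \<and> c < n" for s c
    by (auto simp: sweeps_def set_sweep Bex_def intro!: exI[of _ "nat \<bar>s\<bar>"])
  then show ?thesis by auto
qed

lemma sorted_sweep: "0 < v \<Longrightarrow> sorted_wrt later (sweep n v)" "0 < v \<Longrightarrow> distinct (sweep n v)"
proof -
  assume v: "0 < v"
  have "sorted_wrt (\<lambda>i j. j < i) (rev [0..<n])"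
    by (simp add: sorted_wrt_rev)
  then show "sorted_wrt later (sweep n v)"
    using v by (auto simp: sweep_def sorted_wrt_append sorted_wrt_map later_def prec_eq_key
        elim!: sorted_wrt_mono_rel[rotated])
  show "distinct (sweep n v)"
    using v by (auto simp: sweep_def distinct_map inj_on_def)
qed

lemma sorted_sweeps: "sorted_wrt later (sweeps n N) \<and> distinct (sweeps n N)"
proof (induction N)
  case 0
  then show ?case by (simp add: sweeps_def)
next
  case (Suc N)
  have e: "sweeps n (Suc N) = sweeps n N @ sweep n (Suc N)" by (simp add: sweeps_def)
  have "later p q" if "p \<in> set (sweeps n N)" "q \<in> set (sweep n (Suc N))" for p q
    using that by (auto simp: set_sweeps set_sweep later_def prec_eq_def)
  moreover have "set (sweeps n N) \<inter> set (sweep n (Suc N)) = {}"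
    by (auto simp: set_sweeps set_sweep)
  ultimately show ?case unfolding e using Suc sorted_sweep[of "Suc N" n] by (simp add: sorted_wrt_append)
qed

lemma fold_sweeps:
  "fold (\<lambda>(s, c). letter c (x (nat \<bar>s\<bar>))) (sweeps (Suc m) N) F = rows True m (map x (rev [1..<Suc N])) F"
proof (induction N)
  case 0
  then show ?case by (simp add: sweeps_def)
next
  case (Suc N)
  have e: "sweeps (Suc m) (Suc N) = sweeps (Suc m) N @ sweep (Suc m) (Suc N)" by (simp add: sweeps_def)
  show ?case unfolding e using Suc by (simp add: fold_sweep)
qed

theorem tableau_sum_rows:
  assumes "finite S" "0 \<notin> S"
  shows "tableau_sum x {(s, c). s \<noteq> 0 \<and> \<bar>s\<bar> \<le> int N \<and> c < Suc m} S =
    rows True m (map x (rev [1..<Suc N])) (unit_vec {}) S"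
  using tableau_sum_fold[of "sweeps (Suc m) N" S x] sorted_sweeps[of "Suc m" N] assms
  by (simp add: set_sweeps fold_sweeps del: upt_Suc)

end

section \<open>Shifted tableaux with bounded entries\<close>

lemma shifted_diagram_cells:
  assumes "strict_partition lam"
  shows "shifted_diagram lam = cells (set lam)"
proof -
  have sorted: "sorted_wrt (>) lam" using assms by (simp add: strict_partition_def)
  then have dist: "distinct lam" by (induction lam) auto
  have pa: "i < parts_above (set lam) c \<longleftrightarrow> i < length lam \<and> c < lam ! i" for i c
  proof -
    have "{t \<in> set lam. c < t} = set (takeWhile (\<lambda>t. c < t) lam)"
      using sorted
    proof (induction lam)
      case (Cons t lam)
      then show ?case by (cases "c < t") (auto dest: bspec)
    qed simp
    then have p: "parts_above (set lam) c = length (takeWhile (\<lambda>t. c < t) lam)"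
      using dist by (simp add: parts_above_def distinct_card distinct_takeWhile)
    show ?thesis unfolding p using sorted
    proof (induction lam arbitrary: i)
      case (Cons t lam)
      then show ?case by (cases i) (auto dest!: nth_mem)
    qed simp
  qed
  have "(i, j) \<in> shifted_diagram lam \<longleftrightarrow> (i, j) \<in> cells (set lam)" for i j
  proof (cases i)
    case (Suc r)
    then show ?thesis using pa[of r "j - i"] by (auto simp: shifted_diagram_def cells_def Suc_le_eq)
  qed (simp add: shifted_diagram_def cells_def)
  then show ?thesis by auto
qed

text \<open>Contents in the diagram are smaller than the largest part, so the bound
  \<open>c < n\<close> holds automatically.\<close>

lemma shifted_tableaux_bounded:
  assumes "strict_partition lam" "\<forall>t\<in>set lam. t \<le> n"
  shows "{T \<in> shifted_tableaux lam. \<forall>p\<in>shifted_diagram lam. \<forall>s\<in>T p. \<bar>s\<bar> \<le> int N} =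
    tableaux {(s, c). s \<noteq> 0 \<and> \<bar>s\<bar> \<le> int N \<and> c < n} (set lam)"
proof -
  note d = shifted_diagram_cells[OF assms(1)]
  have c: "cell_content p < n" if "p \<in> cells (set lam)" for p
  proof -
    have "0 < parts_above (set lam) (cell_content p)" using that by (auto simp: cells_def cell_content_def)
    then obtain t where "t \<in> set lam" "cell_content p < t" by (auto simp: parts_above_def card_gt_0_iff)
    then show ?thesis using assms(2) by fastforce
  qed
  have "T \<in> shifted_tableaux lam \<and> (\<forall>p\<in>shifted_diagram lam. \<forall>s\<in>T p. \<bar>s\<bar> \<le> int N) \<longleftrightarrow>
      T \<in> tableaux {(s, c). s \<noteq> 0 \<and> \<bar>s\<bar> \<le> int N \<and> c < n} (set lam)" (is "?L \<longleftrightarrow> ?R") for T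
  proof (cases "T \<in> cells (set lam) \<rightarrow>\<^sub>E {A. finite A \<and> A \<noteq> {}}")
    case True
    then have f: "finite (T p)" "T p \<noteq> {}" if "p \<in> cells (set lam)" for p
      using that by (auto simp: PiE_iff)
    have ent: "T \<in> cells (set lam) \<rightarrow>\<^sub>E {A. finite A \<and> A \<noteq> {} \<and> 0 \<notin> A} \<longleftrightarrow> (\<forall>p\<in>cells (set lam). 0 \<notin> T p)"
      using True by (auto simp: PiE_iff)
    have v: "prec_max (T (i, j)) \<preceq> prec_min (T (i + 1, j)) \<and>
        (prec_max (T (i, j)) = prec_min (T (i + 1, j)) \<longrightarrow> prec_max (T (i, j)) < 0) \<longleftrightarrow> below (\<lambda>s. s < 0) (T (i, j)) (T (i + 1, j))"
      if "(i, j) \<in> cells (set lam) \<and> (i + 1, j) \<in> cells (set lam)" for i j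
      using below_max_min[of "T (i, j)" "T (i + 1, j)" "\<lambda>s. s < 0"] f that by blast
    have h: "prec_max (T (i, j)) \<preceq> prec_min (T (i, j + 1)) \<and>
        (prec_max (T (i, j)) = prec_min (T (i, j + 1)) \<longrightarrow> prec_max (T (i, j)) > 0) \<longleftrightarrow> below (\<lambda>s. 0 < s) (T (i, j)) (T (i, j + 1))"
      if "(i, j) \<in> cells (set lam) \<and> (i, j + 1) \<in> cells (set lam)" for i j
      using below_max_min[of "T (i, j)" "T (i, j + 1)" "\<lambda>s. 0 < s"] f that by blast
    have v': "(\<forall>i j. (i, j) \<in> cells (set lam) \<and> (i + 1, j) \<in> cells (set lam) \<longrightarrow>
        prec_max (T (i, j)) \<preceq> prec_min (T (i + 1, j)) \<and>
        (prec_max (T (i, j)) = prec_min (T (i + 1, j)) \<longrightarrow> prec_max (T (i, j)) < 0)) \<longleftrightarrow>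
        (\<forall>i j. (i, j) \<in> cells (set lam) \<and> (i + 1, j) \<in> cells (set lam) \<longrightarrow> below (\<lambda>s. s < 0) (T (i, j)) (T (i + 1, j)))"
      using v by blast
    have h': "(\<forall>i j. (i, j) \<in> cells (set lam) \<and> (i, j + 1) \<in> cells (set lam) \<longrightarrow>
        prec_max (T (i, j)) \<preceq> prec_min (T (i, j + 1)) \<and>
        (prec_max (T (i, j)) = prec_min (T (i, j + 1)) \<longrightarrow> prec_max (T (i, j)) > 0)) \<longleftrightarrow>
        (\<forall>i j. (i, j) \<in> cells (set lam) \<and> (i, j + 1) \<in> cells (set lam) \<longrightarrow> below (\<lambda>s. 0 < s) (T (i, j)) (T (i, j + 1)))"
      using h by blast
    have "?L \<longleftrightarrow> (\<forall>p\<in>cells (set lam). 0 \<notin> T p) \<and>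
       (\<forall>i j. (i, j) \<in> cells (set lam) \<and> (i + 1, j) \<in> cells (set lam) \<longrightarrow> below (\<lambda>s. s < 0) (T (i, j)) (T (i + 1, j))) \<and>
       (\<forall>i j. (i, j) \<in> cells (set lam) \<and> (i, j + 1) \<in> cells (set lam) \<longrightarrow> below (\<lambda>s. 0 < s) (T (i, j)) (T (i, j + 1))) \<and>
       (\<forall>p\<in>cells (set lam). \<forall>s\<in>T p. \<bar>s\<bar> \<le> int N)"
      unfolding shifted_tableaux_def d mem_Collect_eq ent v' h' by blast
    also have "\<dots> \<longleftrightarrow> ?R"
      unfolding tableaux_def mem_Collect_eq using True c by auto
    finally show ?thesis .
  next
    case False
    then show ?thesis by (auto simp: shifted_tableaux_def tableaux_def d PiE_iff)
  qed
  then show ?thesis by blast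
qed

lemma (in site_model) set_tau:
  assumes "0 < a" "a \<le> b"
  shows "set (tau a b) = steps (b - a + 1) a"
proof -
  have "(\<lambda>i. a + b - 1 - 2 * i) ` {..<a} = (\<lambda>j. b - a + 1 + 2 * j) ` {..<a}"
  proof (rule subset_antisym; rule subsetI; elim imageE)
    fix t i assume "t = a + b - 1 - 2 * i" "i \<in> {..<a}"
    then show "t \<in> (\<lambda>j. b - a + 1 + 2 * j) ` {..<a}"
      using assms by (intro image_eqI[of _ _ "a - 1 - i"]) auto
  next
    fix t j assume "t = b - a + 1 + 2 * j" "j \<in> {..<a}"
    then show "t \<in> (\<lambda>i. a + b - 1 - 2 * i) ` {..<a}"
      using assms by (intro image_eqI[of _ _ "a - 1 - j"]) auto
  qed
  then show ?thesis by (simp add: tau_def steps_def lessThan_atLeast0)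
qed

subsection \<open>Signed permutations\<close>

definition des :: "nat \<Rightarrow> (int \<Rightarrow> int) \<Rightarrow> bool" where
  "des i w \<longleftrightarrow> (if i = 0 then w 1 < 0 else w (int i) > w (int i + 1))"

lemma gen_apply:
  "gen i j = (if i = 0 then (if \<bar>j\<bar> = 1 then - j else j)
     else if j = int i \<or> j = - int i - 1 then j + 1
     else if j = int i + 1 \<or> j = - int i then j - 1 else j)"
  by (auto simp: gen_def transpose_def)

lemma gen_gen [simp]: "gen i (gen i j) = j"
  by (auto simp: gen_apply split: if_splits)

lemma inj_gen: "inj_on (gen i) A"
  by (rule inj_on_inverseI[of _ "gen i"]) simp

lemma gen_comp_gen [simp]: "gen i \<circ> gen i = id" "w \<circ> gen i \<circ> gen i = w"
  by (simp_all add: fun_eq_iff)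

lemma gen_uminus: "gen i (- j) = - gen i j"
  by (auto simp: gen_apply split: if_splits)

lemma gen_nonneg:
  assumes "0 < i" "0 \<le> k"
  shows "gen i k = (if k = int i then int i + 1 else if k = int i + 1 then int i else k)"
  using assms by (simp add: gen_apply)

text \<open>Signed permutations are odd, so identities between generators need checking at
  nonnegative arguments only.\<close>

lemma odd_eqI:
  fixes f g :: "int \<Rightarrow> int"
  assumes "\<And>k. k \<ge> 0 \<Longrightarrow> f k = g k" "\<And>k. f (- k) = - f k" "\<And>k. g (- k) = - g k"
  shows "f k = g k"
  using assms(1)[of k] assms(1)[of "- k"] assms(2,3)[of "- k"] by (cases "0 \<le> k") auto

lemma gen_commute:
  assumes "Suc i < j" shows "gen i (gen j k) = gen j (gen i k)"
proof (rule odd_eqI[where f = "\<lambda>k. gen i (gen j k)" and g = "\<lambda>k. gen j (gen i k)"])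
  fix k :: int assume k: "0 \<le> k"
  show "gen i (gen j k) = gen j (gen i k)"
  proof (cases "i = 0")
    case True
    consider "k = 1" | "k = int j" | "k = int j + 1" | "k \<noteq> 1" "k \<noteq> int j" "k \<noteq> int j + 1" by blast
    then show ?thesis using assms k True by cases (simp_all add: gen_apply)
  next
    case False
    consider "k = int i" | "k = int i + 1" | "k = int j" | "k = int j + 1"
      | "k \<noteq> int i" "k \<noteq> int i + 1" "k \<noteq> int j" "k \<noteq> int j + 1" by blast
    then show ?thesis using assms k False by cases (simp_all add: gen_nonneg)
  qed
qed (simp_all add: gen_uminus)

lemma gen_braid:
  assumes "0 < i" shows "gen i (gen (Suc i) (gen i k)) = gen (Suc i) (gen i (gen (Suc i) k))"
proof (rule odd_eqI[where f = "\<lambda>k. gen i (gen (Suc i) (gen i k))" and g = "\<lambda>k. gen (Suc i) (gen i (gen (Suc i) k))"])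
  fix k :: int assume k: "0 \<le> k"
  consider "k = int i" | "k = int i + 1" | "k = int i + 2" | "k \<noteq> int i" "k \<noteq> int i + 1" "k \<noteq> int i + 2" by blast
  then show "gen i (gen (Suc i) (gen i k)) = gen (Suc i) (gen i (gen (Suc i) k))"
    using assms k by cases (simp_all add: gen_nonneg)
qed (simp_all add: gen_uminus)

lemma gen_braid4: "gen 1 (gen 0 (gen 1 (gen 0 k))) = gen 0 (gen 1 (gen 0 (gen 1 k)))"
proof (rule odd_eqI[where f = "\<lambda>k. gen 1 (gen 0 (gen 1 (gen 0 k)))" and g = "\<lambda>k. gen 0 (gen 1 (gen 0 (gen 1 k)))"])
  fix k :: int assume k: "0 \<le> k"
  consider "k = 1" | "k = 2" | "k \<noteq> 1" "k \<noteq> 2" by blast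
  then show "gen 1 (gen 0 (gen 1 (gen 0 k))) = gen 0 (gen 1 (gen 0 (gen 1 k)))"
    using k by cases (simp_all add: gen_apply)
qed (simp_all add: gen_uminus)

abbreviation domain :: "nat \<Rightarrow> int set" where
  "domain n \<equiv> {- int n..int n} - {0}"

lemma gen_domain: "i < n \<Longrightarrow> gen i j \<in> domain n \<longleftrightarrow> j \<in> domain n"
  by (auto simp: gen_apply split: if_splits)

lemma gen_permutes: "i < n \<Longrightarrow> gen i permutes domain n"
  unfolding permutes_def
proof (intro conjI allI impI)
  fix j
  show "\<exists>!k. gen i k = j" using gen_gen by metis
  assume "i < n" "j \<notin> domain n"
  then show "gen i j = j" by (auto simp: gen_apply)
qed

lemma signed_permsD:
  assumes "w \<in> signed_perms n"
  shows "w permutes domain n" "w (- i) = - w i" "w i = w j \<longleftrightarrow> i = j"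
    "w i \<in> domain n \<longleftrightarrow> i \<in> domain n" "w 0 = 0" "i \<noteq> 0 \<Longrightarrow> w i \<noteq> 0"
proof -
  show p: "w permutes domain n" "w (- i) = - w i" using assms by (auto simp: signed_perms_def)
  show inj: "w i = w j \<longleftrightarrow> i = j" for i j using p(1) by (metis permutes_inj injD)
  show "w i \<in> domain n \<longleftrightarrow> i \<in> domain n" using p(1) by (metis permutes_in_image)
  show z: "w 0 = 0" using p(1) by (auto simp: permutes_def)
  show "i \<noteq> 0 \<Longrightarrow> w i \<noteq> 0" using inj[of i 0] z by simp
qed

lemma signed_perms_comp_gen: "w \<in> signed_perms n \<Longrightarrow> i < n \<Longrightarrow> w \<circ> gen i \<in> signed_perms n"
  unfolding signed_perms_def by (auto simp: gen_uminus intro!: permutes_compose gen_permutes)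

lemma id_signed_perms: "id \<in> signed_perms n"
  by (auto simp: signed_perms_def permutes_id)

lemma finite_signed_perms: "finite (signed_perms n)"
  by (rule finite_subset[OF _ finite_permutations[of "domain n"]]) (auto simp: signed_perms_def)

lemma des_comp_gen:
  assumes "w \<in> signed_perms n" "i < n"
  shows "des i (w \<circ> gen i) \<longleftrightarrow> \<not> des i w"
  using signed_permsD(2)[OF assms(1), of 1] signed_permsD(6)[OF assms(1), of 1]
    signed_permsD(3)[OF assms(1), of "int i" "int i + 1"]
  by (auto simp: des_def gen_apply)

section \<open>Length and reduced words\<close>

definition inversions :: "nat \<Rightarrow> (int \<Rightarrow> int) \<Rightarrow> (int \<times> int) set" where
  "inversions n w = {(i, j). i \<in> domain n \<and> j \<in> domain n \<and> i < j \<and> w j < w i}"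

text \<open>Twice the length: inversions of \<open>w\<close> on \<open>{-n, \<dots>, n}\<close> come in pairs \<open>(i, j)\<close>, \<open>(-j, -i)\<close>
  except for those of the form \<open>(-i, i)\<close>, which the second summand counts once more.\<close>

definition len2 :: "nat \<Rightarrow> (int \<Rightarrow> int) \<Rightarrow> nat" where
  "len2 n w = card (inversions n w) + card {i \<in> domain n. 0 < i \<and> w i < 0}"

lemma finite_inversions: "finite (inversions n w)"
  by (rule finite_subset[of _ "domain n \<times> domain n"]) (auto simp: inversions_def)

lemma gen_bounds: "0 < i \<Longrightarrow> gen i p \<le> p + 1" "0 < i \<Longrightarrow> p - 1 \<le> gen i p"
  by (simp_all add: gen_apply)

lemma gen_less:
  assumes "0 < i" "p < q" "\<not> (p = int i \<and> q = int i + 1)" "\<not> (p = - int i - 1 \<and> q = - int i)"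
  shows "gen i p < gen i q"
proof -
  consider "q = p + 1" | "q = p + 2" | "p + 3 \<le> q" using assms(2) by linarith
  then show ?thesis
  proof cases
    case 1
    then show ?thesis using assms by (auto simp: gen_apply)
  next
    case 2
    then show ?thesis using assms by (auto simp: gen_apply)
  next
    case 3
    then show ?thesis using gen_bounds(1)[OF assms(1), of p] gen_bounds(2)[OF assms(1), of q] by linarith
  qed
qed

lemma gen_0_less:
  assumes "p < q" "p \<noteq> 0" "q \<noteq> 0" "\<not> (p = - 1 \<and> q = 1)"
  shows "gen 0 p < gen 0 q"
  using assms by (auto simp: gen_apply)

text \<open>Outside the pairs \<open>X\<close> that it reverses, \<open>gen i\<close> preserves
  order and so transports inversions; the pairs in \<open>X\<close> become inverted. There are two
  of them for \<open>i > 0\<close>; for \<open>i = 0\<close> there is one, and the new negative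
  value supplies the other unit.\<close>

lemma len2_ascent:
  assumes w: "w \<in> signed_perms n" and i: "i < n" and nd: "\<not> des i w"
  shows "len2 n (w \<circ> gen i) = len2 n w + 2"
proof -
  define X :: "(int \<times> int) set" where "X = (if i = 0 then {(-1, 1)} else {(int i, int i + 1), (- int i - 1, - int i)})"
  let ?g = "\<lambda>(p, q). (gen i p, gen i q)"
  have mono1: "gen i p < gen i q" if "p \<noteq> 0" "q \<noteq> 0" "(p, q) \<notin> X" "p < q" for p q
    using that gen_less[of i p q] gen_0_less[of p q] by (cases "i = 0") (auto simp: X_def)
  have mono: "gen i p < gen i q \<longleftrightarrow> p < q"
    if "p \<noteq> 0" "q \<noteq> 0" "(p, q) \<notin> X" "(q, p) \<notin> X" for p q
    using that mono1[of p q] mono1[of q p] by (metis less_asym linorder_neqE_linordered_idom)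
  have o: "w (- 1) = - w 1" "w (- int i) = - w (int i)" "w (- int i - 1) = - w (int i + 1)"
    using signed_permsD(2)[OF w, of 1] signed_permsD(2)[OF w, of "int i"] signed_permsD(2)[OF w, of "int i + 1"]
    by simp_all
  have XI: "X \<inter> inversions n w = {}"
    using nd o by (auto simp: X_def inversions_def des_def split: if_splits)
  have asc: "w (int i) < w (int i + 1)" if "i \<noteq> 0"
    using nd that signed_permsD(3)[OF w, of "int i" "int i + 1"] by (auto simp: des_def)
  have asc0: "0 < w 1" if "i = 0"
    using nd that signed_permsD(6)[OF w, of 1] by (auto simp: des_def)
  have XI': "X \<subseteq> inversions n (w \<circ> gen i)"
    using i asc asc0 o by (auto simp: X_def inversions_def gen_apply)
  have "(gen i q, gen i p) \<in> X" if "(p, q) \<in> X" for p q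
    using that by (cases "i = 0") (auto simp: X_def gen_apply)
  from this[of "gen i r" "gen i s" for r s]
  have swap: "(gen i r, gen i s) \<in> X \<Longrightarrow> (s, r) \<in> X" for r s by simp
  have "?g ` (inversions n (w \<circ> gen i) - X) = inversions n w"
  proof (intro equalityI subsetI)
    fix p assume "p \<in> ?g ` (inversions n (w \<circ> gen i) - X)"
    then obtain r s where rs: "p = (gen i r, gen i s)" "(r, s) \<in> inversions n (w \<circ> gen i)" "(r, s) \<notin> X" by auto
    then have "(s, r) \<notin> X" by (auto simp: X_def inversions_def)
    then show "p \<in> inversions n w"
      using rs mono[of r s] gen_domain[OF i] by (auto simp: inversions_def)
  next
    fix p assume p: "p \<in> inversions n w"
    obtain r s where rs: "p = (r, s)" by (cases p)
    have nX: "(r, s) \<notin> X" "(s, r) \<notin> X" using p rs XI by (auto simp: X_def inversions_def)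
    then have "(gen i r, gen i s) \<in> inversions n (w \<circ> gen i) - X"
      using p rs mono[of r s] gen_domain[OF i] swap[of r s] by (auto simp: inversions_def)
    then show "p \<in> ?g ` (inversions n (w \<circ> gen i) - X)"
      using rs by (intro image_eqI[of _ _ "(gen i r, gen i s)"]) auto
  qed
  moreover have "inj_on ?g A" for A
    by (rule inj_onI) (auto, (metis gen_gen)+)
  ultimately have "card (inversions n (w \<circ> gen i) - X) = card (inversions n w)"
    by (metis card_image)
  then have c: "card (inversions n (w \<circ> gen i)) = card (inversions n w) + card X"
    using XI' finite_inversions[of n "w \<circ> gen i"] by (metis card_Diff_subset card_mono finite_subset le_add_diff_inverse2)
  show ?thesis
  proof (cases "i = 0")
    case True
    have "{j \<in> domain n. 0 < j \<and> (w \<circ> gen i) j < 0} = insert 1 {j \<in> domain n. 0 < j \<and> w j < 0}"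
      using True asc0 i signed_permsD(2)[OF w, of 1] by (auto simp: gen_apply)
    moreover have "1 \<notin> {j \<in> domain n. 0 < j \<and> w j < 0}" using asc0 True by auto
    moreover have "finite {j \<in> domain n. 0 < j \<and> w j < 0}"
      by (rule finite_subset[of _ "domain n"]) auto
    ultimately have "card {j \<in> domain n. 0 < j \<and> (w \<circ> gen i) j < 0} = Suc (card {j \<in> domain n. 0 < j \<and> w j < 0})"
      by (metis (no_types, lifting) card_insert_disjoint)
    then show ?thesis using c True unfolding len2_def by (simp add: X_def)
  next
    case False
    have sg: "0 < gen i j \<longleftrightarrow> 0 < j" for j
      using False by (auto simp: gen_apply)
    have "gen i ` {j \<in> domain n. 0 < j \<and> (w \<circ> gen i) j < 0} = {j \<in> domain n. 0 < j \<and> w j < 0}"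
    proof (intro equalityI subsetI)
      fix j assume "j \<in> {j \<in> domain n. 0 < j \<and> w j < 0}"
      then show "j \<in> gen i ` {j \<in> domain n. 0 < j \<and> (w \<circ> gen i) j < 0}"
        using sg[of j] gen_domain[OF i] by (intro image_eqI[of _ _ "gen i j"]) auto
    qed (use sg gen_domain[OF i] in auto)
    from arg_cong[OF this, of card]
    have "card {j \<in> domain n. 0 < j \<and> (w \<circ> gen i) j < 0} = card {j \<in> domain n. 0 < j \<and> w j < 0}"
      unfolding card_image[OF inj_gen] .
    then show ?thesis using c False unfolding len2_def by (simp add: X_def)
  qed
qed

lemma len2_descent:
  assumes "w \<in> signed_perms n" "i < n" "des i w"
  shows "len2 n w = len2 n (w \<circ> gen i) + 2"
  using len2_ascent[OF signed_perms_comp_gen[OF assms(1,2)] assms(2)] des_comp_gen[OF assms(1,2)] assms(3) by simp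

lemma len2_id: "len2 n id = 0"
proof -
  have "inversions n id = {}" by (auto simp: inversions_def)
  then show ?thesis by (simp add: len2_def)
qed

lemma no_descent_id:
  assumes w: "w \<in> signed_perms n" and nd: "\<And>i. i < n \<Longrightarrow> \<not> des i w"
  shows "w = id"
proof -
  have lower: "int j \<le> w (int j)" if "j \<le> n" for j
    using that
  proof (induction j)
    case 0
    then show ?case using signed_permsD(5)[OF w] by simp
  next
    case (Suc j)
    then have "\<not> des j w" using nd by simp
    then show ?case
      using Suc signed_permsD(3)[OF w, of "int j" "int j + 1"] signed_permsD(6)[OF w, of 1]
      by (cases "j = 0") (auto simp: des_def add.commute)
  qed
  have upper: "w (int (n - j)) \<le> int (n - j)" if "j < n" for j
    using that
  proof (induction j)
    case 0
    then have "w (int n) \<in> domain n" using signed_permsD(4)[OF w, of "int n"] by simp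
    then show ?case by simp
  next
    case (Suc j)
    have "\<not> des (n - Suc j) w" "n - Suc j \<noteq> 0" using nd Suc.prems by auto
    moreover have "int (n - Suc j) + 1 = int (n - j)" using Suc.prems by simp
    ultimately have "w (int (n - Suc j)) \<le> w (int (n - j))" by (auto simp: des_def)
    moreover have "w (int (n - Suc j)) \<noteq> w (int (n - j))"
      using signed_permsD(3)[OF w] Suc.prems by simp
    moreover have "w (int (n - j)) \<le> int (n - j)" using Suc by simp
    ultimately show ?case using Suc.prems by linarith
  qed
  have eq: "w (int j) = int j" if "0 < j" "j \<le> n" for j
    using lower[of j] upper[of "n - j"] that by simp
  show ?thesis
  proof
    fix i
    consider "i \<notin> domain n" | "i \<in> domain n" "0 < i" | "i \<in> domain n" "i < 0" by force
    then show "w i = id i"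
    proof cases
      case 1
      then show ?thesis using signed_permsD(1)[OF w] by (auto simp: permutes_def)
    next
      case 2
      then show ?thesis using eq[of "nat i"] by auto
    next
      case 3
      then show ?thesis using eq[of "nat (- i)"] signed_permsD(2)[OF w, of "- i"] by auto
    qed
  qed
qed

lemma word_prod_simps [simp]: "word_prod [] = id" "word_prod (i # as) = gen i \<circ> word_prod as"
  by (simp_all add: word_prod_def)

lemma word_prod_append: "word_prod (as @ bs) = word_prod as \<circ> word_prod bs"
  by (induction as) (simp_all add: comp_assoc)

lemma word_prod_snoc: "word_prod (as @ [i]) = word_prod as \<circ> gen i"
  unfolding word_prod_append by (simp add: comp_def)

lemma word_prod_signed_perms: "set as \<subseteq> {..<n} \<Longrightarrow> word_prod as \<in> signed_perms n"
proof (induction as rule: rev_induct)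
  case Nil
  then show ?case by (simp only: word_prod_simps id_signed_perms)
next
  case (snoc i as)
  then show ?case unfolding word_prod_snoc by (intro signed_perms_comp_gen) auto
qed

lemma len2_word_prod: "set as \<subseteq> {..<n} \<Longrightarrow> len2 n (word_prod as) \<le> 2 * length as"
proof (induction as rule: rev_induct)
  case Nil
  then show ?case by (simp only: word_prod_simps len2_id)
next
  case (snoc i as)
  then show ?case
    unfolding word_prod_snoc
    using len2_ascent[of "word_prod as" n i] len2_descent[of "word_prod as" n i] word_prod_signed_perms[of as n]
    by (cases "des i (word_prod as)") (auto simp: comp_def)
qed

lemma ex_word: "w \<in> signed_perms n \<Longrightarrow> \<exists>as. set as \<subseteq> {..<n} \<and> word_prod as = w \<and> 2 * length as = len2 n w"
proof (induction "len2 n w" arbitrary: w rule: less_induct)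
  case less
  show ?case
  proof (cases "\<exists>i<n. des i w")
    case True
    then obtain i where i: "i < n" "des i w" by blast
    have l: "len2 n w = len2 n (w \<circ> gen i) + 2" by (rule len2_descent[OF less.prems i])
    then obtain as where "set as \<subseteq> {..<n}" "word_prod as = w \<circ> gen i" "2 * length as = len2 n (w \<circ> gen i)"
      using less.hyps[of "w \<circ> gen i"] signed_perms_comp_gen[OF less.prems i(1)] by auto
    then show ?thesis using i l by (intro exI[of _ "as @ [i]"]) (auto simp: word_prod_snoc simp del: word_prod_simps)
  next
    case False
    then show ?thesis
      using no_descent_id[OF less.prems] len2_id[of n] by (intro exI[of _ "[]"]) auto
  qed
qed

text \<open>One generator changes \<open>len2\<close> by two, which bounds every word from below,
  and stripping descents one at a time attains the bound.\<close>

lemma reduced_word_iff: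
  assumes "w \<in> signed_perms n"
  shows "reduced_word n w as \<longleftrightarrow> set as \<subseteq> {..<n} \<and> word_prod as = w \<and> 2 * length as = len2 n w"
proof -
  obtain cs where cs: "set cs \<subseteq> {..<n}" "word_prod cs = w" "2 * length cs = len2 n w"
    using ex_word[OF assms] by blast
  have le: "len2 n w \<le> 2 * length bs" if "set bs \<subseteq> {..<n}" "word_prod bs = w" for bs
    using len2_word_prod[OF that(1)] that(2) by simp
  show ?thesis
  proof
    assume r: "reduced_word n w as"
    then have a: "set as \<subseteq> {..<n}" "word_prod as = w" by (simp_all add: reduced_word_def)
    have "length as \<le> length cs" using r cs unfolding reduced_word_def by blast
    then show "set as \<subseteq> {..<n} \<and> word_prod as = w \<and> 2 * length as = len2 n w"
      using a cs(3) le[OF a] by simp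
  next
    assume a: "set as \<subseteq> {..<n} \<and> word_prod as = w \<and> 2 * length as = len2 n w"
    have "length as \<le> length bs" if "set bs \<subseteq> {..<n}" "word_prod bs = w" for bs
      using le[OF that] a by simp
    then show "reduced_word n w as" using a by (simp add: reduced_word_def)
  qed
qed

lemma ex_reduced_word: "w \<in> signed_perms n \<Longrightarrow> \<exists>as. reduced_word n w as"
  using ex_word reduced_word_iff by metis

lemma reduced_word_prefix:
  assumes "w \<in> signed_perms n" "reduced_word n w (as @ [i])"
  shows "i < n" "reduced_word n (w \<circ> gen i) as" "des i w"
proof -
  have r: "set (as @ [i]) \<subseteq> {..<n}" "word_prod as \<circ> gen i = w" "2 * Suc (length as) = len2 n w"
    using assms reduced_word_iff[OF assms(1), of "as @ [i]"] unfolding word_prod_snoc by auto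
  then show i: "i < n" by simp
  have e: "w \<circ> gen i = word_prod as" using r(2) by auto
  have "len2 n (w \<circ> gen i) \<le> 2 * length as"
    using len2_word_prod[of as n] r(1) e by simp
  then show d: "des i w"
    using len2_ascent[OF assms(1) i] r(3) by fastforce
  show "reduced_word n (w \<circ> gen i) as"
    using len2_descent[OF assms(1) i d] r e signed_perms_comp_gen[OF assms(1) i]
    by (auto simp: reduced_word_iff)
qed

lemma reduced_word_append:
  assumes "reduced_word n v cs" "v \<in> signed_perms n" "w \<in> signed_perms n" "set r \<subseteq> {..<n}"
    "v \<circ> word_prod r = w" "len2 n w = len2 n v + 2 * length r"
  shows "reduced_word n w (cs @ r)"
  using assms by (auto simp: reduced_word_iff word_prod_append)

subsection \<open>Reduced words in the algebra\<close>

definition u_word :: "nat list \<Rightarrow> free_algebra" where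
  "u_word as = prod_list (map u as)"

lemma u_word_simps [simp]: "u_word [] = 1" "u_word (as @ bs) = u_word as * u_word bs" "u_word [i] = u i"
  by (simp_all add: u_word_def)

lemma u_word_Cons: "u_word (i # as) = u i * u_word as"
  by (simp add: u_word_def)

lemma u_word_single: "u_word as = Poly_Mapping.single (Word as) 1"
proof (induction as)
  case Nil
  then show ?case by (simp add: zero_word_def[symmetric])
next
  case (Cons i as)
  then show ?case by (simp add: u_word_Cons u_def mult_single plus_word_def)
qed

lemma scalar_mult_u_word: "scalar c * u_word as = Poly_Mapping.single (Word as) c"
  by (simp add: scalar_def u_word_single mult_single)

lemma free_subalgebra_single: "set as \<subseteq> {..<n} \<Longrightarrow> Poly_Mapping.single (Word as) c \<in> free_subalgebra n"
  by (auto simp: free_subalgebra_def)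

lemma free_subalgebra_u_word: "set as \<subseteq> {..<n} \<Longrightarrow> u_word as \<in> free_subalgebra n"
  by (simp add: u_word_single free_subalgebra_single)

lemma free_subalgebra_u: "i < n \<Longrightarrow> u i \<in> free_subalgebra n"
  using free_subalgebra_u_word[of "[i]"] by simp

lemma free_subalgebra_scalar: "scalar c \<in> free_subalgebra n"
  by (auto simp: free_subalgebra_def scalar_def zero_word_def)

lemma relation_ideal_scalar: "p \<in> relation_ideal n \<Longrightarrow> scalar c * p \<in> relation_ideal n"
  by (rule relation_ideal.mult_left[OF _ free_subalgebra_scalar])

lemma relation_ideal_uminus: "p \<in> relation_ideal n \<Longrightarrow> - p \<in> relation_ideal n"
proof -
  have "scalar (-1) * p = - p"
    by (simp add: scalar_def single_uminus)
  then show "p \<in> relation_ideal n \<Longrightarrow> ?thesis" using relation_ideal_scalar by metis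
qed

lemma relation_ideal_sum: "(\<And>x. x \<in> A \<Longrightarrow> p x \<in> relation_ideal n) \<Longrightarrow> sum p A \<in> relation_ideal n"
  by (induction A rule: infinite_finite_induct) (auto intro: relation_ideal.zero relation_ideal.add)

lemma relation_ideal_trans:
  "p - q \<in> relation_ideal n \<Longrightarrow> q - r \<in> relation_ideal n \<Longrightarrow> p - r \<in> relation_ideal n"
  using relation_ideal.add by fastforce

lemma relation_ideal_sym: "p - q \<in> relation_ideal n \<Longrightarrow> q - p \<in> relation_ideal n"
  using relation_ideal_uminus by fastforce

lemma relation_ideal_u_right:
  "p - q \<in> relation_ideal n \<Longrightarrow> i < n \<Longrightarrow> p * u i - q * u i \<in> relation_ideal n"
  using relation_ideal.mult_right[OF _ free_subalgebra_u] by (metis left_diff_distrib)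

lemma relation_ideal_u_word_left:
  "p - q \<in> relation_ideal n \<Longrightarrow> set as \<subseteq> {..<n} \<Longrightarrow> u_word as * p - u_word as * q \<in> relation_ideal n"
  using relation_ideal.mult_left[OF _ free_subalgebra_u_word] by (metis right_diff_distrib)

lemma relation_ideal_square: "i < n \<Longrightarrow> u i ^ 2 - scalar beta * u i \<in> relation_ideal n"
  by (rule relation_ideal.relator) (unfold relators_def, blast)

lemma relation_ideal_commute:
  "i < n \<Longrightarrow> j < n \<Longrightarrow> \<bar>int i - int j\<bar> > 1 \<Longrightarrow> u i * u j - u j * u i \<in> relation_ideal n"
  by (rule relation_ideal.relator) (unfold relators_def, blast)

lemma relation_ideal_braid:
  "0 < i \<Longrightarrow> i + 1 < n \<Longrightarrow> u i * u (i + 1) * u i - u (i + 1) * u i * u (i + 1) \<in> relation_ideal n"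
  by (rule relation_ideal.relator) (unfold relators_def, blast)

lemma relation_ideal_braid4:
  "1 < n \<Longrightarrow> u 1 * u 0 * u 1 * u 0 - u 0 * u 1 * u 0 * u 1 \<in> relation_ideal n"
  by (rule relation_ideal.relator) (simp add: relators_def)

text \<open>The comparison runs through two further words for \<open>w\<close>:
  \<open>as @ [i]\<close> and \<open>(cs @ r) @ [i]\<close> share their last letter, as do
  \<open>(cs @ r') @ [j]\<close> and \<open>bs @ [j]\<close>, so shorter words decide; the middle
  step is the single relation \<open>rel\<close>.\<close>

lemma reduced_words_connect:
  assumes IH: "\<And>w as bs. w \<in> signed_perms n \<Longrightarrow> reduced_word n w as \<Longrightarrow> reduced_word n w bs \<Longrightarrow> length as = N \<Longrightarrow>
      u_word as - u_word bs \<in> relation_ideal n"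
    and w: "w \<in> signed_perms n" and as: "reduced_word n w (as @ [i])" and bs: "reduced_word n w (bs @ [j])"
    and N: "length as = N"
    and v: "v \<in> signed_perms n" "v \<circ> word_prod (r @ [i]) = w" "v \<circ> word_prod (r' @ [j]) = w"
      "length r = length r'" "len2 n w = len2 n v + 2 * Suc (length r)" "set r \<subseteq> {..<n}" "set r' \<subseteq> {..<n}"
    and rel: "u_word (r @ [i]) - u_word (r' @ [j]) \<in> relation_ideal n"
  shows "u_word (as @ [i]) - u_word (bs @ [j]) \<in> relation_ideal n"
proof -
  obtain cs where cs: "reduced_word n v cs" using ex_reduced_word[OF v(1)] by blast
  note pi = reduced_word_prefix[OF w as] and pj = reduced_word_prefix[OF w bs]
  have c1: "reduced_word n w ((cs @ r) @ [i])" and c2: "reduced_word n w ((cs @ r') @ [j])"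
    using reduced_word_append[OF cs v(1) w, of "r @ [i]"] reduced_word_append[OF cs v(1) w, of "r' @ [j]"] v pi(1) pj(1)
    by auto
  have l: "length (as @ [i]) = length (bs @ [j])"
    using as bs w by (metis reduced_word_iff mult_cancel1 zero_neq_numeral)
  have "u_word as - u_word (cs @ r) \<in> relation_ideal n"
    by (rule IH[OF signed_perms_comp_gen[OF w pi(1)] pi(2) reduced_word_prefix(2)[OF w c1] N])
  then have 1: "u_word (as @ [i]) - u_word ((cs @ r) @ [i]) \<in> relation_ideal n"
    using relation_ideal_u_right[OF _ pi(1)] by (fastforce simp: mult.assoc)
  have "u_word bs - u_word (cs @ r') \<in> relation_ideal n"
    using IH[OF signed_perms_comp_gen[OF w pj(1)] pj(2) reduced_word_prefix(2)[OF w c2]] l N by simp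
  then have 2: "u_word ((cs @ r') @ [j]) - u_word (bs @ [j]) \<in> relation_ideal n"
    using relation_ideal_sym relation_ideal_u_right[OF _ pj(1)] by (fastforce simp: mult.assoc)
  have "set cs \<subseteq> {..<n}" using cs by (simp add: reduced_word_def)
  from relation_ideal_u_word_left[OF rel this]
  have "u_word ((cs @ r) @ [i]) - u_word ((cs @ r') @ [j]) \<in> relation_ideal n"
    by (simp add: mult.assoc)
  then show ?thesis using 1 2 relation_ideal_trans by blast
qed

text \<open>Both \<open>i\<close> and \<open>j\<close> are descents of \<open>w\<close>, so
  \<open>w\<close> is some shorter \<open>v\<close> times the longest element of the dihedral group
  generated by the two. That element has length two, three or four, and its two reduced words form
  the defining relation.\<close>

lemma reduced_words_step:
  assumes IH: "\<And>w as bs. w \<in> signed_perms n \<Longrightarrow> reduced_word n w as \<Longrightarrow> reduced_word n w bs \<Longrightarrow> length as = N \<Longrightarrow>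
      u_word as - u_word bs \<in> relation_ideal n"
    and w: "w \<in> signed_perms n" and as: "reduced_word n w (as @ [i])" and bs: "reduced_word n w (bs @ [j])"
    and N: "length as = N" and ij: "i < j"
  shows "u_word (as @ [i]) - u_word (bs @ [j]) \<in> relation_ideal n"
proof -
  note pi = reduced_word_prefix[OF w as] and pj = reduced_word_prefix[OF w bs]
  note conn = reduced_words_connect[OF IH w as bs N]
  note S = signed_perms_comp_gen
  have n: "i < n" "j < n" by (fact pi(1) pj(1))+
  have odd: "w (- k) = - w k" for k by (rule signed_permsD(2)[OF w])
  consider "Suc i < j" | "j = Suc i" "0 < i" | "i = 0" "j = 1" using ij by linarith
  then show ?thesis
  proof cases
    case 1
    let ?v = "w \<circ> gen i \<circ> gen j"
    have d: "des j (w \<circ> gen i)" using pj(3) 1 by (auto simp: des_def gen_apply)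
    have l: "len2 n w = len2 n ?v + 4"
      using len2_descent[OF w n(1) pi(3)] len2_descent[OF S[OF w n(1)] n(2) d] by simp
    have "u j * u i - u i * u j \<in> relation_ideal n"
      using n 1 by (intro relation_ideal_commute) auto
    moreover have "gen j (gen i k) = gen i (gen j k)" for k using gen_commute[OF 1] by simp
    then have "?v \<circ> word_prod ([j] @ [i]) = w" "?v \<circ> word_prod ([i] @ [j]) = w"
      by (simp_all add: fun_eq_iff)
    ultimately show ?thesis
      using l n by (intro conn[where v = ?v and r = "[j]" and r' = "[i]"] S w) (auto simp: u_word_Cons)
  next
    case 2
    let ?v1 = "w \<circ> gen i" and ?v2 = "w \<circ> gen i \<circ> gen j" and ?v = "w \<circ> gen i \<circ> gen j \<circ> gen i"
    have dd: "w (int i) > w (int i + 1)" "w (int i + 1) > w (int i + 2)"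
      using pi(3) pj(3) 2 by (auto simp: des_def add.commute)
    have d: "des j ?v1" "des i ?v2"
      using dd 2 by (auto simp: des_def gen_apply add.commute)
    have v: "?v1 \<in> signed_perms n" "?v2 \<in> signed_perms n" "?v \<in> signed_perms n"
      using w n by (auto intro!: S)
    have l: "len2 n w = len2 n ?v + 6"
      using len2_descent[OF w n(1) pi(3)] len2_descent[OF v(1) n(2) d(1)] len2_descent[OF v(2) n(1) d(2)] by simp
    have "u i * u j * u i - u j * u i * u j \<in> relation_ideal n"
      using relation_ideal_braid[of i n] n 2 by simp
    moreover have "gen j (gen i (gen j k)) = gen i (gen j (gen i k))" for k using gen_braid[OF 2(2)] 2(1) by simp
    then have "?v \<circ> word_prod ([i, j] @ [i]) = w" "?v \<circ> word_prod ([j, i] @ [j]) = w"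
      by (simp_all add: fun_eq_iff)
    ultimately show ?thesis
      using l n by (intro conn[where v = ?v and r = "[i, j]" and r' = "[j, i]"] v) (auto simp: u_word_Cons mult.assoc)
  next
    case 3
    let ?v1 = "w \<circ> gen 0" and ?v2 = "w \<circ> gen 0 \<circ> gen 1" and ?v3 = "w \<circ> gen 0 \<circ> gen 1 \<circ> gen 0"
      and ?v = "w \<circ> gen 0 \<circ> gen 1 \<circ> gen 0 \<circ> gen 1"
    have n': "0 < n" "1 < n" using n 3 by auto
    have dd: "w 1 < 0" "w 1 > w 2"
      using pi(3) pj(3) 3 by (auto simp: des_def)
    have d: "des 1 ?v1" "des 0 ?v2" "des 1 ?v3"
      using dd odd[of 1] odd[of 2] by (auto simp: des_def gen_apply)
    have v: "?v1 \<in> signed_perms n" "?v2 \<in> signed_perms n" "?v3 \<in> signed_perms n" "?v \<in> signed_perms n"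
      using w n' by (auto intro!: S)
    have l: "len2 n w = len2 n ?v + 8"
      using len2_descent[OF w n'(1)] pi(3) 3 len2_descent[OF v(1) n'(2) d(1)] len2_descent[OF v(2) n'(1) d(2)]
        len2_descent[OF v(3) n'(2) d(3)] by simp
    have "u 1 * u 0 * u 1 * u 0 - u 0 * u 1 * u 0 * u 1 \<in> relation_ideal n"
      by (rule relation_ideal_braid4[OF n'(2)])
    moreover have "?v \<circ> word_prod ([1, 0, 1] @ [0]) = w" "?v \<circ> word_prod ([0, 1, 0] @ [1]) = w"
      using gen_braid4 by (simp_all add: fun_eq_iff)
    ultimately show ?thesis
      using l n' 3 by (intro conn[where v = ?v and r = "[1, 0, 1]" and r' = "[0, 1, 0]"] v) (auto simp: u_word_Cons mult.assoc)
  qed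
qed

text \<open>Matsumoto's theorem for the hyperoctahedral group, stated modulo the ideal.\<close>

theorem reduced_words_congruent:
  "w \<in> signed_perms n \<Longrightarrow> reduced_word n w as \<Longrightarrow> reduced_word n w bs \<Longrightarrow> u_word as - u_word bs \<in> relation_ideal n"
proof (induction "length as" arbitrary: w as bs)
  case 0
  then have "length bs = 0" by (metis reduced_word_iff mult_eq_0_iff zero_neq_numeral)
  then show ?case using 0 by (simp add: relation_ideal.zero)
next
  case (Suc N)
  have "length bs = length as" using Suc.prems by (metis reduced_word_iff mult_cancel1 zero_neq_numeral)
  then obtain as' i bs' j where eq: "as = as' @ [i]" "bs = bs' @ [j]" "length as' = N" "length bs' = N"
    using Suc.hyps(2) by (metis length_Suc_conv_rev)
  note IH = Suc.hyps(1)[OF sym]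
  consider "i = j" | "i < j" | "j < i" by linarith
  then show ?case
  proof cases
    case 1
    note pi = reduced_word_prefix[OF Suc.prems(1) Suc.prems(2)[unfolded eq]]
      and pj = reduced_word_prefix[OF Suc.prems(1) Suc.prems(3)[unfolded eq]]
    have "u_word as' - u_word bs' \<in> relation_ideal n"
      by (rule IH[OF eq(3) signed_perms_comp_gen[OF Suc.prems(1) pi(1)] pi(2)]) (use pj 1 in simp)
    then show ?thesis using 1 eq relation_ideal_u_right[OF _ pi(1)] by simp
  next
    case 2
    then show ?thesis
      using reduced_words_step[of n N w as' i bs' j] IH Suc.prems eq by blast
  next
    case 3
    then show ?thesis
      using reduced_words_step[of n N w bs' j as' i] IH Suc.prems eq relation_ideal_sym by blast
  qed
qed

subsection \<open>Right modules over algebras of words and of polynomials\<close>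

lemma poly_mapping_sum_single: "p = (\<Sum>k\<in>Poly_Mapping.keys p. Poly_Mapping.single k (Poly_Mapping.lookup p k))"
proof (rule poly_mapping_eqI)
  fix k
  have "Poly_Mapping.lookup (\<Sum>k\<in>Poly_Mapping.keys p. Poly_Mapping.single k (Poly_Mapping.lookup p k)) k
      = (\<Sum>l\<in>Poly_Mapping.keys p. if l = k then Poly_Mapping.lookup p k else 0)"
    unfolding lookup_sum by (rule sum.cong) (auto simp: lookup_single when_def)
  then show "Poly_Mapping.lookup p k = Poly_Mapping.lookup (\<Sum>k\<in>Poly_Mapping.keys p. Poly_Mapping.single k (Poly_Mapping.lookup p k)) k"
    by (simp add: in_keys_iff)
qed

text \<open>
  The monomial with exponent \<open>k\<close> and coefficient \<open>c\<close> acts by \<open>m k c\<close>. These are right modules, so the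
  factors of a product act from left to right.
\<close>

locale monomial_action =
  fixes m :: "'k::monoid_add \<Rightarrow> 'c::semiring_1 \<Rightarrow> ('s \<Rightarrow> 'r::comm_ring_1) \<Rightarrow> 's \<Rightarrow> 'r"
  assumes m_zero: "m k 0 f s = 0"
    and m_add: "m k (c + d) f s = m k c f s + m k d f s"
    and m_fun_zero: "m k c (\<lambda>s. 0) s = 0"
    and m_fun_add: "m k c (\<lambda>s. f s + g s) s = m k c f s + m k c g s"
    and m_mult: "m (k + l) (c * d) f = m l d (m k c f)"
    and m_one: "m 0 1 f = f"
begin

definition act :: "('k \<Rightarrow>\<^sub>0 'c) \<Rightarrow> ('s \<Rightarrow> 'r) \<Rightarrow> 's \<Rightarrow> 'r" where
  "act p f s = (\<Sum>k\<in>Poly_Mapping.keys p. m k (Poly_Mapping.lookup p k) f s)"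

lemma act_superset:
  assumes "finite K" "Poly_Mapping.keys p \<subseteq> K"
  shows "act p f s = (\<Sum>k\<in>K. m k (Poly_Mapping.lookup p k) f s)"
  unfolding act_def using assms
  by (intro sum.mono_neutral_left) (auto simp: in_keys_iff m_zero)

lemma act_zero [simp]: "act 0 f s = 0"
  by (simp add: act_def)

lemma act_single: "act (Poly_Mapping.single k c) f s = m k c f s"
  by (cases "c = 0") (simp_all add: act_def m_zero)

lemma act_one [simp]: "act 1 f = f"
proof
  fix s show "act 1 f s = f s"
    using act_single[of 0 1 f s] by (simp add: m_one)
qed

lemma act_add: "act (p + q) f s = act p f s + act q f s"
proof -
  let ?K = "Poly_Mapping.keys p \<union> Poly_Mapping.keys q"
  have "act (p + q) f s = (\<Sum>k\<in>?K. m k (Poly_Mapping.lookup (p + q) k) f s)"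
    using keys_add[of p q] by (intro act_superset) auto
  also have "\<dots> = (\<Sum>k\<in>?K. m k (Poly_Mapping.lookup p k) f s) + (\<Sum>k\<in>?K. m k (Poly_Mapping.lookup q k) f s)"
    by (simp add: lookup_add m_add sum.distrib)
  also have "\<dots> = act p f s + act q f s"
    by (simp add: act_superset[of ?K])
  finally show ?thesis .
qed

lemma act_sum: "act (sum p A) f s = (\<Sum>x\<in>A. act (p x) f s)"
  by (induction A rule: infinite_finite_induct) (simp_all add: act_add)

lemma m_fun_sum: "m k c (\<lambda>s. \<Sum>x\<in>A. f x s) s = (\<Sum>x\<in>A. m k c (f x) s)"
  by (induction A rule: infinite_finite_induct) (simp_all add: m_fun_zero m_fun_add)

lemma act_mult: "act (p * q) f s = act q (act p f) s"
proof -
  let ?p = "Poly_Mapping.lookup p" and ?q = "Poly_Mapping.lookup q"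
  have "p * q = (\<Sum>k\<in>Poly_Mapping.keys p. \<Sum>l\<in>Poly_Mapping.keys q. Poly_Mapping.single (k + l) (?p k * ?q l))"
    by (subst (1) poly_mapping_sum_single[of p], subst (1) poly_mapping_sum_single[of q])
      (simp add: sum_product mult_single)
  then have "act (p * q) f s = (\<Sum>k\<in>Poly_Mapping.keys p. \<Sum>l\<in>Poly_Mapping.keys q. m l (?q l) (m k (?p k) f) s)"
    by (simp add: act_sum act_single m_mult)
  also have "\<dots> = (\<Sum>l\<in>Poly_Mapping.keys q. \<Sum>k\<in>Poly_Mapping.keys p. m l (?q l) (m k (?p k) f) s)"
    by (rule sum.swap)
  also have "\<dots> = (\<Sum>l\<in>Poly_Mapping.keys q. m l (?q l) (act p f) s)"
    unfolding act_def m_fun_sum[symmetric] ..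
  finally show ?thesis by (simp add: act_def)
qed

lemma act_prod_list: "act (prod_list ps) f = fold act ps f"
proof (induction ps arbitrary: f)
  case (Cons p ps)
  have "act (p * prod_list ps) f = act (prod_list ps) (act p f)"
    by (rule ext) (rule act_mult)
  then show ?case using Cons by simp
qed simp

lemma act_fun_add: "act p (\<lambda>s. f s + g s) s = act p f s + act p g s"
  by (simp add: act_def m_fun_add sum.distrib)

lemma act_fun_zero: "act p (\<lambda>s. 0) s = 0"
  by (simp add: act_def m_fun_zero)

end

subsection \<open>The regular module\<close>

locale ring_hom_beta =
  fixes hom :: "int poly \<Rightarrow> 'r::comm_ring_1"
  assumes hom_zero: "hom 0 = 0" and hom_one: "hom 1 = 1"
    and hom_add: "hom (x + y) = hom x + hom y" and hom_mult: "hom (x * y) = hom x * hom y"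
begin

text \<open>Right multiplication by \<open>u i\<close> on coefficient functions: \<open>u i\<close>
  takes the basis element of \<open>v\<close> to that of \<open>v \<circ> gen i\<close> at an ascent
  and multiplies it by \<open>beta\<close> at a descent. So \<open>w\<close> receives something only
  if \<open>i\<close> is a descent of \<open>w\<close>, from \<open>w \<circ> gen i\<close> and from
  itself.\<close>

definition uop :: "nat \<Rightarrow> ((int \<Rightarrow> int) \<Rightarrow> 'r) \<Rightarrow> (int \<Rightarrow> int) \<Rightarrow> 'r" where
  "uop i f w = (if des i w then f (w \<circ> gen i) + hom beta * f w else 0)"

definition wop :: "nat list \<Rightarrow> ((int \<Rightarrow> int) \<Rightarrow> 'r) \<Rightarrow> (int \<Rightarrow> int) \<Rightarrow> 'r" where
  "wop as f = fold uop as f"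

lemma wop_simps [simp]: "wop [] f = f" "wop (i # as) f = wop as (uop i f)" "wop (as @ bs) f = wop bs (wop as f)"
  by (simp_all add: wop_def)

lemma uop_fun: "uop i (\<lambda>s. 0) = (\<lambda>s. 0)" "uop i (\<lambda>s. f s + g s) = (\<lambda>s. uop i f s + uop i g s)"
  "uop i (\<lambda>s. c * f s) = (\<lambda>s. c * uop i f s)"
  by (auto simp: uop_def fun_eq_iff algebra_simps)

lemma wop_fun: "wop as (\<lambda>s. 0) = (\<lambda>s. 0)" "wop as (\<lambda>s. f s + g s) = (\<lambda>s. wop as f s + wop as g s)"
  "wop as (\<lambda>s. c * f s) = (\<lambda>s. c * wop as f s)"
  by (induction as arbitrary: f g) (simp_all add: uop_fun)

sublocale monomial_action "\<lambda>v c f s. hom c * wop (letters v) f s"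
  by unfold_locales
    (simp_all add: hom_zero hom_one hom_add hom_mult wop_fun plus_word_def zero_word_def algebra_simps fun_eq_iff)

lemma act_u: "act (u i) f = uop i f"
  by (rule ext) (simp add: u_def act_single hom_one)

lemma act_scalar: "act (scalar c) f s = hom c * f s"
  by (simp add: scalar_def act_single zero_word_def)

lemma act_fun_scale: "act p (\<lambda>s. c * f s) s = c * act p f s"
  unfolding act_def wop_fun sum_distrib_left by (simp add: mult_ac)

lemma act_scalar_mult: "act (scalar c * p) f s = hom c * act p f s"
proof -
  have "act (scalar c) f = (\<lambda>s. hom c * f s)" by (rule ext) (rule act_scalar)
  then show ?thesis by (simp only: act_mult act_fun_scale)
qed

lemma act_uminus: "act (- p) f s = - act p f s"
  using act_add[of p "- p" f s] by (simp add: eq_neg_iff_add_eq_0 add.commute)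

lemma act_diff: "act (p - q) f s = act p f s - act q f s"
  using act_add[of p "- q" f s] by (simp add: act_uminus)

lemma act_u_mult: "act (p * u i) f = uop i (act p f)"
  by (rule ext) (simp add: act_mult act_u)

lemma uop_square: "w \<in> signed_perms n \<Longrightarrow> i < n \<Longrightarrow> uop i (uop i f) w = hom beta * uop i f w"
  using des_comp_gen[of w n i] by (simp add: uop_def)

lemma uop_commute:
  assumes "Suc i < j" shows "uop i (uop j f) w = uop j (uop i f) w"
proof -
  have c: "w \<circ> gen i \<circ> gen j = w \<circ> gen j \<circ> gen i"
    using gen_commute[OF assms] by (simp add: fun_eq_iff)
  have "des j (w \<circ> gen i) = des j w" "des i (w \<circ> gen j) = des i w"
    using assms by (auto simp: des_def gen_apply)
  then show ?thesis by (simp add: uop_def c algebra_simps)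
qed

text \<open>Which terms survive depends only on the relative order of three consecutive values of
  \<open>w\<close>.\<close>

lemma uop_braid:
  assumes "0 < i" shows "uop i (uop (Suc i) (uop i f)) w = uop (Suc i) (uop i (uop (Suc i) f)) w"
proof -
  let ?s = "gen i" and ?t = "gen (Suc i)"
  have c: "w \<circ> ?s \<circ> ?t \<circ> ?s = w \<circ> ?t \<circ> ?s \<circ> ?t"
    using gen_braid[OF assms] by (simp add: fun_eq_iff)
  define p q r where "p = w (int i)" and "q = w (int i + 1)" and "r = w (int i + 2)"
  have ev: "gen i (int i) = int i + 1" "gen i (int i + 1) = int i" "gen i (int i + 2) = int i + 2"
    "gen (Suc i) (int i) = int i" "gen (Suc i) (int i + 1) = int i + 2" "gen (Suc i) (int i + 2) = int i + 1"
    using assms by (auto simp: gen_nonneg)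
  have d: "des i v \<longleftrightarrow> v (int i) > v (int i + 1)" "des (Suc i) v \<longleftrightarrow> v (int i + 1) > v (int i + 2)" for v
    using assms by (auto simp: des_def add.commute)
  show ?thesis
    unfolding uop_def d comp_apply ev c
    by (cases "p < q"; cases "q < r"; cases "p < r"; cases "p = q"; cases "q = r"; cases "p = r")
      (auto simp: p_def q_def r_def algebra_simps)
qed

lemma uop_braid4:
  assumes "\<And>i. w (- i) = - w i"
  shows "uop 0 (uop 1 (uop 0 (uop 1 f))) w = uop 1 (uop 0 (uop 1 (uop 0 f))) w"
proof -
  let ?s = "gen 0" and ?t = "gen 1"
  have c: "w \<circ> ?t \<circ> ?s \<circ> ?t \<circ> ?s = w \<circ> ?s \<circ> ?t \<circ> ?s \<circ> ?t"
    using gen_braid4 by (simp add: fun_eq_iff)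
  define p q where "p = w 1" and "q = w 2"
  have ev: "gen 0 1 = - 1" "gen 0 2 = 2" "gen 1 1 = 2" "gen 1 2 = 1" "gen 1 (- 1) = - 2" "gen 1 (- 2) = - 1"
    "gen 0 (- 2) = - 2" "gen 0 (- 1) = 1"
    by (simp_all add: gen_apply)
  have o: "w (- 1) = - p" "w (- 2) = - q" "w 1 = p" "w 2 = q" using assms[of 1] assms[of 2] by (auto simp: p_def q_def)
  have d: "des 0 v \<longleftrightarrow> v 1 < 0" "des 1 v \<longleftrightarrow> v 1 > v 2" for v
    by (auto simp: des_def)
  show ?thesis
    unfolding uop_def d comp_apply ev o c
    by (cases "p < 0"; cases "q < 0"; cases "p < q"; cases "p < - q"; cases "p = q"; cases "p = - q"; cases "p = 0"; cases "q = 0")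
      (auto simp: algebra_simps)
qed

text \<open>Relations are only known to act by zero at signed permutations; letters below
  \<open>n\<close> keep values from elsewhere from leaking in.\<close>

lemma wop_vanish:
  assumes "\<And>w. w \<in> signed_perms n \<Longrightarrow> f w = 0" "set as \<subseteq> {..<n}" "w \<in> signed_perms n"
  shows "wop as f w = 0"
  using assms(1,2)
proof (induction as arbitrary: f)
  case Nil
  then show ?case using assms(3) by simp
next
  case (Cons i as)
  have "uop i f w = 0" if "w \<in> signed_perms n" for w
    using Cons.prems(1)[OF that] Cons.prems(1)[OF signed_perms_comp_gen[OF that, of i]] Cons.prems(2)
    by (simp add: uop_def comp_def)
  then show ?case using Cons by simp
qed

lemma act_vanish:
  assumes "\<And>w. w \<in> signed_perms n \<Longrightarrow> f w = 0" "p \<in> free_subalgebra n" "w \<in> signed_perms n"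
  shows "act p f w = 0"
  unfolding act_def
proof (rule sum.neutral, rule ballI)
  fix v assume "v \<in> Poly_Mapping.keys p"
  then show "hom (Poly_Mapping.lookup p v) * wop (letters v) f w = 0"
    using wop_vanish[of n f "letters v" w] assms by (auto simp: free_subalgebra_def)
qed

lemma act_relation_ideal:
  assumes "p \<in> relation_ideal n" "w \<in> signed_perms n"
  shows "act p f w = 0"
  using assms
proof (induction arbitrary: f w rule: relation_ideal.induct)
  case (relator r)
  have odd: "w (- i) = - w i" for i using signed_permsD(2)[OF relator(2)] by simp
  from relator(1) consider
      i where "r = u i ^ 2 - scalar beta * u i" "i < n"
    | "r = u 1 * u 0 * u 1 * u 0 - u 0 * u 1 * u 0 * u 1"
    | i where "r = u i * u (i + 1) * u i - u (i + 1) * u i * u (i + 1)" "0 < i"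
    | i j where "r = u i * u j - u j * u i" "\<bar>int i - int j\<bar> > 1"
    unfolding relators_def by (auto split: if_splits)
  then show ?case
  proof cases
    case 1
    then show ?thesis
      using uop_square[OF relator(2) 1(2)]
      by (simp add: act_diff power2_eq_square act_u_mult act_u act_scalar uop_fun)
        (simp add: uop_def act_scalar algebra_simps)
  next
    case 2
    then show ?thesis
      using uop_braid4[of w f, OF odd] by (simp add: act_diff act_u_mult act_u)
  next
    case 3
    then show ?thesis
      using uop_braid[of i f w] by (simp add: act_diff act_u_mult act_u)
  next
    case 4
    then have "Suc i < j \<or> Suc j < i" by linarith
    then show ?thesis
      using 4 uop_commute[of i j f w] uop_commute[of j i f w] by (auto simp: act_diff act_u_mult act_u)
  qed
next
  \<comment> \<open>The right factor acts last, on a function known to vanish on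
    \<open>signed_perms n\<close> only.\<close>
  case (mult_right p g)
  then show ?case by (simp add: act_mult act_vanish[of n "act p f"])
qed (simp_all add: act_add act_mult)

definition unit_at :: "(int \<Rightarrow> int) \<Rightarrow> (int \<Rightarrow> int) \<Rightarrow> 'r" where
  "unit_at v w = (if w = v then 1 else 0)"

lemma uop_unit_at_ascent:
  assumes "v \<in> signed_perms n" "i < n" "\<not> des i v"
  shows "uop i (unit_at v) = unit_at (v \<circ> gen i)"
proof
  fix w
  have "w \<circ> gen i = v \<longleftrightarrow> w = v \<circ> gen i" by (metis gen_comp_gen(2))
  then show "uop i (unit_at v) w = unit_at (v \<circ> gen i) w"
    using assms des_comp_gen[OF assms(1,2)] by (auto simp: uop_def unit_at_def)
qed

lemma uop_unit_at_descent:
  assumes "v \<in> signed_perms n" "i < n" "des i v"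
  shows "uop i (unit_at v) = (\<lambda>w. hom beta * unit_at v w)"
proof
  fix w
  have "w \<circ> gen i = v \<longleftrightarrow> w = v \<circ> gen i" by (metis gen_comp_gen(2))
  then show "uop i (unit_at v) w = hom beta * unit_at v w"
    using assms des_comp_gen[OF assms(1,2)] by (auto simp: uop_def unit_at_def)
qed

lemma wop_reduced_word:
  "w \<in> signed_perms n \<Longrightarrow> reduced_word n w as \<Longrightarrow> wop as (unit_at id) = unit_at w"
proof (induction as arbitrary: w rule: rev_induct)
  case Nil
  then show ?case by (simp add: reduced_word_def)
next
  case (snoc i as)
  note r = reduced_word_prefix[OF snoc.prems]
  have "\<not> des i (w \<circ> gen i)" using des_comp_gen[OF snoc.prems(1) r(1)] r(3) by simp
  then show ?case
    using snoc.IH[OF signed_perms_comp_gen[OF snoc.prems(1) r(1)] r(2)]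
      uop_unit_at_ascent[OF signed_perms_comp_gen[OF snoc.prems(1) r(1)] r(1)] by (simp add: comp_def)
qed

lemma act_u_word: "act (u_word as) f = wop as f"
  by (rule ext) (simp add: u_word_single act_single hom_one)

lemma u_perm_reduced:
  assumes "w \<in> signed_perms n"
  obtains as where "reduced_word n w as" "u_perm n w = u_word as"
  using someI_ex[OF ex_reduced_word[OF assms]] by (auto simp: u_perm_def u_word_def)

lemma act_u_perm: "w \<in> signed_perms n \<Longrightarrow> act (u_perm n w) (unit_at id) = unit_at w"
  using u_perm_reduced[of w n] wop_reduced_word act_u_word by metis

end

section \<open>Normal forms modulo the relations\<close>

interpretation int_hom: ring_hom_beta "\<lambda>x. x"
  by unfold_locales simp_all

text \<open>The same \<open>k\<close> and \<open>w\<close> describe the word in the quotient and its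
  action on the unit at \<open>id\<close>; therefore the action computes the normal form.\<close>

lemma u_word_normal_form:
  assumes "set as \<subseteq> {..<n}"
  shows "\<exists>k w. w \<in> signed_perms n \<and> int_hom.wop as (int_hom.unit_at id) = (\<lambda>v. beta ^ k * int_hom.unit_at w v) \<and>
    u_word as - scalar (beta ^ k) * u_perm n w \<in> relation_ideal n"
  using assms
proof (induction as rule: rev_induct)
  case Nil
  obtain bs where "reduced_word n id bs" "u_perm n id = u_word bs"
    using int_hom.u_perm_reduced[OF id_signed_perms] .
  moreover have "bs = []"
    using \<open>reduced_word n id bs\<close> id_signed_perms len2_id by (simp add: reduced_word_iff)
  ultimately have "u_perm n id = 1" by simp
  then have "u_word [] - scalar (beta ^ 0) * u_perm n id = 0"
    by (simp only: u_word_simps scalar_def power_0 single_one mult_1_left diff_self)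
  then show ?case
    using id_signed_perms[of n] relation_ideal.zero[of n]
    by (intro exI[of _ 0] exI[of _ id] conjI) (simp_all only: int_hom.wop_simps power_0 mult_1_left)
next
  case (snoc i as)
  then have "set as \<subseteq> {..<n}" by simp
  from snoc.IH[OF this] obtain k w where w: "w \<in> signed_perms n"
    and act: "int_hom.wop as (int_hom.unit_at id) = (\<lambda>v. beta ^ k * int_hom.unit_at w v)"
    and rel: "u_word as - scalar (beta ^ k) * u_perm n w \<in> relation_ideal n"
    by blast
  have i: "i < n" using snoc.prems by simp
  note S = signed_perms_comp_gen[OF w i]
  have rel': "u_word (as @ [i]) - scalar (beta ^ k) * (u_perm n w * u i) \<in> relation_ideal n"
    using relation_ideal_u_right[OF rel i] by (simp add: mult.assoc)
  obtain ws where ws: "reduced_word n w ws" "u_perm n w = u_word ws" using int_hom.u_perm_reduced[OF w] .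
  obtain vs where vs: "reduced_word n (w \<circ> gen i) vs" "u_perm n (w \<circ> gen i) = u_word vs" using int_hom.u_perm_reduced[OF S] .
  show ?case
  proof (cases "des i w")
    case False
    have "reduced_word n (w \<circ> gen i) (ws @ [i])"
      using ws(1) w S i len2_ascent[OF w i False] by (auto simp: reduced_word_iff word_prod_snoc simp del: word_prod_simps)
    from reduced_words_congruent[OF S this vs(1)]
    have "u_perm n w * u i - u_perm n (w \<circ> gen i) \<in> relation_ideal n"
      by (simp add: ws vs)
    from relation_ideal_scalar[OF this, of "beta ^ k"]
    have "scalar (beta ^ k) * (u_perm n w * u i) - scalar (beta ^ k) * u_perm n (w \<circ> gen i) \<in> relation_ideal n"
      by (simp add: right_diff_distrib)
    note relation_ideal_trans[OF rel' this]
    moreover have "int_hom.wop (as @ [i]) (int_hom.unit_at id) = (\<lambda>v. beta ^ k * int_hom.unit_at (w \<circ> gen i) v)"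
      by (simp only: int_hom.wop_simps act int_hom.uop_fun int_hom.uop_unit_at_ascent[OF w i False])
    ultimately show ?thesis using S by blast
  next
    case True
    have "reduced_word n w (vs @ [i])"
      using vs(1) w S i len2_descent[OF w i True] by (auto simp: reduced_word_iff word_prod_snoc simp del: word_prod_simps)
    from reduced_words_congruent[OF w ws(1) this]
    have 1: "u_perm n w - u_word vs * u i \<in> relation_ideal n"
      by (simp add: ws)
    have "u_word vs * (u i ^ 2 - scalar beta * u i) \<in> relation_ideal n"
      using vs(1) by (intro relation_ideal.mult_left relation_ideal_square i free_subalgebra_u_word) (simp add: reduced_word_def)
    moreover have com: "u_word xs * scalar c = scalar c * u_word xs" for xs c
      by (simp add: u_word_single scalar_def mult_single)
    ultimately have 2: "u_word vs * u i * u i - scalar beta * (u_word vs * u i) \<in> relation_ideal n"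
      using com[of vs beta] by (simp add: right_diff_distrib power2_eq_square mult.assoc[symmetric])
    have 3: "scalar beta * (u_word vs * u i) - scalar beta * u_perm n w \<in> relation_ideal n"
      using relation_ideal_scalar[OF relation_ideal_sym[OF 1], of beta] by (simp add: right_diff_distrib)
    have "u_perm n w * u i - scalar beta * u_perm n w \<in> relation_ideal n"
      using relation_ideal_trans[OF relation_ideal_trans[OF relation_ideal_u_right[OF 1 i] 2] 3] .
    from relation_ideal_scalar[OF this, of "beta ^ k"]
    have "scalar (beta ^ k) * (u_perm n w * u i) - scalar (beta ^ Suc k) * u_perm n w \<in> relation_ideal n"
      by (simp add: right_diff_distrib scalar_def mult.assoc[symmetric] mult_single mult.commute)
    note relation_ideal_trans[OF rel' this]
    moreover have "int_hom.wop (as @ [i]) (int_hom.unit_at id) = (\<lambda>v. beta ^ Suc k * int_hom.unit_at w v)"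
      by (simp only: int_hom.wop_simps act int_hom.uop_fun int_hom.uop_unit_at_descent[OF w i True] power_Suc2 mult.assoc)
    ultimately show ?thesis using w by blast
  qed
qed

lemma normal_form:
  assumes "p \<in> free_subalgebra n"
  shows "p - (\<Sum>w\<in>signed_perms n. scalar (int_hom.act p (int_hom.unit_at id) w) * u_perm n w) \<in> relation_ideal n"
proof -
  let ?K = "Poly_Mapping.keys p" and ?e = "int_hom.unit_at id"
  let ?s = "\<lambda>v. Poly_Mapping.single v (Poly_Mapping.lookup p v)"
  have scalar_sum: "scalar (\<Sum>x\<in>A. c x) = (\<Sum>x\<in>A. scalar (c x))" for A :: "word set" and c
    by (induction A rule: infinite_finite_induct) (simp_all add: scalar_def single_add)
  have one: "?s v - (\<Sum>w\<in>signed_perms n. scalar (Poly_Mapping.lookup p v * int_hom.wop (letters v) ?e w) * u_perm n w) \<in> relation_ideal n"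
    if "v \<in> ?K" for v
  proof -
    let ?c = "Poly_Mapping.lookup p v"
    have "set (letters v) \<subseteq> {..<n}" using assms that by (auto simp: free_subalgebra_def)
    then obtain k w where w: "w \<in> signed_perms n"
      and act: "int_hom.wop (letters v) ?e = (\<lambda>x. beta ^ k * int_hom.unit_at w x)"
      and rel: "u_word (letters v) - scalar (beta ^ k) * u_perm n w \<in> relation_ideal n"
      using u_word_normal_form by blast
    have "(\<Sum>x\<in>signed_perms n. scalar (?c * int_hom.wop (letters v) ?e x) * u_perm n x)
      = (\<Sum>x\<in>signed_perms n. if x = w then scalar (?c * beta ^ k) * u_perm n w else 0)"
      by (rule sum.cong) (auto simp: act int_hom.unit_at_def scalar_def)
    also have "\<dots> = scalar (?c * beta ^ k) * u_perm n w"
      using w finite_signed_perms by simp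
    also have "\<dots> = scalar ?c * (scalar (beta ^ k) * u_perm n w)"
      by (simp add: scalar_def mult.assoc[symmetric] mult_single)
    finally show ?thesis
      using relation_ideal_scalar[OF rel, of ?c] by (simp add: right_diff_distrib scalar_mult_u_word)
  qed
  have "(\<Sum>w\<in>signed_perms n. scalar (int_hom.act p ?e w) * u_perm n w) =
    (\<Sum>v\<in>?K. \<Sum>w\<in>signed_perms n. scalar (Poly_Mapping.lookup p v * int_hom.wop (letters v) ?e w) * u_perm n w)"
    unfolding int_hom.act_def scalar_sum sum_distrib_right by (rule sum.swap)
  then have "p - (\<Sum>w\<in>signed_perms n. scalar (int_hom.act p ?e w) * u_perm n w) =
    (\<Sum>v\<in>?K. ?s v - (\<Sum>w\<in>signed_perms n. scalar (Poly_Mapping.lookup p v * int_hom.wop (letters v) ?e w) * u_perm n w))"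
    by (subst poly_mapping_sum_single[of p]) (simp add: sum_subtractf)
  then show ?thesis using one by (simp add: relation_ideal_sum)
qed

text \<open>Existence is \<open>normal_form\<close>. For uniqueness, the ideal acts by zero and
  \<open>u_perm n v\<close> takes the unit at \<open>id\<close> to the unit at \<open>v\<close>, so
  acting on the unit at \<open>id\<close> returns the coefficients of any expansion.\<close>

theorem u_coeff_eq:
  assumes "p \<in> free_subalgebra n" "w \<in> signed_perms n"
  shows "u_coeff n p w = int_hom.act p (int_hom.unit_at id) w"
proof -
  let ?c = "\<lambda>w. if w \<in> signed_perms n then int_hom.act p (int_hom.unit_at id) w else 0"
  have "u_coeff n p = ?c"
    unfolding u_coeff_def
  proof (rule the_equality)
    show "(\<forall>w. w \<notin> signed_perms n \<longrightarrow> ?c w = 0) \<and>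
      p - (\<Sum>w\<in>signed_perms n. scalar (?c w) * u_perm n w) \<in> relation_ideal n"
      using normal_form[OF assms(1)] by simp
  next
    fix c assume c: "(\<forall>w. w \<notin> signed_perms n \<longrightarrow> c w = 0) \<and>
      p - (\<Sum>w\<in>signed_perms n. scalar (c w) * u_perm n w) \<in> relation_ideal n"
    show "c = ?c"
    proof
      fix w show "c w = ?c w"
      proof (cases "w \<in> signed_perms n")
        case True
        have "int_hom.act p (int_hom.unit_at id) w =
          (\<Sum>v\<in>signed_perms n. c v * int_hom.unit_at v w)"
          using int_hom.act_relation_ideal[OF conjunct2[OF c] True, of "int_hom.unit_at id"]
          by (simp add: int_hom.act_diff int_hom.act_sum int_hom.act_u_perm int_hom.act_scalar_mult)
        also have "\<dots> = (\<Sum>v\<in>signed_perms n. if v = w then c w else 0)"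
          by (rule sum.cong) (auto simp: int_hom.unit_at_def)
        also have "\<dots> = c w" using True finite_signed_perms by simp
        finally show ?thesis using True by simp
      qed (use c in simp)
    qed
  qed
  then show ?thesis using assms(2) by simp
qed

subsection \<open>Evaluation of polynomials\<close>

definition eval_mono :: "(nat \<Rightarrow> 'r) \<Rightarrow> exponent \<Rightarrow> 'r::comm_ring_1" where
  "eval_mono x \<alpha> = (\<Prod>i\<in>Poly_Mapping.keys \<alpha>. x i ^ Poly_Mapping.lookup \<alpha> i)"

lemma eval_mono_superset:
  "finite K \<Longrightarrow> Poly_Mapping.keys \<alpha> \<subseteq> K \<Longrightarrow> eval_mono x \<alpha> = (\<Prod>i\<in>K. x i ^ Poly_Mapping.lookup \<alpha> i)"
  unfolding eval_mono_def by (intro prod.mono_neutral_left) (auto simp: in_keys_iff)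

lemma eval_mono_zero [simp]: "eval_mono x 0 = 1"
  by (simp add: eval_mono_def)

lemma eval_mono_add: "eval_mono x (\<alpha> + \<gamma>) = eval_mono x \<alpha> * eval_mono x \<gamma>"
proof -
  let ?K = "Poly_Mapping.keys \<alpha> \<union> Poly_Mapping.keys \<gamma>"
  have "eval_mono x (\<alpha> + \<gamma>) = (\<Prod>i\<in>?K. x i ^ Poly_Mapping.lookup (\<alpha> + \<gamma>) i)"
    using keys_add[of \<alpha> \<gamma>] by (intro eval_mono_superset) auto
  also have "\<dots> = eval_mono x \<alpha> * eval_mono x \<gamma>"
    by (simp add: lookup_add power_add prod.distrib eval_mono_superset[of ?K])
  finally show ?thesis .
qed

lemma eval_mono_sum: "eval_mono x (\<Sum>c\<in>A. f c) = (\<Prod>c\<in>A. eval_mono x (f c))"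
  by (induction A rule: infinite_finite_induct) (simp_all add: eval_mono_add)

lemma eval_mono_single: "eval_mono x (Poly_Mapping.single i 1) = x i"
  by (simp add: eval_mono_def)

definition pos_distinct :: "nat \<Rightarrow> (nat \<Rightarrow> real) \<Rightarrow> bool" where
  "pos_distinct N x \<longleftrightarrow> inj_on x {..<N} \<and> (\<forall>i<N. 0 < x i)"

text \<open>Terms are grouped by the exponent of the last variable. For fixed values of the others,
  infinitely many values remain for it, which kills a polynomial in one variable. Distinct positive
  points are used because the comparison of rows is available only there.\<close>

lemma coefficients_zero:
  fixes c :: "'a \<Rightarrow> real" and e :: "'a \<Rightarrow> nat \<Rightarrow> nat"
  assumes "finite A" "\<And>s t. s \<in> A \<Longrightarrow> t \<in> A \<Longrightarrow> (\<And>i. i < N \<Longrightarrow> e s i = e t i) \<Longrightarrow> s = t"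
    "\<And>x. pos_distinct N x \<Longrightarrow> (\<Sum>s\<in>A. c s * (\<Prod>i<N. x i ^ e s i)) = 0" "s \<in> A"
  shows "c s = 0"
  using assms
proof (induction N arbitrary: A s)
  case 0
  then have "A = {s}" by auto
  then show ?case using "0.prems"(3)[of "\<lambda>_. 0"] by (simp add: pos_distinct_def)
next
  case (Suc N)
  let ?B = "\<lambda>j. {t \<in> A. e t N = j}"
  have "(\<Sum>t\<in>?B (e s N). c t * (\<Prod>i<N. x i ^ e t i)) = 0" if x: "pos_distinct N x" for x
  proof -
    let ?d = "\<lambda>j. \<Sum>t\<in>?B j. c t * (\<Prod>i<N. x i ^ e t i)"
    let ?J = "(\<lambda>t. e t N) ` A"
    define q where "q = (\<Sum>j\<in>?J. monom (?d j) j)"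
    have "poly q y = 0" if y: "0 < y" "y \<notin> x ` {..<N}" for y
    proof -
      have "pos_distinct (Suc N) (x(N := y))"
        using x y by (auto simp: pos_distinct_def inj_on_def lessThan_Suc less_Suc_eq)
      from Suc.prems(3)[OF this]
      have "0 = (\<Sum>t\<in>A. (c t * (\<Prod>i<N. x i ^ e t i)) * y ^ e t N)"
        by (simp add: mult.assoc)
      also have "\<dots> = (\<Sum>j\<in>?J. \<Sum>t\<in>?B j. (c t * (\<Prod>i<N. x i ^ e t i)) * y ^ e t N)"
        using Suc.prems(1) by (rule sum.image_gen)
      also have "\<dots> = poly q y"
        unfolding q_def by (simp add: poly_sum poly_monom sum_distrib_right)
      finally show ?thesis by simp
    qed
    then have "{0<..} - x ` {..<N} \<subseteq> {y. poly q y = 0}" by auto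
    moreover have "infinite ({0::real<..} - x ` {..<N})"
      by (rule Diff_infinite_finite) (simp_all add: infinite_Ioi)
    ultimately have "q = 0"
      using poly_roots_finite[of q] finite_subset by blast
    then have "coeff q (e s N) = 0" by simp
    then show ?thesis
      using Suc.prems(1,4) by (simp add: q_def coeff_sum if_distrib sum.delta cong: if_cong)
  qed
  moreover have "t = t'" if "t \<in> ?B (e s N)" "t' \<in> ?B (e s N)" "\<And>i. i < N \<Longrightarrow> e t i = e t' i" for t t'
  proof (rule Suc.prems(2))
    show "e t i = e t' i" if "i < Suc N" for i
      using \<open>t \<in> _\<close> \<open>t' \<in> _\<close> \<open>\<And>i. i < N \<Longrightarrow> e t i = e t' i\<close> that by (cases "i = N") auto
  qed (use that in auto)
  ultimately show ?case
    using Suc.prems(1,4) by (intro Suc.IH[of "?B (e s N)" s]) auto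
qed

subsection \<open>The coefficients of the infinite product\<close>

lemma lookup_mult_lin_factors:
  assumes "Poly_Mapping.lookup \<alpha> i = 0"
  shows "Poly_Mapping.lookup (P * prod_list (map (lin_factor i) js)) \<alpha> = Poly_Mapping.lookup P \<alpha>"
proof (induction js arbitrary: P)
  case (Cons j js)
  let ?s = "Poly_Mapping.single (Poly_Mapping.single i 1) (u j) :: exponent \<Rightarrow>\<^sub>0 free_algebra"
  have "\<alpha> \<notin> Poly_Mapping.keys (P * ?s)"
    using keys_mult[of P ?s] assms by (auto simp: lookup_add split: if_splits)
  then have "Poly_Mapping.lookup (P * lin_factor i j) \<alpha> = Poly_Mapping.lookup P \<alpha>"
    by (simp add: lin_factor_def distrib_left lookup_add in_keys_iff)
  then show ?case using Cons[of "P * lin_factor i j"] by (simp add: mult.assoc)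
qed simp

lemma lookup_partial_product:
  assumes "Poly_Mapping.keys \<alpha> \<subseteq> {..N}"
  shows "N \<le> M \<Longrightarrow> Poly_Mapping.lookup (partial_product n M) \<alpha> = Poly_Mapping.lookup (partial_product n N) \<alpha>"
proof (induction M rule: dec_induct)
  case (step M)
  have "Poly_Mapping.lookup \<alpha> (Suc M) = 0" using assms step(1) by (auto simp: in_keys_iff)
  then show ?case
    using step(3) by (simp add: partial_product_def var_factor_def lookup_mult_lin_factors mult.assoc[symmetric])
qed simp

lemma infinite_product_eq:
  assumes "Poly_Mapping.keys \<alpha> \<subseteq> {..N}"
  shows "infinite_product n \<alpha> = Poly_Mapping.lookup (partial_product n N) \<alpha>"
proof -
  let ?c = "Poly_Mapping.lookup (partial_product n N) \<alpha>"
  have ev: "\<forall>\<^sub>F M in sequentially. Poly_Mapping.lookup (partial_product n M) \<alpha> = ?c"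
    using lookup_partial_product[OF assms] eventually_sequentially by blast
  show ?thesis
    unfolding infinite_product_def
  proof (rule the_equality)
    show "\<forall>\<^sub>F M in sequentially. Poly_Mapping.lookup (partial_product n M) \<alpha> = ?c" by (rule ev)
  next
    fix c assume "\<forall>\<^sub>F M in sequentially. Poly_Mapping.lookup (partial_product n M) \<alpha> = c"
    from eventually_conj[OF ev this] show "c = ?c"
      by (metis (mono_tags, lifting) eventually_happens' trivial_limit_sequentially)
  qed
qed

definition bounded_coeffs :: "nat \<Rightarrow> nat \<Rightarrow> (exponent \<Rightarrow>\<^sub>0 free_algebra) \<Rightarrow> bool" where
  "bounded_coeffs n N P \<longleftrightarrow> (\<forall>\<alpha>\<in>Poly_Mapping.keys P. Poly_Mapping.keys \<alpha> \<subseteq> {..N}) \<and>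
     (\<forall>\<alpha>. Poly_Mapping.lookup P \<alpha> \<in> free_subalgebra n)"

lemma free_subalgebra_add: "p \<in> free_subalgebra n \<Longrightarrow> q \<in> free_subalgebra n \<Longrightarrow> p + q \<in> free_subalgebra n"
  using keys_add[of p q] by (auto simp: free_subalgebra_def)

lemma free_subalgebra_mult: "p \<in> free_subalgebra n \<Longrightarrow> q \<in> free_subalgebra n \<Longrightarrow> p * q \<in> free_subalgebra n"
  using keys_mult[of p q] by (fastforce simp: free_subalgebra_def plus_word_def)

lemma free_subalgebra_zero: "0 \<in> free_subalgebra n"
  by (simp add: free_subalgebra_def)

lemma free_subalgebra_one: "1 \<in> free_subalgebra n"
  by (simp add: free_subalgebra_def zero_word_def)

lemma free_subalgebra_sum: "(\<And>x. x \<in> A \<Longrightarrow> f x \<in> free_subalgebra n) \<Longrightarrow> sum f A \<in> free_subalgebra n"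
  by (induction A rule: infinite_finite_induct) (auto intro: free_subalgebra_zero free_subalgebra_add)

lemma bounded_coeffs_mult:
  assumes "bounded_coeffs n N P" "bounded_coeffs n N Q"
  shows "bounded_coeffs n N (P * Q)"
proof -
  have "Poly_Mapping.keys \<alpha> \<subseteq> {..N}" if \<alpha>: "\<alpha> \<in> Poly_Mapping.keys (P * Q)" for \<alpha>
  proof -
    obtain \<gamma> \<delta> where "\<alpha> = \<gamma> + \<delta>" "\<gamma> \<in> Poly_Mapping.keys P" "\<delta> \<in> Poly_Mapping.keys Q"
      using \<alpha> keys_mult[of P Q] by blast
    then show ?thesis using assms keys_add[of \<gamma> \<delta>] unfolding bounded_coeffs_def by blast
  qed
  moreover have "Poly_Mapping.lookup (P * Q) \<alpha> \<in> free_subalgebra n" for \<alpha>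
  proof -
    have "P * Q = (\<Sum>k\<in>Poly_Mapping.keys P. \<Sum>l\<in>Poly_Mapping.keys Q.
        Poly_Mapping.single (k + l) (Poly_Mapping.lookup P k * Poly_Mapping.lookup Q l))"
      by (subst (1) poly_mapping_sum_single[of P], subst (1) poly_mapping_sum_single[of Q])
        (simp add: sum_product mult_single)
    moreover have "Poly_Mapping.lookup (Poly_Mapping.single (k + l) (Poly_Mapping.lookup P k * Poly_Mapping.lookup Q l)) \<alpha> \<in> free_subalgebra n" for k l
      using assms by (auto simp: lookup_single when_def bounded_coeffs_def intro: free_subalgebra_mult free_subalgebra_zero)
    ultimately show ?thesis
      by (simp add: lookup_sum free_subalgebra_sum)
  qed
  ultimately show ?thesis by (simp add: bounded_coeffs_def)
qed

lemma bounded_coeffs_prod_list: "(\<And>P. P \<in> set Ps \<Longrightarrow> bounded_coeffs n N P) \<Longrightarrow> bounded_coeffs n N (prod_list Ps)"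
proof (induction Ps)
  case Nil
  then show ?case
    by (auto simp: bounded_coeffs_def lookup_one when_def intro: free_subalgebra_zero free_subalgebra_one)
qed (simp add: bounded_coeffs_mult)

lemma bounded_coeffs_lin_factor: "i \<le> N \<Longrightarrow> j < n \<Longrightarrow> bounded_coeffs n N (lin_factor i j)"
  using keys_add[of 1 "Poly_Mapping.single (Poly_Mapping.single i 1) (u j) :: exponent \<Rightarrow>\<^sub>0 free_algebra"]
  by (auto simp: bounded_coeffs_def lin_factor_def lookup_add lookup_one lookup_single when_def split: if_splits
      intro!: free_subalgebra_add free_subalgebra_u free_subalgebra_zero free_subalgebra_one)

lemma bounded_coeffs_partial_product: "bounded_coeffs n N (partial_product n N)"
  unfolding partial_product_def
proof (rule bounded_coeffs_prod_list)
  fix P assume "P \<in> set (map (var_factor n) [1..<Suc N])"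
  then obtain i where i: "i \<le> N" and P: "P = var_factor n i"
    by (auto simp: less_Suc_eq_le simp del: upt_Suc)
  show "bounded_coeffs n N P"
    unfolding P var_factor_def
    using i by (intro bounded_coeffs_mult bounded_coeffs_prod_list) (auto intro: bounded_coeffs_lin_factor)
qed

subsection \<open>Subsets as Grassmannian permutations\<close>

context site_model
begin

text \<open>The minimal coset representative that maps \<open>k + S\<close> increasingly onto \<open>{k + 1, \<dots>, k + a}\<close>.\<close>

definition place :: "nat \<Rightarrow> nat \<Rightarrow> nat set \<Rightarrow> nat \<Rightarrow> nat" where
  "place a k S j = (if j \<le> k then j else if j - k \<in> S then k + cnt S (j - k) else a + j - cnt S (j - k))"

definition subset_perm :: "nat \<Rightarrow> nat \<Rightarrow> nat set \<Rightarrow> int \<Rightarrow> int" where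
  "subset_perm a k S i = sgn i * int (place a k S (nat \<bar>i\<bar>))"

definition subsets :: "nat \<Rightarrow> nat \<Rightarrow> nat set set" where
  "subsets a m = {S. S \<subseteq> {1..m} \<and> card S = a}"

lemma subset_perm_nat: "subset_perm a k S (int j) = int (place a k S j)"
  by (cases "j = 0") (simp_all add: subset_perm_def place_def)

lemma subset_perm_uminus: "subset_perm a k S (- i) = - subset_perm a k S i"
  by (simp add: subset_perm_def)

lemma cnt_le: "cnt S j \<le> j"
  using card_mono[of "{1..j}" "S \<inter> {1..j}"] by (simp add: cnt_def)

lemma cnt_le_card: "S \<in> subsets a m \<Longrightarrow> cnt S j \<le> a"
  using card_mono[of S "S \<inter> {1..j}"] finite_subset[of S "{1..m}"] by (auto simp: cnt_def subsets_def)

lemma cnt_0: "cnt S 0 = 0"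
  by (simp add: cnt_def)

text \<open>Values increase along \<open>S\<close> and along its complement, and \<open>S\<close>
  carries the smaller ones. So a descent is a position of the complement directly before one of
  \<open>S\<close>, which is the condition for a move in \<open>hop\<close>.\<close>

lemma des_subset_perm:
  assumes "S \<in> subsets a m" "0 < k"
  shows "des i (subset_perm a k S) \<longleftrightarrow> k < i \<and> i - k \<notin> S \<and> Suc (i - k) \<in> S"
proof -
  have d: "des i (subset_perm a k S) \<longleftrightarrow> 0 < i \<and> place a k S i > place a k S (Suc i)"
    using subset_perm_nat[of a k S 1] subset_perm_nat[of a k S i] subset_perm_nat[of a k S "Suc i"]
    by (auto simp: des_def add.commute)
  show ?thesis
  proof (cases "k < i")
    case False
    then have "place a k S i \<le> place a k S (Suc i)"
      by (auto simp: place_def Suc_diff_le cnt_Suc cnt_0)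
    then show ?thesis using d False by auto
  next
    case True
    define t where "t = i - k"
    then have i: "i = k + t" "0 < t" using True by auto
    have "cnt S (Suc t) \<le> a" "cnt S t \<le> t" "cnt S t \<le> a" using cnt_le_card[OF assms(1)] cnt_le by auto
    moreover have "cnt S t < t" if "t \<notin> S"
      using that i(2) cnt_Suc[of S "t - 1"] cnt_le[of S "t - 1"] by (cases t) auto
    ultimately show ?thesis
      using i unfolding d by (auto simp: place_def cnt_Suc split: if_splits)
  qed
qed

lemma subset_perm_comp_gen:
  assumes "k < i" "i - k \<notin> S" "Suc (i - k) \<in> S"
  shows "subset_perm a k S \<circ> gen i = subset_perm a k (insert (i - k) (S - {Suc (i - k)}))"
proof
  fix x
  obtain t where i: "i = k + t" "0 < t" using less_imp_add_positive[OF assms(1)] by blast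
  then have t: "t \<notin> S" "Suc t \<in> S" using assms by simp_all
  let ?S = "insert t (S - {Suc t})"
  have c: "cnt ?S j = (if j = t then Suc (cnt S t) else cnt S j)" for j
    using cnt_move[OF t i(2)] .
  have "subset_perm a k S (gen i x) = subset_perm a k ?S x"
  proof (rule odd_eqI[where f = "\<lambda>x. subset_perm a k S (gen i x)" and g = "\<lambda>x. subset_perm a k ?S x"])
    fix x :: int assume "0 \<le> x"
    then obtain j where x: "x = int j" using nonneg_int_cases by blast
    let ?j = "if j = i then Suc i else if j = Suc i then i else j"
    have "gen i x = int ?j"
      using i by (simp add: gen_nonneg x)
    moreover have "place a k S ?j = place a k ?S j"
    proof (cases "j \<le> k")
      case True
      then show ?thesis using i by (simp add: place_def)
    next
      case False
      then obtain s where "j = k + s" "0 < s" by (metis less_imp_add_positive not_le)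
      then show ?thesis using i t by (auto simp: place_def c cnt_Suc)
    qed
    ultimately show "subset_perm a k S (gen i x) = subset_perm a k ?S x"
      by (simp only: subset_perm_nat x)
  qed (simp_all add: gen_uminus subset_perm_uminus)
  then show "(subset_perm a k S \<circ> gen i) x = subset_perm a k (insert (i - k) (S - {Suc (i - k)})) x"
    using i by simp
qed

lemma subsets_move:
  assumes "S \<in> subsets a m" "0 < t" "t \<notin> S" "Suc t \<in> S"
  shows "insert t (S - {Suc t}) \<in> subsets a m"
proof -
  have "finite S" using assms(1) finite_subset[of S "{1..m}"] by (auto simp: subsets_def)
  moreover have "Suc (card S - 1) = card S" using assms(4) \<open>finite S\<close> by (metis Suc_diff_1 card_gt_0_iff empty_iff)
  ultimately show ?thesis using assms by (auto simp: subsets_def)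
qed

lemma place_initial: "place a k {1..a} j = j"
  unfolding place_def cnt_initial by auto

lemma subset_perm_eq_id:
  assumes "S \<in> subsets a m"
  shows "subset_perm a k S = id \<longleftrightarrow> S = {1..a}"
proof
  assume id: "subset_perm a k S = id"
  have "t \<le> a" if "t \<in> S" for t
  proof -
    have "0 < t" using assms that by (auto simp: subsets_def)
    then have "place a k S (k + t) = k + cnt S t" using that by (simp add: place_def)
    moreover have "place a k S (k + t) = k + t"
      using subset_perm_nat[of a k S "k + t"] unfolding id by simp
    ultimately show ?thesis using cnt_le_card[OF assms, of t] by simp
  qed
  then have "S \<subseteq> {1..a}" using assms by (auto simp: subsets_def)
  then show "S = {1..a}" using assms card_subset_eq[of "{1..a}" S] by (simp add: subsets_def)
next
  assume S: "S = {1..a}"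
  show "subset_perm a k S = id"
    unfolding S subset_perm_def place_initial by (simp add: fun_eq_iff sgn_mult_abs)
qed

lemma w_perm_apply:
  "w_perm a b k i = (if \<bar>i\<bar> \<le> int k then i else if \<bar>i\<bar> \<le> int (b + k) then i + sgn i * int a
     else if \<bar>i\<bar> \<le> int (a + b + k) then i - sgn i * int b else i)"
proof -
  obtain j where j: "\<bar>i\<bar> = int j" using nonneg_int_cases[of "\<bar>i\<bar>"] by force
  let ?xs = "[1..int k] @ [int (a + k) + 1..int (a + b + k)] @ [int k + 1..int (a + k)]"
  have "?xs ! (j - 1) = (if j \<le> k then int j else if j \<le> b + k then int j + int a else int j - int b)"
    if "1 \<le> j" "j \<le> a + b + k"
    using that by (auto simp: nth_append)
  moreover have "i = sgn i * int j" using j by (metis sgn_mult_abs)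
  ultimately show ?thesis
    using j by (cases "j = 0") (auto simp: w_perm_def one_line_def Let_def algebra_simps)
qed

lemma w_perm_signed_perms: "w_perm a b k \<in> signed_perms (a + b + k)"
proof -
  let ?w = "w_perm a b k"
  define v where "v i = (if \<bar>i\<bar> \<le> int k then i else if \<bar>i\<bar> \<le> int (a + k) then i + sgn i * int b
     else if \<bar>i\<bar> \<le> int (a + b + k) then i - sgn i * int a else i)" for i :: int
  have "v (?w i) = i" "?w (v i) = i" for i
    by (cases "0 < i"; cases "i = 0"; auto simp: v_def w_perm_apply split: if_splits)+
  then have "\<exists>!i. ?w i = j" for j by metis
  moreover have "?w i = i" if "i \<notin> domain (a + b + k)" for i using that by (auto simp: w_perm_apply)
  moreover have "?w (- i) = - ?w i" for i by (simp add: w_perm_apply)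
  ultimately show ?thesis unfolding signed_perms_def permutes_def by blast
qed

lemma cnt_block: "cnt (block a b) t = min a (t - b)"
proof -
  have "block a b \<inter> {1..t} = {Suc b..min (b + a) t}" by (auto simp: block_def)
  then show ?thesis by (auto simp: cnt_def)
qed

lemma block_subsets: "block a b \<in> subsets a (a + b)"
  by (auto simp: subsets_def block_def)

lemma subset_perm_block: "subset_perm a k (block a b) = w_perm a b k"
proof
  fix i
  obtain j where j: "\<bar>i\<bar> = int j" using nonneg_int_cases[of "\<bar>i\<bar>"] by force
  have s: "i = sgn i * int j" using j by (metis sgn_mult_abs)
  have "int (place a k (block a b) j) = (if j \<le> k then int j else if j \<le> b + k then int j + int a
     else if j \<le> a + b + k then int j - int b else int j)"
    unfolding place_def cnt_block by (auto simp: block_def)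
  then show "subset_perm a k (block a b) i = w_perm a b k i"
    using s j by (auto simp: subset_perm_def w_perm_apply algebra_simps)
qed

end

subsection \<open>The product acting on functions of subsets\<close>

context site_model
begin

definition eval_beta :: "int poly \<Rightarrow> real" where
  "eval_beta p = poly (map_poly real_of_int p) \<beta>"

lemma eval_beta_add: "eval_beta (p + q) = eval_beta p + eval_beta q"
proof -
  have "map_poly real_of_int (p + q) = map_poly real_of_int p + map_poly real_of_int q"
    by (rule poly_eqI) (simp add: coeff_map_poly)
  then show ?thesis by (simp add: eval_beta_def)
qed

lemma eval_beta_mult: "eval_beta (p * q) = eval_beta p * eval_beta q"
proof -
  have "map_poly real_of_int (p * q) = map_poly real_of_int p * map_poly real_of_int q"
    by (rule poly_eqI) (simp add: coeff_map_poly coeff_mult)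
  then show ?thesis by (simp add: eval_beta_def)
qed

sublocale real_hom: ring_hom_beta eval_beta
  by unfold_locales (simp_all add: eval_beta_add eval_beta_mult, simp_all add: eval_beta_def)

lemma eval_beta_beta: "eval_beta beta = \<beta>"
  by (simp add: eval_beta_def map_poly_pCons)

lemma eval_beta_sum: "eval_beta (sum f A) = (\<Sum>x\<in>A. eval_beta (f x))"
  by (induction A rule: infinite_finite_induct) (simp_all add: real_hom.hom_zero eval_beta_add)

lemma eval_beta_power: "eval_beta (p ^ n) = eval_beta p ^ n"
  by (induction n) (simp_all add: real_hom.hom_one eval_beta_mult)

lemma eval_beta_wop: "eval_beta (int_hom.wop as f w) = real_hom.wop as (\<lambda>v. eval_beta (f v)) w"
proof (induction as arbitrary: f)
  case (Cons i as)
  have "(\<lambda>v. eval_beta (int_hom.uop i f v)) = real_hom.uop i (\<lambda>v. eval_beta (f v))"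
    by (rule ext) (simp add: int_hom.uop_def real_hom.uop_def eval_beta_add eval_beta_mult real_hom.hom_zero del: mult_pCons_left)
  then show ?case using Cons[of "int_hom.uop i f"] by simp
qed simp

lemma eval_beta_act:
  "eval_beta (int_hom.act p (int_hom.unit_at v) w) = real_hom.act p (real_hom.unit_at v) w"
proof -
  have "(\<lambda>w. eval_beta (int_hom.unit_at v w)) = real_hom.unit_at v"
    by (rule ext) (simp add: int_hom.unit_at_def real_hom.unit_at_def real_hom.hom_zero real_hom.hom_one)
  then show ?thesis
    by (simp add: int_hom.act_def real_hom.act_def eval_beta_sum eval_beta_mult eval_beta_wop)
qed

end

locale site_evaluation = site_model +
  fixes x :: "nat \<Rightarrow> real"
begin

sublocale series: monomial_action "\<lambda>\<alpha> p f w. eval_mono x \<alpha> * real_hom.act p f w"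
  by unfold_locales
    (simp_all add: real_hom.act_add real_hom.act_fun_zero real_hom.act_fun_add real_hom.act_fun_scale
      real_hom.act_mult eval_mono_add algebra_simps fun_eq_iff)

lemma act_lin_factor: "series.act (lin_factor i j) f w = f w + x i * real_hom.uop j f w"
  by (simp add: lin_factor_def series.act_add series.act_single eval_mono_single real_hom.act_u del: One_nat_def)

context
  fixes a b k :: nat
  assumes k: "0 < k"
begin

definition agree :: "((int \<Rightarrow> int) \<Rightarrow> real) \<Rightarrow> vec \<Rightarrow> bool" where
  "agree f F \<longleftrightarrow> (\<forall>S\<in>subsets a (a + b). f (subset_perm a k S) = F S)"

text \<open>A descent of such a permutation leads to another one of the same kind, so restriction to
  them is compatible with every \<open>u j\<close>; for \<open>j \<le> k\<close> there is no descent
  and \<open>u j\<close> acts by zero.\<close>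

lemma agree_lin_factor:
  assumes "agree f F"
  shows "agree (series.act (lin_factor i j) f) (if k < j then hop (j - k) (x i) F else F)"
  unfolding agree_def
proof
  fix S assume S: "S \<in> subsets a (a + b)"
  show "series.act (lin_factor i j) f (subset_perm a k S) = (if k < j then hop (j - k) (x i) F else F) S"
  proof (cases "k < j \<and> j - k \<notin> S \<and> Suc (j - k) \<in> S")
    case True
    then have "insert (j - k) (S - {Suc (j - k)}) \<in> subsets a (a + b)"
      using subsets_move[OF S, of "j - k"] by simp
    then show ?thesis
      using assms S True subset_perm_comp_gen[of k j S a] des_subset_perm[OF S k, of j]
      by (simp add: act_lin_factor real_hom.uop_def hop_def agree_def eval_beta_beta algebra_simps)
  next
    case False
    then show ?thesis
      using assms S des_subset_perm[OF S k, of j]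
      by (auto simp: act_lin_factor real_hom.uop_def hop_def agree_def)
  qed
qed

lemma agree_trivial_factors:
  "\<forall>j\<in>set js. j \<le> k \<Longrightarrow> agree f F \<Longrightarrow> agree (fold series.act (map (lin_factor i) js) f) F"
proof (induction js arbitrary: f)
  case (Cons j js)
  then show ?case using agree_lin_factor[OF Cons.prems(2), of i j] by simp
qed simp

lemma agree_down:
  "agree f F \<Longrightarrow> agree (fold series.act (map (lin_factor i) [0..<Suc (k + m)]) f) (down m (x i) F)"
proof (induction m)
  case 0
  then show ?case using agree_trivial_factors[of "[0..<Suc k]" f F i] by simp
next
  case (Suc m)
  show ?case using agree_lin_factor[OF Suc.IH[OF Suc.prems], of i "Suc (k + m)"] by simp
qed

lemma agree_up:
  "agree f F \<Longrightarrow> agree (fold series.act (map (lin_factor i) (rev [0..<Suc (k + m)])) f) (up m (x i) F)"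
proof (induction m arbitrary: f F)
  case 0
  then show ?case using agree_trivial_factors[of "rev [0..<Suc k]" f F i] by simp
next
  case (Suc m)
  show ?case using Suc.IH[OF agree_lin_factor[OF Suc.prems, of i "Suc (k + m)"]] by simp
qed

lemma agree_partial_product:
  assumes "0 < a"
  shows "agree f F \<Longrightarrow> agree (series.act (partial_product (a + b + k) N) f)
    (rows False (a + b - 1) (map x (rev [1..<Suc N])) F)"
proof (induction N)
  case 0
  then show ?case by (simp add: partial_product_def)
next
  case (Suc N)
  let ?P = "partial_product (a + b + k) N"
  have n: "a + b + k = Suc (k + (a + b - 1))" using assms by simp
  have "partial_product (a + b + k) (Suc N) = ?P * var_factor (a + b + k) (Suc N)"
    by (simp add: partial_product_def)
  then have "series.act (partial_product (a + b + k) (Suc N)) f =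
      fold series.act (map (lin_factor (Suc N)) [0..<a + b + k])
       (fold series.act (map (lin_factor (Suc N)) (rev [0..<a + b + k])) (series.act ?P f))"
    by (simp add: fun_eq_iff series.act_mult var_factor_def series.act_prod_list)
  then show ?case
    using agree_down[OF agree_up[OF Suc.IH[OF Suc.prems], of "Suc N" "a + b - 1"], of "Suc N" "a + b - 1"]
    by (simp add: n row_def wall_def del: upt_Suc) (simp add: row_def wall_def)
qed

lemma act_partial_product:
  assumes "0 < a"
  shows "series.act (partial_product (a + b + k) N) (real_hom.unit_at id) (w_perm a b k) =
    rows False (a + b - 1) (map x (rev [1..<Suc N])) (unit_vec {1..a}) (block a b)"
proof -
  have "agree (real_hom.unit_at id) (unit_vec {1..a})"
    using subset_perm_eq_id by (auto simp: agree_def real_hom.unit_at_def unit_vec_def)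
  from agree_partial_product[OF assms this, of N] show ?thesis
    using block_subsets[of a b] unfolding agree_def subset_perm_block[symmetric] by blast
qed

end

end

subsection \<open>Generating functions of tableaux\<close>

lemma card_shifted_diagram: "card (shifted_diagram lam) = sum_list lam"
proof -
  have "shifted_diagram lam = (SIGMA i:{1..length lam}. {i..lam ! (i - 1) + i - 1})"
    by (auto simp: shifted_diagram_def)
  then have "card (shifted_diagram lam) = (\<Sum>i = 1..length lam. lam ! (i - 1))"
    by (simp add: card_SigmaI)
  also have "\<dots> = sum_list lam"
    by (simp add: sum.atLeast1_atMost_eq sum_list_sum_nth atLeast0LessThan)
  finally show ?thesis .
qed

lemma finite_shifted_diagram: "finite (shifted_diagram lam)"
proof -
  have "shifted_diagram lam = (SIGMA i:{1..length lam}. {i..lam ! (i - 1) + i - 1})"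
    by (auto simp: shifted_diagram_def)
  then show ?thesis by simp
qed

lemma keys_sum_exponent:
  fixes f :: "'a \<Rightarrow> exponent"
  assumes "finite A"
  shows "Poly_Mapping.keys (sum f A) = (\<Union>c\<in>A. Poly_Mapping.keys (f c))"
  using assms by (auto simp: set_eq_iff in_keys_iff lookup_sum)

lemma shifted_tableaux_entry:
  assumes "T \<in> shifted_tableaux lam" "p \<in> shifted_diagram lam"
  shows "finite (T p)" "T p \<noteq> {}"
  using assms by (auto simp: shifted_tableaux_def PiE_iff)

lemma keys_tableau_weight:
  assumes "T \<in> shifted_tableaux lam"
  shows "Poly_Mapping.keys (tableau_weight lam T) = (\<Union>p\<in>shifted_diagram lam. (\<lambda>s. nat \<bar>s\<bar>) ` T p)"
  unfolding tableau_weight_def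
  using shifted_tableaux_entry(1)[OF assms] by (auto simp: keys_sum_exponent finite_shifted_diagram)

lemma tableau_weight_bounded:
  assumes "T \<in> shifted_tableaux lam"
  shows "Poly_Mapping.keys (tableau_weight lam T) \<subseteq> {..N} \<longleftrightarrow>
    (\<forall>p\<in>shifted_diagram lam. \<forall>s\<in>T p. \<bar>s\<bar> \<le> int N)"
  unfolding keys_tableau_weight[OF assms] UN_subset_iff image_subset_iff atMost_iff nat_le_iff ..

lemma finite_letters: "finite {(s, c). s \<noteq> 0 \<and> \<bar>s\<bar> \<le> int N \<and> c < (n::nat)}"
  by (rule finite_subset[of _ "{- int N..int N} \<times> {..<n}"]) auto

context site_evaluation
begin

lemma weight_eq:
  assumes "strict_partition lam" "T \<in> shifted_tableaux lam"
  shows "weight x (set lam) T =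
    eval_beta (beta ^ (tableau_size lam T - sum_list lam)) * eval_mono x (tableau_weight lam T)"
proof -
  let ?D = "shifted_diagram lam"
  have "1 \<le> card (T p)" if "p \<in> ?D" for p
    using shifted_tableaux_entry[OF assms(2) that] by (simp add: Suc_leI card_gt_0_iff)
  then have "tableau_size lam T - sum_list lam = (\<Sum>p\<in>?D. card (T p) - 1)"
    unfolding tableau_size_def card_shifted_diagram[symmetric] card_eq_sum
    by (intro sum_subtractf_nat[symmetric]) auto
  then have "eval_beta (beta ^ (tableau_size lam T - sum_list lam)) = (\<Prod>p\<in>?D. \<beta> ^ (card (T p) - 1))"
    by (simp only: eval_beta_power eval_beta_beta) (simp only: power_sum)
  moreover have "eval_mono x (tableau_weight lam T) = (\<Prod>p\<in>?D. \<Prod>s\<in>T p. x (nat \<bar>s\<bar>))"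
    by (simp only: tableau_weight_def eval_mono_sum eval_mono_single)
  ultimately show ?thesis
    by (simp add: weight_def shifted_diagram_cells[OF assms(1)] prod.distrib)
qed

lemma sum_GQ:
  assumes lam: "strict_partition lam" "\<forall>t\<in>set lam. t \<le> Suc m" and A: "finite A"
    and bd: "\<And>\<alpha>. \<alpha> \<in> A \<Longrightarrow> Poly_Mapping.keys \<alpha> \<subseteq> {..N}"
    and sub: "\<And>T. T \<in> shifted_tableaux lam \<Longrightarrow> Poly_Mapping.keys (tableau_weight lam T) \<subseteq> {..N} \<Longrightarrow> tableau_weight lam T \<in> A"
  shows "(\<Sum>\<alpha>\<in>A. eval_beta (GQ lam \<alpha>) * eval_mono x \<alpha>) =
    rows True m (map x (rev [1..<Suc N])) (unit_vec {}) (set lam)"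
proof -
  let ?B = "{T \<in> shifted_tableaux lam. \<forall>p\<in>shifted_diagram lam. \<forall>s\<in>T p. \<bar>s\<bar> \<le> int N}"
  let ?E = "{(s, c). s \<noteq> 0 \<and> \<bar>s\<bar> \<le> int N \<and> c < Suc m}"
  have B: "T \<in> ?B \<longleftrightarrow> T \<in> shifted_tableaux lam \<and> Poly_Mapping.keys (tableau_weight lam T) \<subseteq> {..N}" for T
    using tableau_weight_bounded by blast
  have E: "?B = tableaux ?E (set lam)"
    using shifted_tableaux_bounded[OF lam] .
  have fin: "finite ?B" unfolding E by (simp add: finite_tableaux finite_letters)
  have "(\<Sum>\<alpha>\<in>A. eval_beta (GQ lam \<alpha>) * eval_mono x \<alpha>) =
    (\<Sum>\<alpha>\<in>A. \<Sum>T\<in>{T \<in> ?B. tableau_weight lam T = \<alpha>}. weight x (set lam) T)"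
  proof (rule sum.cong)
    fix \<alpha> assume "\<alpha> \<in> A"
    then have "{T \<in> shifted_tableaux lam. tableau_weight lam T = \<alpha>} = {T \<in> ?B. tableau_weight lam T = \<alpha>}"
      using bd B by blast
    then show "eval_beta (GQ lam \<alpha>) * eval_mono x \<alpha> = (\<Sum>T\<in>{T \<in> ?B. tableau_weight lam T = \<alpha>}. weight x (set lam) T)"
      using weight_eq[OF lam(1)] by (simp add: GQ_def eval_beta_sum sum_distrib_right)
  qed simp
  also have "\<dots> = (\<Sum>T\<in>?B. weight x (set lam) T)"
    using fin A sub B by (intro sum.group) auto
  also have "\<dots> = tableau_sum x ?E (set lam)"
    by (simp only: tableau_sum_def E)
  also have "\<dots> = rows True m (map x (rev [1..<Suc N])) (unit_vec {}) (set lam)"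
    using lam by (intro tableau_sum_rows) (auto simp: strict_partition_def)
  finally show ?thesis .
qed

lemma sum_GC:
  assumes "0 < a" "0 < k" and A: "finite A" "\<And>\<alpha>. \<alpha> \<in> A \<Longrightarrow> Poly_Mapping.keys \<alpha> \<subseteq> {..N}"
    "Poly_Mapping.keys (partial_product (a + b + k) N) \<subseteq> A"
  shows "(\<Sum>\<alpha>\<in>A. eval_beta (GC (a + b + k) (w_perm a b k) \<alpha>) * eval_mono x \<alpha>) =
    rows False (a + b - 1) (map x (rev [1..<Suc N])) (unit_vec {1..a}) (block a b)"
proof -
  let ?P = "partial_product (a + b + k) N" and ?w = "w_perm a b k"
  have "eval_beta (GC (a + b + k) ?w \<alpha>) = real_hom.act (Poly_Mapping.lookup ?P \<alpha>) (real_hom.unit_at id) ?w"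
    if "\<alpha> \<in> A" for \<alpha>
  proof -
    have "Poly_Mapping.lookup ?P \<alpha> \<in> free_subalgebra (a + b + k)"
      using bounded_coeffs_partial_product[of "a + b + k" N] by (simp add: bounded_coeffs_def)
    then show ?thesis
      by (simp add: GC_def infinite_product_eq[OF A(2)[OF that]] u_coeff_eq w_perm_signed_perms eval_beta_act)
  qed
  then have "(\<Sum>\<alpha>\<in>A. eval_beta (GC (a + b + k) ?w \<alpha>) * eval_mono x \<alpha>) =
      (\<Sum>\<alpha>\<in>A. eval_mono x \<alpha> * real_hom.act (Poly_Mapping.lookup ?P \<alpha>) (real_hom.unit_at id) ?w)"
    by (intro sum.cong) (simp_all add: mult.commute)
  also have "\<dots> = series.act ?P (real_hom.unit_at id) ?w"
    using A by (simp add: series.act_superset)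
  finally show ?thesis
    using act_partial_product[OF assms(2,1), of b N] by simp
qed

end

section \<open>Comparison of the two series\<close>

lemma eval_beta_GC_GQ:
  assumes "0 < a" "0 < k" "a \<le> b" "0 < \<beta>"
  shows "site_model.eval_beta \<beta> (GC (a + b + k) (w_perm a b k) \<alpha>) = site_model.eval_beta \<beta> (GQ (tau a b) \<alpha>)"
proof -
  interpret site_model \<beta> by unfold_locales (rule assms)
  obtain N where N: "Poly_Mapping.keys \<alpha> \<subseteq> {..N}"
    using finite_keys[of \<alpha>] finite_nat_iff_bounded_le by blast
  let ?P = "partial_product (a + b + k) N" and ?lam = "tau a b" and ?w = "w_perm a b k"
  let ?X = "{T \<in> shifted_tableaux ?lam. Poly_Mapping.keys (tableau_weight ?lam T) \<subseteq> {..N}}"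
  \<comment> \<open>A finite set containing every exponent in variables up to \<open>N\<close> that
    contributes to either series, so that both sums over \<open>A\<close> are complete
    truncations.\<close>
  define A where "A = insert \<alpha> (Poly_Mapping.keys ?P \<union> tableau_weight ?lam ` ?X)"
  have lam: "strict_partition ?lam" "set ?lam = steps (b - a + 1) a"
    using strict_partition_tau set_tau assms by simp_all
  have bound: "\<forall>t\<in>set ?lam. t \<le> Suc (a + b - 1)" by (auto simp: tau_def)
  have "?X = {T \<in> shifted_tableaux ?lam. \<forall>p\<in>shifted_diagram ?lam. \<forall>s\<in>T p. \<bar>s\<bar> \<le> int N}"
    using tableau_weight_bounded by blast
  also have "\<dots> = tableaux {(s, c). s \<noteq> 0 \<and> \<bar>s\<bar> \<le> int N \<and> c < Suc (a + b - 1)} (set ?lam)"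
    by (rule shifted_tableaux_bounded[OF lam(1) bound])
  also have "finite \<dots>"
    by (intro finite_tableaux finite_letters finite_set)
  finally have fin: "finite A" by (simp add: A_def)
  have bd: "Poly_Mapping.keys \<gamma> \<subseteq> {..N}" if "\<gamma> \<in> A" for \<gamma>
    using that N bounded_coeffs_partial_product[of "a + b + k" N] by (auto simp: A_def bounded_coeffs_def)
  let ?c = "\<lambda>\<gamma>. eval_beta (GC (a + b + k) ?w \<gamma>) - eval_beta (GQ ?lam \<gamma>)"
  have "?c \<alpha> = 0"
  \<comment> \<open>\<open>Suc N\<close> because the indices \<open>0, ..., N\<close> are
    counted.\<close>
  proof (rule coefficients_zero[OF fin, of "Suc N" Poly_Mapping.lookup ?c])
    fix s t assume "s \<in> A" "t \<in> A" "\<And>i. i < Suc N \<Longrightarrow> Poly_Mapping.lookup s i = Poly_Mapping.lookup t i"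
    then show "s = t"
      using bd[of s] bd[of t] by (intro poly_mapping_eqI) (metis atMost_iff in_keys_iff less_Suc_eq_le subsetD)
  next
    fix x assume x: "pos_distinct (Suc N) x"
    interpret site_evaluation \<beta> x ..
    let ?xs = "map x (rev [1..<Suc N])"
    have "inj_on x {1..<Suc N}" using x by (auto simp: pos_distinct_def intro: inj_on_subset)
    then have "distinct ?xs" by (simp add: distinct_map del: upt_Suc)
    moreover have "\<forall>z\<in>set ?xs. 0 < z" using x by (auto simp: pos_distinct_def simp del: upt_Suc)
    ultimately have rows: "rows False (a + b - 1) ?xs (unit_vec {1..a}) (block a b) =
        rows True (a + b - 1) ?xs (unit_vec {}) (set ?lam)"
      using rows_block_eq_rows_steps[of a b ?xs] assms by (simp only: lam(2))
    have "(\<Sum>\<gamma>\<in>A. eval_beta (GC (a + b + k) ?w \<gamma>) * eval_mono x \<gamma>) =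
        rows False (a + b - 1) ?xs (unit_vec {1..a}) (block a b)"
      using assms(1,2) by (intro sum_GC fin bd) (auto simp: A_def)
    moreover have "(\<Sum>\<gamma>\<in>A. eval_beta (GQ ?lam \<gamma>) * eval_mono x \<gamma>) =
        rows True (a + b - 1) ?xs (unit_vec {}) (set ?lam)"
      by (rule sum_GQ[OF lam(1) bound fin bd]) (auto simp: A_def)
    ultimately have "(\<Sum>\<gamma>\<in>A. ?c \<gamma> * eval_mono x \<gamma>) = 0"
      by (simp only: left_diff_distrib sum_subtractf rows diff_self)
    moreover have "eval_mono x \<gamma> = (\<Prod>i<Suc N. x i ^ Poly_Mapping.lookup \<gamma> i)" if "\<gamma> \<in> A" for \<gamma>
      using bd[OF that] by (intro eval_mono_superset) (auto simp: lessThan_Suc_atMost)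
    ultimately show "(\<Sum>s\<in>A. ?c s * (\<Prod>i<Suc N. x i ^ Poly_Mapping.lookup s i)) = 0"
      by simp
  qed (simp add: A_def)
  then show ?thesis by simp
qed

theorem corollary3p6:
  fixes a b k :: nat
  assumes "0 < a" and "0 < b" and "0 < k" and "a \<le> b"
  shows "GC (a + b + k) (w_perm a b k) = GQ (tau a b)"
proof
  fix \<alpha>
  let ?p = "GC (a + b + k) (w_perm a b k) \<alpha>" and ?q = "GQ (tau a b) \<alpha>"
  let ?r = "map_poly real_of_int ?p - map_poly real_of_int ?q"
  have "poly ?r \<beta> = 0" if "0 < \<beta>" for \<beta>
  proof -
    interpret site_model \<beta> by unfold_locales (rule that)
    show ?thesis
      using eval_beta_GC_GQ[OF assms(1,3,4) that, of \<alpha>] by (simp add: eval_beta_def)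
  qed
  \<comment> \<open>Agreement at the infinitely many positive values of \<open>\<beta>\<close>
    identifies the coefficient polynomials.\<close>
  then have "{0<..} \<subseteq> {\<beta>. poly ?r \<beta> = 0}" by auto
  then have "?r = 0"
    using poly_roots_finite[of ?r] finite_subset infinite_Ioi[of "0::real"] by blast
  then have "coeff (map_poly real_of_int ?p) i = coeff (map_poly real_of_int ?q) i" for i
    by simp
  then show "?p = ?q"
    by (intro poly_eqI) (simp add: coeff_map_poly)
qed

end
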